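(* There exists no entire transcendental function $f\colon\mathbb{C}\to\mathbb{C}$ in class $\mathcal{S}$ such that the multipliers of all repelling periodic orbits of $f$ are real.
   Context: An entire transcendental function is an entire function $f\colon\mathbb{C}\to\mathbb{C}$ that is not a polynomial. A singular value of $f$ is a critical value or a finite asymptotic value of $f$ (a finite asymptotic value is a point $a\in\mathbb{C}$ such that $f(\alpha(t))\to a$ along some curve $\alpha(t)\to\infty$). The function $f$ belongs to class $\mathcal{S}$ if it has only finitely many singular values. If $p$ is a periodic point of $f$ of period $n$, the multiplier of its orbit is $(f^n)'(p)$; the orbit is repelling if $|(f^n)'(p)|>1$. *)

theory Defs
  imports "HOL-Complex_Analysis.Complex_Analysis" "HOL-Computational_Algebra.Polynomial"
begin

definition entire_transcendental :: "(complex \<Rightarrow> complex) \<Rightarrow> bool" where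
  "entire_transcendental f \<longleftrightarrow>
     f holomorphic_on UNIV \<and> \<not> (\<exists>p :: complex poly. f = poly p)"

definition critical_values :: "(complex \<Rightarrow> complex) \<Rightarrow> complex set" where
  "critical_values f = f ` {z. deriv f z = 0}"

text \<open>Curves tending to infinity are parametrised by \<open>[0, \<infinity>)\<close>.\<close>

definition asymptotic_values :: "(complex \<Rightarrow> complex) \<Rightarrow> complex set" where
  "asymptotic_values f =
     {a. \<exists>\<alpha> :: real \<Rightarrow> complex. continuous_on {0..} \<alpha> \<and>
           filterlim \<alpha> at_infinity at_top \<and> ((\<lambda>t. f (\<alpha> t)) \<longlongrightarrow> a) at_top}"

definition singular_values :: "(complex \<Rightarrow> complex) \<Rightarrow> complex set" where
  "singular_values f = critical_values f \<union> asymptotic_values f"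

definition class_S :: "(complex \<Rightarrow> complex) \<Rightarrow> bool" where
  "class_S f \<longleftrightarrow> finite (singular_values f)"

text \<open>The period is the exact (least positive) one, so that the multiplier depends only on
  the orbit; by the chain rule it is the same at every point of the orbit.\<close>

definition periodic_point :: "(complex \<Rightarrow> complex) \<Rightarrow> nat \<Rightarrow> complex \<Rightarrow> bool" where
  "periodic_point f n p \<longleftrightarrow>
     n > 0 \<and> (f ^^ n) p = p \<and> (\<forall>m. 0 < m \<and> m < n \<longrightarrow> (f ^^ m) p \<noteq> p)"

definition multiplier :: "(complex \<Rightarrow> complex) \<Rightarrow> nat \<Rightarrow> complex \<Rightarrow> complex" where
  "multiplier f n p = deriv (f ^^ n) p"

definition repelling_periodic_point :: "(complex \<Rightarrow> complex) \<Rightarrow> nat \<Rightarrow> complex \<Rightarrow> bool" where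
  "repelling_periodic_point f n p \<longleftrightarrow> periodic_point f n p \<and> cmod (multiplier f n p) > 1"

end

theory Submission
  imports Defs "HOL-Real_Asymp.Real_Asymp"
begin

text \<open>Over \<open>{w. cmod w > R}\<close>, with \<open>R\<close> large, \<open>f\<close> has no singular values, so \<open>exp\<close> lifts through \<open>f\<close>
  to the half plane \<open>Re z > ln R\<close>; in logarithmic coordinates this gives a univalent map \<open>G\<close> with
  \<open>f (exp (G z)) = exp z\<close>, whose image contains no two points that differ by \<open>2 \<pi> \<i>\<close>. Compositions of \<open>G\<close> with
  translations by multiples of \<open>2 \<pi> \<i>\<close> are inverse branches of iterates of \<open>f\<close>, and their attracting
  fixed points yield repelling cycles. The branch \<open>\<phi> z = G (z + 2 \<pi> \<i> k)\<close> attracts a half disc that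
  exhausts a half plane as \<open>k\<close> grows. If all multipliers are real, then comparing
  \<open>\<phi>\<^sup>n \<circ> \<psi>\<close> with \<open>\<phi>\<^sup>n \<circ> (\<psi> + 2 \<pi> \<i> j)\<close> shows that, for large \<open>n\<close>, the argument of the derivative of \<open>\<phi>\<^sup>n\<close> nearly
  agrees at the points \<open>a + 2 \<pi> \<i> j\<close> of a vertical line; the same holds for \<open>\<phi>\<^sup>n \<circ> G\<close>. By the distortion theorem
  and Phragmen-Lindelof both arguments are nearly constant to the right of that line, and hence so
  is \<open>arg G'\<close>. Consequently \<open>G'\<close> decays slower than \<open>1/x\<close>, whereas Bloch's theorem gives
  \<open>G' = O(1/x)\<close>.\<close>

section \<open>Distortion and Phragmen-Lindelof estimates\<close>

text \<open>The comparison works because \<open>\<psi>\<close> and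
  \<open>\<psi> + 2 \<pi> \<i> j\<close> have the same derivative: reality of both multipliers fixes
  the direction of the derivative of \<open>\<phi>\<^sup>n\<close> at both landing points modulo
  \<open>\<pi>\<close>, up to one common factor coming from \<open>\<psi>\<close>, which cancels.
  The obstacle is the order of choices. For a given \<open>n\<close> only finitely many points of
  the line are controlled, and the attracting point varies with \<open>k\<close>. So
  Phragmen-Lindelof is run on half discs of finite radius, and the attracting point is carried by
  further inverse branches to a line whose abscissa stays in a range independent of
  \<open>k\<close>. For each pair of points the radius is chosen first, then \<open>k\<close>, then
  \<open>n\<close>; only the final half plane must not depend on the pair. Distortion lets the
  arguments grow at most logarithmically in the half disc, which is far below the square root
  barrier. Quantitatively, an oscillation of \<open>arg G'\<close> of at most 1/8 gives
  \<open>cmod (G'' / G') \<le> (3/4) / x\<close>, where \<open>x\<close> is the distance to the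
  boundary line, so along the real axis \<open>cmod G'\<close> is at least a multiple of
  \<open>x powr (-3/4)\<close>. What counts is that 3/4 is below 1.\<close>

lemma univalent_omits:
  assumes hol: "g holomorphic_on ball 0 1" and inj: "inj_on g (ball 0 1)"
    and g0: "g 0 = 0" and g1: "deriv g 0 = 1"
  obtains c where "cmod c < 2" "c \<notin> g ` ball 0 1"
proof -
  have "\<not> ball 0 2 \<subseteq> g ` ball 0 1"
  proof
    assume sub: "ball 0 2 \<subseteq> g ` ball 0 1"
    obtain k where k: "k holomorphic_on (g ` ball 0 1)"
      and kd: "\<And>z. z \<in> ball 0 1 \<Longrightarrow> deriv g z * deriv k (g z) = 1"
      and kg: "\<And>z. z \<in> ball 0 1 \<Longrightarrow> k (g z) = z"
      using holomorphic_has_inverse [OF hol open_ball inj] by blast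
    have k0: "k 0 = 0" using kg [of 0] g0 by simp
    have dk0: "deriv k 0 = 1" using kd [of 0] g0 g1 by simp
    \<comment> \<open>If the image contained the disc of radius 2, the rescaled inverse
      \<open>h\<close> would be a self-map of the unit disc with \<open>h 0 = 0\<close> and
      derivative 2 at 0, against the Schwarz lemma.\<close>
    define h where "h w = k (2 * w)" for w
    have holk: "k holomorphic_on ball 0 2"
      using k sub holomorphic_on_subset by blast
    have holh: "h holomorphic_on ball 0 1"
      unfolding h_def
      by (rule holomorphic_on_compose_gen [of "\<lambda>w. 2 * w" _ k "ball 0 2", unfolded o_def])
        (auto intro!: holomorphic_intros holk simp: norm_mult)
    have kin: "cmod (h w) < 1" if "cmod w < 1" for w
    proof -
      have "2 * w \<in> ball 0 2" using that by (simp add: norm_mult)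
      then obtain u where "u \<in> ball 0 1" "2 * w = g u" using sub by blast
      then show ?thesis using kg [of u] by (simp add: h_def)
    qed
    have "cmod (deriv h 0) \<le> 1"
      by (rule Schwarz_Lemma(2) [OF holh _ kin, of 0]) (auto simp: h_def k0)
    moreover have "(k has_field_derivative 1) (at (2 * 0))"
      using holomorphic_derivI [OF holk open_ball, of 0] dk0 by simp
    then have "(h has_field_derivative 1 * 2) (at 0)"
      unfolding h_def by (rule DERIV_chain2) (auto intro!: derivative_eq_intros)
    then have "deriv h 0 = 2" using DERIV_imp_deriv by force
    ultimately show False by simp
  qed
  then obtain c where "c \<in> ball 0 2" "c \<notin> g ` ball 0 1" by blast
  then show ?thesis using that by simp
qed

text \<open>The bound of Schottky's theorem on the disc of radius 1/2, for a function that omits 0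
  and 1 and has modulus at most 1 at the origin.\<close>

definition schottky_bound :: real where
  "schottky_bound = exp (pi * exp (pi * (2 + 2 * 1 + 12 * (1/2) / (1 - 1/2))))"

text \<open>Cauchy's estimate for a second derivative on radius 1/4 turns the bound
  \<open>2 * (1 + schottky_bound\<^sup>2)\<close> into this constant:
  \<open>2 * 2 * 16 = 64\<close>.\<close>

definition distortion_const :: real where
  "distortion_const = 64 * (1 + schottky_bound\<^sup>2)"

lemma distortion_const_pos: "distortion_const > 0"
  unfolding distortion_const_def by (simp add: add_pos_nonneg)

text \<open>A square root of \<open>1 - g / c\<close> omits \<open>0\<close> and takes only one of the values \<open>\<plusminus>1\<close>, so that
  Schottky's theorem bounds \<open>g\<close>.\<close>

lemma univalent_unit_bound:
  assumes hol: "g holomorphic_on ball 0 1" and inj: "inj_on g (ball 0 1)"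
    and g0: "g 0 = 0" and g1: "deriv g 0 = 1"
  shows "cmod ((deriv ^^ 2) g 0) \<le> distortion_const"
proof -
  obtain c where c: "cmod c < 2" "c \<notin> g ` ball 0 1"
    using univalent_omits [OF assms] .
  have c0: "c \<noteq> 0" using c g0 by force
  have "(\<lambda>z. 1 - g z / c) holomorphic_on ball 0 1"
    by (intro holomorphic_intros hol) (use c0 in auto)
  moreover have "contractible (ball (0::complex) 1)"
    by (simp add: convex_imp_contractible)
  moreover have "1 - g z / c \<noteq> 0" if "z \<in> ball 0 1" for z
  proof
    assume "1 - g z / c = 0"
    then have "g z = c" using c0 by (simp add: field_simps)
    then show False using c that by blast
  qed
  ultimately obtain q where holq: "q holomorphic_on ball 0 1"
    and q: "\<And>z. z \<in> ball 0 1 \<Longrightarrow> 1 - g z / c = q z ^ 2"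
    using contractible_imp_holomorphic_sqrt [of "\<lambda>z. 1 - g z / c" "ball 0 1"] by blast
  have q0: "q 0 ^ 2 = 1" using q [of 0] g0 by simp
  \<comment> \<open>Normalised so that \<open>W 0 = -1\<close>. If \<open>W z = 1\<close>, then
    \<open>g (z/2) = g 0\<close>, so \<open>z = 0\<close> by injectivity, where the value is -1;
    hence 1 is omitted. The factor 1/2 makes \<open>W\<close> holomorphic on the closed unit disc,
    as Schottky's theorem requires.\<close>
  define W where "W z = - q (z/2) / q 0" for z
  have qn0: "q 0 \<noteq> 0" using q0 by auto
  have W2: "W z ^ 2 = 1 - g (z/2) / c" if "cmod z \<le> 1" for z
    using q [of "z/2"] that q0 by (simp add: W_def power_divide norm_divide)
  have W00: "W 0 = -1" using qn0 by (simp add: W_def)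
  have holW: "W holomorphic_on cball 0 1"
  proof -
    have "(\<lambda>z. q (z/2)) holomorphic_on cball 0 1"
      by (rule holomorphic_on_compose_gen [of "\<lambda>w. w/2" _ q "ball 0 1", unfolded o_def])
        (auto intro!: holomorphic_intros holq simp: norm_divide)
    then show ?thesis unfolding W_def by (intro holomorphic_intros) (use qn0 in auto)
  qed
  have Wb: "cmod (W z) \<le> schottky_bound" if "cmod z \<le> 1/2" for z
    unfolding schottky_bound_def
  proof (rule Schottky [OF holW])
    show "cmod (W 0) \<le> 1" by (simp add: W00)
    show "\<not> (W z = 0 \<or> W z = 1)" if "z \<in> cball 0 1" for z
    proof
      assume "W z = 0 \<or> W z = 1"
      then show False
      proof
        assume "W z = 0"
        then have "g (z/2) = c" using W2 [of z] that c0 by (simp add: field_simps)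
        moreover have "z/2 \<in> ball 0 1" using that by (simp add: norm_divide)
        ultimately show False using c by blast
      next
        assume W1: "W z = 1"
        then have "g (z/2) = g 0" using W2 [of z] that c0 g0 by (simp add: field_simps)
        moreover have "z/2 \<in> ball 0 1" using that by (simp add: norm_divide)
        ultimately have "z = 0" using inj by (auto dest: inj_onD)
        then show False using W1 W00 by simp
      qed
    qed
  qed (use that in auto)
  have gb: "cmod (g z) \<le> 2 * (1 + schottky_bound\<^sup>2)" if "cmod (0 - z) = 1/4" for z
  proof -
    have "g z = c * (1 - W (2*z) ^ 2)"
      using W2 [of "2*z"] that c0 by (simp add: norm_mult)
    then have "cmod (g z) \<le> cmod c * (1 + cmod (W (2*z)) ^ 2)"
      using norm_triangle_ineq4 [of 1 "W (2*z) ^ 2"]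
      by (simp add: norm_mult norm_power mult_left_mono)
    also have "\<dots> \<le> 2 * (1 + schottky_bound\<^sup>2)"
      using Wb [of "2*z"] that c by (intro mult_mono add_mono power_mono) (auto simp: norm_mult)
    finally show ?thesis .
  qed
  have sub: "cball 0 (1/4) \<subseteq> ball (0::complex) 1" by auto
  have "cmod ((deriv ^^ 2) g 0) \<le> fact 2 * (2 * (1 + schottky_bound\<^sup>2)) / (1/4) ^ 2"
  proof (rule Cauchy_inequality)
    show "g holomorphic_on ball 0 (1/4)"
      by (rule holomorphic_on_subset [OF hol]) auto
    show "continuous_on (cball 0 (1/4)) g"
      by (rule holomorphic_on_imp_continuous_on [OF holomorphic_on_subset [OF hol sub]])
  qed (use gb in auto)
  also have "\<dots> = distortion_const"
    by (simp add: distortion_const_def power2_eq_square)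
  finally show ?thesis .
qed

text \<open>Affine renormalisation to the unit disc. The quotient \<open>F'' / F'\<close> is the
  derivative of \<open>ln F'\<close>, so this is the distortion theorem in the form that controls
  \<open>arg F'\<close>.\<close>

lemma univalent_second_deriv_bound:
  assumes r: "r > 0" and hol: "F holomorphic_on ball z r" and inj: "inj_on F (ball z r)"
  shows "cmod (deriv (deriv F) z) \<le> distortion_const * cmod (deriv F z) / r"
proof -
  define a where "a = deriv F z"
  have a0: "a \<noteq> 0"
    unfolding a_def using holomorphic_injective_imp_regular [OF hol open_ball inj, of z] r by simp
  define g where "g w = (F (z + of_real r * w) - F z) / (of_real r * a)" for w
  have inb: "z + of_real r * w \<in> ball z r \<longleftrightarrow> w \<in> ball 0 1" for w
    using r by (simp add: dist_norm norm_mult)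
  have dg: "(g has_field_derivative deriv F (z + of_real r * w) / a) (at w)" if "w \<in> ball 0 1" for w
  proof -
    have "(F has_field_derivative deriv F (z + of_real r * w)) (at (z + of_real r * w))"
      using that inb holomorphic_derivI [OF hol open_ball] by blast
    then have "((\<lambda>w. F (z + of_real r * w)) has_field_derivative
        deriv F (z + of_real r * w) * of_real r) (at w)"
      by (rule DERIV_chain2) (auto intro!: derivative_eq_intros)
    then show ?thesis
      unfolding g_def using r a0 by (auto intro!: derivative_eq_intros simp: field_simps)
  qed
  have holg: "g holomorphic_on ball 0 1"
    using dg unfolding holomorphic_on_open [OF open_ball] by blast
  have injg: "inj_on g (ball 0 1)"
  proof (rule inj_onI)
    fix u v assume uv: "u \<in> ball (0::complex) 1" "v \<in> ball (0::complex) 1" "g u = g v"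
    then have "F (z + of_real r * u) = F (z + of_real r * v)"
      using r a0 by (simp add: g_def)
    then show "u = v" using inj uv inb r by (auto dest: inj_onD)
  qed
  have "cmod ((deriv ^^ 2) g 0) \<le> distortion_const"
  proof (rule univalent_unit_bound [OF holg injg])
    show "g 0 = 0" by (simp add: g_def)
    show "deriv g 0 = 1" using DERIV_imp_deriv [OF dg, of 0] a0 by (simp add: a_def)
  qed
  moreover have "(deriv ^^ 2) g 0 = deriv (deriv F) z * of_real r / a"
  proof -
    have "eventually (\<lambda>w. w \<in> ball 0 1) (nhds (0::complex))"
      by (rule eventually_nhds_in_open) auto
    then have "eventually (\<lambda>w. deriv g w = deriv F (z + of_real r * w) / a) (nhds 0)"
      by eventually_elim (use dg DERIV_imp_deriv in blast)
    then have "deriv (deriv g) 0 = deriv (\<lambda>w. deriv F (z + of_real r * w) / a) 0"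
      by (rule deriv_cong_ev) simp
    also have "\<dots> = deriv (deriv F) z * of_real r / a"
    proof (rule DERIV_imp_deriv)
      have "(deriv F has_field_derivative deriv (deriv F) z) (at (z + of_real r * 0))"
        using holomorphic_derivI [OF holomorphic_deriv [OF hol open_ball] open_ball, of z] r by simp
      then have "((\<lambda>w. deriv F (z + of_real r * w)) has_field_derivative
          deriv (deriv F) z * of_real r) (at 0)"
        by (rule DERIV_chain2) (auto intro!: derivative_eq_intros)
      then show "((\<lambda>w. deriv F (z + of_real r * w) / a) has_field_derivative
          deriv (deriv F) z * of_real r / a) (at 0)"
        by (rule DERIV_cdivide)
    qed
    finally show ?thesis by (simp add: numeral_2_eq_2)
  qed
  ultimately have "cmod (deriv (deriv F) z) * r / cmod a \<le> distortion_const"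
    using r by (simp add: norm_mult norm_divide)
  then show ?thesis using r a0 by (simp add: field_simps a_def)
qed

text \<open>Instead of a gradient estimate for harmonic functions: \<open>exp (- 8 \<i> L)\<close> is bounded.\<close>

lemma deriv_bound_of_Im_oscillation:
  assumes r: "r > 0" and hol: "L holomorphic_on ball z r"
    and osc: "\<And>w. w \<in> ball z r \<Longrightarrow> \<bar>Im (L w) - Im (L z)\<bar> \<le> 1/8"
  shows "cmod (deriv L z) \<le> 3 / 4 / r"
proof -
  \<comment> \<open>The factor 8 turns an oscillation of 1/8 into a modulus of at most
    \<open>exp 1 \<le> 3\<close>. Cauchy's estimate on radius \<open>r/2\<close> gives
    \<open>6 / r\<close>, and division by 8 leaves the constant 3/4.\<close>
  define E where "E w = exp (- 8 * \<i> * (L w - L z))" for w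
  have holE: "E holomorphic_on ball z r"
    unfolding E_def by (intro holomorphic_intros hol)
  have Eb: "cmod (E w) \<le> 3" if "w \<in> ball z r" for w
  proof -
    have "cmod (E w) = exp (8 * (Im (L w) - Im (L z)))"
      by (simp add: E_def norm_exp_eq_Re)
    also have "\<dots> \<le> exp 1" using abs_le_D1 [OF osc [OF that]] by simp
    also have "\<dots> \<le> 3" by (rule exp_le)
    finally show ?thesis .
  qed
  have "cmod ((deriv ^^ 1) E z) \<le> fact 1 * 3 / (r/2) ^ 1"
  proof (rule Cauchy_inequality)
    have sub: "cball z (r/2) \<subseteq> ball z r" using r by auto
    then show "E holomorphic_on ball z (r/2)" "continuous_on (cball z (r/2)) E"
      using holE r by (auto intro: holomorphic_on_subset intro!: holomorphic_on_imp_continuous_on)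
    show "cmod (E x) \<le> 3" if "cmod (z - x) = r/2" for x
      using Eb [of x] that r by (auto simp: dist_norm)
  qed (use r in auto)
  moreover have "(E has_field_derivative (- 8 * \<i> * deriv L z)) (at z)"
    unfolding E_def using holomorphic_derivI [OF hol open_ball, of z] r
    by (auto intro!: derivative_eq_intros)
  then have "deriv E z = - 8 * \<i> * deriv L z" by (rule DERIV_imp_deriv)
  ultimately have "8 * cmod (deriv L z) \<le> 6 / r" by (simp add: norm_mult)
  then show ?thesis by (simp add: field_simps)
qed

text \<open>Integration of \<open>K / (x - m)\<close> along the segment. It serves twice: for the
  logarithmic growth inside the half disc, and at the end for the lower bound on \<open>G'\<close>
  along the real axis.\<close>

lemma horizontal_log_bound:
  assumes S: "open S" "p holomorphic_on S" and x: "m < x1" "x1 \<le> x2"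
    and seg: "\<And>x. x1 \<le> x \<Longrightarrow> x \<le> x2 \<Longrightarrow> Complex x y \<in> S"
    and b: "\<And>x. x1 \<le> x \<Longrightarrow> x \<le> x2 \<Longrightarrow> cmod (deriv p (Complex x y)) \<le> K / (x - m)"
  shows "cmod (p (Complex x2 y) - p (Complex x1 y)) \<le> K * ln ((x2 - m) / (x1 - m))"
proof (cases "x1 = x2")
  case True
  then show ?thesis using x by simp
next
  case False
  then have lt: "x1 < x2" using x by simp
  have eq: "Complex t y = of_real t + \<i> * of_real y" for t by (simp add: complex_eq_iff)
  define f where "f = (\<lambda>x. p (of_real x + \<i> * of_real y))"
  have fd: "(f has_vector_derivative deriv p (Complex t y)) (at t)" if "x1 \<le> t" "t \<le> x2" for t
  proof -
    have "(p has_field_derivative deriv p (Complex t y)) (at (of_real t + \<i> * of_real y))"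
      using holomorphic_derivI [OF S(2,1) seg [OF that]] by (simp add: eq)
    moreover have "((\<lambda>z. z + \<i> * of_real y) has_field_derivative 1) (at (of_real t))"
      by (auto intro!: derivative_eq_intros)
    ultimately have "((\<lambda>z. p (z + \<i> * of_real y)) has_field_derivative deriv p (Complex t y) * 1) (at (of_real t))"
      by (rule DERIV_chain2)
    then show ?thesis unfolding f_def
      using has_vector_derivative_real_field by fastforce
  qed
  have "norm (f x2 - f x1) \<le> K * ln (x2 - m) - K * ln (x1 - m)"
  proof (rule differentiable_bound_general [OF lt])
    show "continuous_on {x1..x2} f"
      using fd by (intro continuous_at_imp_continuous_on ballI)
        (auto intro: has_vector_derivative_continuous)
    show "continuous_on {x1..x2} (\<lambda>x. K * ln (x - m))"
      using x by (intro continuous_intros) auto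
    show "(f has_vector_derivative deriv p (Complex t y)) (at t)" if "x1 < t" "t < x2" for t
      using fd that by simp
    show "((\<lambda>x. K * ln (x - m)) has_vector_derivative K / (t - m)) (at t)" if "x1 < t" "t < x2" for t
      unfolding has_real_derivative_iff_has_vector_derivative [symmetric]
      using that x by (auto intro!: derivative_eq_intros simp: field_simps)
    show "norm (deriv p (Complex t y)) \<le> K / (t - m)" if "x1 < t" "t < x2" for t
      using b that by simp
  qed
  then show ?thesis using x lt by (simp add: f_def eq ln_div right_diff_distrib)
qed

text \<open>This expression is the error term of \<open>half_disc_oscillation\<close> at a fixed
  distance \<open>X\<close> from the centre, with the radius \<open>T\<close> tending to
  infinity.\<close>

lemma log_over_sqrt_eventually:
  fixes e c X C :: real
  assumes "e > 0" "c > 0" "X > 0" "C > 0"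
  shows "eventually (\<lambda>T. (2 * e + C * ln (T + c)) * sqrt 2 * sqrt (X / T) \<le> e) at_top"
proof -
  have "((\<lambda>T. (2 * e + C * ln (T + c)) * sqrt 2 * sqrt (X / T)) \<longlongrightarrow> 0) at_top"
    using assms by real_asymp
  then have "eventually (\<lambda>T. (2 * e + C * ln (T + c)) * sqrt 2 * sqrt (X / T) < e) at_top"
    using assms(1) by (rule order_tendstoD(2))
  then show ?thesis by (rule eventually_mono) simp
qed

text \<open>A Phragmen-Lindelof argument on the half disc \<open>{z. Re z \<ge> A, cmod (z - A) \<le> N}\<close>: the bound
  on \<open>deriv p\<close> makes \<open>Im p\<close> nearly constant on the straight part of the boundary and of size
  \<open>O(ln N)\<close> on the arc, where it is beaten by a multiple of \<open>Re (csqrt (z / N))\<close>.\<close>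

lemma half_disc_oscillation:
  fixes m A N T C e :: real and p :: "complex \<Rightarrow> complex" and a :: complex
  assumes hol: "p holomorphic_on {z. Re z > m} \<inter> ball 0 T"
    and dp: "\<And>z. Re z > m \<Longrightarrow> cmod z < T / 3 \<Longrightarrow> cmod (deriv p z) \<le> C / (Re z - m)"
    and A: "A = Re a" "m + 1 \<le> A" and C: "C > 0" and e: "e > 0" "C * pi / (A - m) \<le> e"
    and ima: "\<bar>Im a\<bar> \<le> pi"
    and N: "N > 1" "\<bar>A\<bar> + N + 4 < T / 3"
    and per: "\<And>j::int. cmod (a + 2 * of_real pi * \<i> * of_int j) < T / 3 \<Longrightarrow>
               \<bar>Im (p (a + 2 * of_real pi * \<i> * of_int j)) - Im (p a)\<bar> \<le> e"
    and c: "\<bar>A\<bar> + \<bar>m\<bar> \<le> c"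
    and z: "Re z \<ge> A" "cmod (z - A) \<le> N"
  shows "\<bar>Im (p z) - Im (p a)\<bar> \<le>
           2 * e + (2 * e + C * ln (N + c)) * sqrt 2 * sqrt (cmod (z - A + 1) / N)"
proof -
  define K where "K = 2 * e + C * ln (N + c)"
  define S where "S = {z. Re z \<ge> A} \<inter> cball (of_real A) N"
  define Om where "Om = {z. Re z > m} \<inter> ball 0 T"
  have opOm: "open Om" unfolding Om_def by (intro open_Int open_halfspace_Re_gt open_ball)
  have m1: "A - m \<ge> 1" using A by simp
  have Apos: "A - m > 0" using m1 by simp
  have c0: "c \<ge> 0" using c by linarith
  have lnp: "ln (N + c) > 0" using N c0 by simp
  have K0: "K \<ge> 0" unfolding K_def using C e lnp by simp
  have nS: "cmod w < T / 3" if "w \<in> S" for w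
  proof -
    have "cmod w \<le> cmod (of_real A) + cmod (w - of_real A)"
      by (metis norm_triangle_sub)
    moreover have "cmod (w - of_real A) \<le> N" using that by (simp add: S_def dist_norm norm_minus_commute)
    ultimately show ?thesis using N by simp
  qed
  have T0: "T > 0" using N by linarith
  have S_Om: "S \<subseteq> Om" using nS m1 T0 by (force simp: S_def Om_def)
  have line: "\<bar>Im (p w) - Im (p a)\<bar> \<le> 2 * e" if w: "Re w = A" "cmod (w - of_real A) \<le> N" for w
  proof -
    \<comment> \<open>The point \<open>b\<close> of the lattice \<open>a + 2 \<pi> \<i> j\<close>
      nearest to \<open>w\<close> is at distance at most \<open>pi\<close>. Moving from
      \<open>w\<close> to \<open>b\<close> costs at most \<open>C * pi / (A - m) \<le> e\<close>,
      and \<open>per\<close> contributes another \<open>e\<close>. The segment may leave the half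
      disc by less than 4, for which the hypothesis on \<open>N\<close> leaves room.\<close>
    define j :: int where "j = round ((Im w - Im a) / (2 * pi))"
    define b where "b = a + 2 * of_real pi * \<i> * of_int j"
    have "\<bar>of_int j - (Im w - Im a) / (2 * pi)\<bar> \<le> 1/2"
      unfolding j_def using of_int_round_abs_le by blast
    then have "\<bar>2 * pi * of_int j - (Im w - Im a)\<bar> \<le> pi"
      using pi_gt_zero by (simp add: field_simps abs_if split: if_splits)
    then have imb: "\<bar>Im b - Im w\<bar> \<le> pi" by (simp add: b_def)
    have reb: "Re b = A" by (simp add: b_def A)
    have imw: "\<bar>Im w\<bar> \<le> N"
      using abs_Im_le_cmod [of "w - of_real A"] w by simp
    have seg: "Re x = A \<and> cmod x < T / 3" if "x \<in> closed_segment w b" for x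
    proof -
      have "x - w \<in> closed_segment (w - w) (b - w)"
        using that closed_segment_translation_eq [of "- w" "x" w b] by (simp add: add.commute)
      then obtain u where u: "0 \<le> u" "u \<le> 1" "x - w = u *\<^sub>R (b - w)"
        by (auto simp: closed_segment_def)
      then have x: "x = w + u *\<^sub>R (b - w)" by (simp add: algebra_simps)
      have rex: "Re x = A" by (simp add: x w reb)
      have "\<bar>u * (Im b - Im w)\<bar> \<le> 1 * pi"
        unfolding abs_mult using u imb by (intro mult_mono) auto
      then have "\<bar>Im x\<bar> \<le> N + pi" using imw by (simp add: x)
      then have "cmod x \<le> \<bar>A\<bar> + (N + pi)" using cmod_le [of x] rex by simp
      also have "\<dots> < T / 3" using N pi_less_4 by simp
      finally show ?thesis using rex by simp
    qed
    have "cmod (p w - p b) \<le> C / (A - m) * cmod (w - b)"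
    proof (rule field_differentiable_bound)
      show "(p has_field_derivative deriv p x) (at x within closed_segment w b)"
        if "x \<in> closed_segment w b" for x
      proof -
        have "x \<in> Om" using seg [OF that] m1 T0 by (auto simp: Om_def)
        then show ?thesis
          using holomorphic_derivI [OF hol [folded Om_def] opOm] by (simp add: has_field_derivative_at_within)
      qed
      show "cmod (deriv p x) \<le> C / (A - m)" if "x \<in> closed_segment w b" for x
        using dp [of x] seg [OF that] m1 by simp
    qed auto
    also have "w - b = of_real (Im w - Im b) * \<i>"
      using w reb by (simp add: complex_eq_iff)
    also have "C / (A - m) * cmod (of_real (Im w - Im b) * \<i>) \<le> C / (A - m) * pi"
      using imb C Apos unfolding norm_mult norm_of_real norm_ii
      by (intro mult_left_mono) (auto simp: abs_minus_commute)
    also have "\<dots> \<le> e" using e by simp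
    finally have "cmod (p w - p b) \<le> e" .
    then have "\<bar>Im (p w) - Im (p b)\<bar> \<le> e"
      using abs_Im_le_cmod [of "p w - p b"] by simp
    moreover have "\<bar>Im (p b) - Im (p a)\<bar> \<le> e"
      unfolding b_def using seg [of b] by (intro per) (simp add: b_def)
    ultimately show ?thesis by linarith
  qed
  have all: "\<bar>Im (p w) - Im (p a)\<bar> \<le> K" if w: "w \<in> S" for w
  proof -
    \<comment> \<open>From the straight side, \<open>w\<close> is reached along a horizontal
      segment, where the bound on \<open>deriv p\<close> integrates to a logarithm.\<close>
    define w' where "w' = Complex A (Im w)"
    have rew: "A \<le> Re w" "cmod (w - of_real A) \<le> N"
      using w by (auto simp: S_def dist_norm norm_minus_commute)
    have rewA: "Re w \<le> A + N"
      using complex_Re_le_cmod [of "w - of_real A"] rew by simp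
    have seg: "Complex x (Im w) \<in> S" if "A \<le> x" "x \<le> Re w" for x
    proof -
      have "(x - A)\<^sup>2 \<le> (Re w - A)\<^sup>2" using that by (intro power_mono) auto
      then have "cmod (Complex x (Im w) - of_real A) \<le> cmod (w - of_real A)"
        by (simp add: cmod_def)
      then show ?thesis using rew that by (simp add: S_def dist_norm norm_minus_commute)
    qed
    have "cmod (p (Complex (Re w) (Im w)) - p (Complex A (Im w))) \<le> C * ln ((Re w - m) / (A - m))"
    proof (rule horizontal_log_bound [OF opOm hol [folded Om_def]])
      show "cmod (deriv p (Complex x (Im w))) \<le> C / (x - m)" if "A \<le> x" "x \<le> Re w" for x
        using dp [of "Complex x (Im w)"] nS [OF seg [OF that]] that m1 by simp
    qed (use rew m1 seg S_Om in auto)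
    also have "\<dots> \<le> C * ln (N + c)"
    proof -
      have "(Re w - m) / (A - m) \<le> (Re w - m) / 1"
        using m1 rew by (intro divide_left_mono) auto
      also have "\<dots> \<le> N + c" using rewA c abs_ge_self [of A] abs_ge_minus_self [of m] by simp
      finally have "(Re w - m) / (A - m) \<le> N + c" .
      moreover have "(Re w - m) / (A - m) > 0"
        using Apos rew by (intro divide_pos_pos) auto
      ultimately have "ln ((Re w - m) / (A - m)) \<le> ln (N + c)"
        by (intro ln_mono)
      then show ?thesis using C by simp
    qed
    finally have "cmod (p w - p w') \<le> C * ln (N + c)" by (simp add: w'_def)
    then have "\<bar>Im (p w) - Im (p w')\<bar> \<le> C * ln (N + c)"
      using abs_Im_le_cmod [of "p w - p w'"] by simp
    moreover have "\<bar>Im (p w') - Im (p a)\<bar> \<le> 2 * e"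
    proof (rule line)
      show "Re w' = A" by (simp add: w'_def)
      show "cmod (w' - of_real A) \<le> N"
        using seg [of A] rew by (simp add: w'_def S_def dist_norm norm_minus_commute)
    qed
    ultimately show ?thesis unfolding K_def by linarith
  qed
  \<comment> \<open>The shift by 1 keeps the argument of \<open>csqrt\<close> in the open right half
    plane, even on the straight side. In that half plane
    \<open>Re (csqrt u) \<ge> sqrt (cmod u / 2)\<close>, so the factor \<open>sqrt 2\<close> gives
    \<open>Re (v w) \<ge> K\<close> on the arc, where the argument has modulus at least 1.\<close>
  define v where "v w = K * sqrt 2 * csqrt ((w - of_real A + 1) / of_real N)" for w
  have rev: "Re (csqrt u) \<ge> sqrt (cmod u / 2)" if "Re u \<ge> 0" for u
    using that by simp
  have main: "s * (Im (p z) - Im (p a)) \<le> 2 * e + Re (v z)" if s: "s = 1 \<or> s = -1" for s :: real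
  proof -
    \<comment> \<open>The logarithm of \<open>cmod (E w)\<close> is \<open>s\<close> times the
      difference of imaginary parts, minus the majorant \<open>2 * e + Re (v w)\<close>. The maximum
      principle for harmonic functions thus becomes the maximum modulus principle for
      \<open>E\<close>.\<close>
    define E where "E w = exp (- of_real s * \<i> * (p w - p a) - of_real (2 * e) - v w)" for w
    have nE: "cmod (E w) = exp (s * (Im (p w) - Im (p a)) - 2 * e - Re (v w))" for w
      by (simp add: E_def norm_exp_eq_Re algebra_simps)
    have closedS: "closed S" unfolding S_def
      by (intro closed_Int closed_halfspace_Re_ge closed_cball)
    have "E holomorphic_on S"
    proof -
      have "(w - of_real A + 1) / of_real N \<notin> \<real>\<^sub>\<le>\<^sub>0" if "w \<in> S" for w
      proof -
        have "Re ((w - of_real A + 1) / of_real N) > 0" using that N by (simp add: S_def)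
        then show ?thesis by (auto simp: complex_nonpos_Reals_iff simp del: Re_divide_of_real)
      qed
      then show ?thesis
        unfolding E_def v_def
        using N holomorphic_on_subset [OF hol [folded Om_def] S_Om]
        by (intro holomorphic_intros) auto
    qed
    have "cmod (E z) \<le> 1"
    proof (rule maximum_modulus_frontier [of E S])
      show "E holomorphic_on interior S"
        using \<open>E holomorphic_on S\<close> holomorphic_on_subset interior_subset by blast
      show "continuous_on (closure S) E"
        using \<open>E holomorphic_on S\<close> closedS by (simp add: holomorphic_on_imp_continuous_on)
      show "bounded S" unfolding S_def by (simp add: bounded_Int)
      show "z \<in> S" using z by (simp add: S_def dist_norm norm_minus_commute)
      show "cmod (E w) \<le> 1" if "w \<in> frontier S" for w
      proof -
        have wS: "w \<in> S" using that closedS frontier_subset_closed by blast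
        have wA: "Re w \<ge> A" "cmod (w - of_real A) \<le> N"
          using wS by (auto simp: S_def dist_norm norm_minus_commute)
        have rv0: "Re (v w) \<ge> 0" unfolding v_def using K0 Re_csqrt
          by (simp add: mult_nonneg_nonneg del: csqrt.simps)
        have "Re w = A \<or> cmod (w - of_real A) = N"
        proof (rule ccontr)
          assume "\<not> ?thesis"
          then have "w \<in> {z. Re z > A} \<inter> ball (of_real A) N"
            using wA by (simp add: dist_norm norm_minus_commute)
          moreover have "open ({z. Re z > A} \<inter> ball (of_real A) N)"
            by (intro open_Int open_halfspace_Re_gt open_ball)
          moreover have "{z. Re z > A} \<inter> ball (of_real A) N \<subseteq> S" by (auto simp: S_def)
          ultimately have "w \<in> interior S" by (meson interiorI)
          then show False using that by (simp add: frontier_def)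
        qed
        then have "s * (Im (p w) - Im (p a)) - 2 * e - Re (v w) \<le> 0"
        proof
          assume "Re w = A"
          then have "\<bar>Im (p w) - Im (p a)\<bar> \<le> 2 * e" using line wA by blast
          then show ?thesis using s rv0 by auto
        next
          assume wN: "cmod (w - of_real A) = N"
          define u where "u = (w - of_real A + 1) / of_real N"
          have "N\<^sup>2 \<le> (cmod (w - of_real A + 1))\<^sup>2"
          proof -
            have "(Re w - A)\<^sup>2 \<le> (Re w - A + 1)\<^sup>2" using wA by (intro power_mono) auto
            then show ?thesis unfolding wN [symmetric] by (simp add: cmod_power2)
          qed
          then have "N \<le> cmod (w - of_real A + 1)" by (rule power2_le_imp_le) simp
          then have "cmod u \<ge> 1" unfolding u_def using N by (simp add: norm_divide)
          moreover have "Re u \<ge> 0" unfolding u_def using N wA by simp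
          ultimately have "Re (csqrt u) \<ge> sqrt (1/2)"
            by (intro order_trans [OF _ rev]) (auto simp: real_sqrt_le_iff)
          then have "K * (sqrt 2 * Re (csqrt u)) \<ge> K * (sqrt 2 * sqrt (1/2))"
            using K0 by (intro mult_left_mono) auto
          moreover have "sqrt 2 * sqrt (1/2) = 1" by (simp flip: real_sqrt_mult)
          moreover have "Re (v w) = K * (sqrt 2 * Re (csqrt u))"
            by (simp add: v_def u_def del: csqrt.simps)
          ultimately have "Re (v w) \<ge> K" by simp
          moreover have "\<bar>Im (p w) - Im (p a)\<bar> \<le> K" using all wS by blast
          ultimately show ?thesis using s e by auto
        qed
        then show ?thesis by (simp add: nE)
      qed
    qed
    then show ?thesis by (simp add: nE)
  qed
  have "Re (v z) \<le> K * sqrt 2 * sqrt (cmod (z - of_real A + 1) / N)"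
  proof -
    define u where "u = (z - of_real A + 1) / of_real N"
    have "Re (csqrt u) \<le> cmod (csqrt u)" by (rule complex_Re_le_cmod)
    also have "\<dots> = sqrt (cmod u)" by (rule norm_csqrt)
    also have "cmod u = cmod (z - of_real A + 1) / N" using N by (simp add: u_def norm_divide)
    finally have "K * sqrt 2 * Re (csqrt u) \<le> K * sqrt 2 * sqrt (cmod (z - of_real A + 1) / N)"
      using K0 by (intro mult_left_mono) auto
    then show ?thesis by (simp add: v_def u_def del: csqrt.simps)
  qed
  then show ?thesis using main [of 1] main [of "-1"] unfolding K_def by simp
qed

section \<open>Lifting through an entire function\<close>

lemma lift_unique:
  assumes f: "f holomorphic_on UNIV" and S: "open S" "connected S"
    and g: "g1 holomorphic_on S" "g2 holomorphic_on S"
    and eq: "\<And>z. z \<in> S \<Longrightarrow> f (g1 z) = f (g2 z)"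
    and z0: "z0 \<in> S" "g1 z0 = g2 z0" "deriv f (g1 z0) \<noteq> 0"
    and z: "z \<in> S"
  shows "g1 z = g2 z"
proof -
  obtain r where r: "r > 0" "inj_on f (ball (g1 z0) r)"
    using has_complex_derivative_locally_injective [OF f _ open_UNIV z0(3)] by blast
  define T where "T = (S \<inter> g1 -` ball (g1 z0) r) \<inter> (S \<inter> g2 -` ball (g1 z0) r)"
  have "open T"
    unfolding T_def using g S
    by (intro open_Int continuous_open_preimage holomorphic_on_imp_continuous_on) auto
  moreover have "z0 \<in> T" using z0 r by (simp add: T_def)
  moreover have "g1 w = g2 w" if "w \<in> T" for w
    using that eq inj_onD [OF r(2), of "g1 w" "g2 w"] unfolding T_def by auto
  ultimately show ?thesis
    using analytic_continuation_open [of T S g1 g2 z] S g z T_def by blast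
qed

text \<open>The last conclusion is a uniqueness clause: every preimage that lies in \<open>U\<close>
  is the value of \<open>k\<close>. It later identifies \<open>k\<close> with a lift that already
  exists, from a single value of that lift in \<open>U\<close>.\<close>

lemma local_lift:
  assumes f: "f holomorphic_on UNIV" and h: "h holomorphic_on S" "open S" "c \<in> S"
    and z: "f z = h c" "deriv f z \<noteq> 0"
  obtains e U k where "e > 0" "ball c e \<subseteq> S" "open U" "z \<in> U"
    "k holomorphic_on ball c e" "\<And>w. w \<in> ball c e \<Longrightarrow> f (k w) = h w"
    "\<And>w u. w \<in> ball c e \<Longrightarrow> u \<in> U \<Longrightarrow> f u = h w \<Longrightarrow> k w = u"
proof -
  obtain r where r: "r > 0" "open (f ` ball z r)" "inj_on f (ball z r)"
    using has_complex_derivative_locally_invertible [OF f _ open_UNIV z(2)] by blast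
  have "f holomorphic_on ball z r" using f holomorphic_on_subset by blast
  then obtain k where k: "k holomorphic_on (f ` ball z r)" "\<And>w. w \<in> ball z r \<Longrightarrow> k (f w) = w"
    using holomorphic_has_inverse r open_ball by metis
  have "open (S \<inter> h -` (f ` ball z r))"
    using h r by (intro continuous_open_preimage holomorphic_on_imp_continuous_on) auto
  moreover have "c \<in> S \<inter> h -` (f ` ball z r)"
    using h r z by (auto intro!: image_eqI [of _ _ z])
  ultimately obtain e where e: "e > 0" "ball c e \<subseteq> S \<inter> h -` (f ` ball z r)"
    using open_contains_ball by blast
  show ?thesis
  proof (rule that [of e "ball z r" "k \<circ> h"])
    show "k \<circ> h holomorphic_on ball c e"
      by (rule holomorphic_on_compose_gen [OF _ k(1)]) (use h e in \<open>auto intro: holomorphic_on_subset\<close>)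
    show "f ((k \<circ> h) w) = h w" if "w \<in> ball c e" for w
      using e that k(2) by force
    show "(k \<circ> h) w = u" if "w \<in> ball c e" "u \<in> ball z r" "f u = h w" for w u
      using that k(2) [of u] by simp
  qed (use e r in auto)
qed

definition lifts :: "(complex \<Rightarrow> complex) \<Rightarrow> (complex \<Rightarrow> complex) \<Rightarrow> complex \<Rightarrow> complex \<Rightarrow>
    complex set \<Rightarrow> (complex \<Rightarrow> complex) \<Rightarrow> bool" where
  "lifts f h c z S g \<longleftrightarrow> g holomorphic_on S \<and> g c = z \<and> (\<forall>w\<in>S. f (g w) = h w)"

lemma lifts_subset: "lifts f h c z S g \<Longrightarrow> S' \<subseteq> S \<Longrightarrow> lifts f h c z S' g"
  unfolding lifts_def by (auto intro: holomorphic_on_subset)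

text \<open>By \<open>lift_unique\<close>, anchored at \<open>c\<close>, the lifts on the nested
  sets agree, so the value at a point may be read off from the first set that contains it.\<close>

lemma lifts_Union:
  fixes B :: "nat \<Rightarrow> complex set"
  assumes f: "f holomorphic_on UNIV" and z: "deriv f z \<noteq> 0"
    and B: "\<And>n. open (B n)" "\<And>n. connected (B n)" "mono B" "c \<in> B 0"
    and ex: "\<And>n. \<exists>g. lifts f h c z (B n) g"
  shows "\<exists>g. lifts f h c z (\<Union>n. B n) g"
proof -
  obtain G where G: "\<And>n. lifts f h c z (B n) (G n)" using ex by metis
  define g where "g w = G (LEAST n. w \<in> B n) w" for w
  have g: "g w = G n w" if "w \<in> B n" for n w
  proof -
    define k where "k = (LEAST n. w \<in> B n)"
    have wk: "w \<in> B k" unfolding k_def using that by (rule LeastI)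
    have "k \<le> n" unfolding k_def using that by (rule Least_le)
    then have sub: "B k \<subseteq> B n" by (rule monoD [OF B(3)])
    have cB: "c \<in> B k" using B(3,4) by (auto dest: monoD [of B 0 k])
    have "G k w = G n w"
    proof (rule lift_unique [OF f B(1,2) _ _ _ cB _ _ wk])
      show "G k holomorphic_on B k" "G n holomorphic_on B k"
        using G lifts_subset [OF G sub] by (auto simp: lifts_def)
      show "f (G k w) = f (G n w)" if "w \<in> B k" for w
        using G that sub by (auto simp: lifts_def subset_iff)
      show "G k c = G n c" "deriv f (G k c) \<noteq> 0" using G z by (auto simp: lifts_def)
    qed
    then show ?thesis by (simp add: g_def k_def)
  qed
  have "lifts f h c z (\<Union>n. B n) g"
    unfolding lifts_def
  proof (intro conjI ballI)
    show "g holomorphic_on (\<Union>n. B n)"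
    proof (rule holomorphic_on_UN_open)
      show "g holomorphic_on B n" for n
        using G [of n] g [of _ n] holomorphic_cong [of "B n" "B n" g "G n"] by (auto simp: lifts_def)
    qed (rule B)
    show "g c = z" using g [OF B(4)] G by (simp add: lifts_def)
    show "f (g w) = h w" if "w \<in> (\<Union>n. B n)" for w
      using that g G by (auto simp: lifts_def)
  qed
  then show ?thesis by blast
qed

text \<open>Over \<open>V\<close> there are neither critical nor asymptotic values. The lemmas below
  extract the part of the covering property that is used: holomorphic maps from discs and half
  planes into \<open>V\<close> lift through \<open>f\<close>.\<close>

locale asymptotically_regular =
  fixes f :: "complex \<Rightarrow> complex" and V :: "complex set"
  assumes hol: "f holomorphic_on UNIV"
    and regular: "\<And>z. f z \<in> V \<Longrightarrow> deriv f z \<noteq> 0"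
    and no_asym: "V \<inter> asymptotic_values f = {}"
begin

text \<open>Along the radius to \<open>b\<close> the values of \<open>f\<close> on the lifted curve
  tend to \<open>h b\<close>, which lies in \<open>V\<close> and so is not an asymptotic value.
  Hence the lifted curve does not tend to infinity and has a finite accumulation point
  \<open>z1\<close> with \<open>f z1 = h b\<close>. The local inverse at \<open>z1\<close> agrees
  with \<open>g\<close> at some point of the radius, hence on the whole overlap of the two
  discs.\<close>

lemma lift_boundary_extension:
  assumes h: "h holomorphic_on ball c r" "h ` ball c r \<subseteq> V"
    and s: "0 < s" "s < r" and g: "lifts f h c z0 (ball c s) g"
    and b: "dist c b = s"
  obtains e k where "e > 0" "ball b e \<subseteq> ball c r" "k holomorphic_on ball b e"
    "\<And>w. w \<in> ball b e \<Longrightarrow> f (k w) = h w"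
    "\<And>w. w \<in> ball b e \<Longrightarrow> w \<in> ball c s \<Longrightarrow> k w = g w"
proof -
  have holg: "g holomorphic_on ball c s" and fg: "\<And>w. w \<in> ball c s \<Longrightarrow> f (g w) = h w"
    using g by (auto simp: lifts_def)
  have br: "b \<in> ball c r" using b s by simp
  \<comment> \<open>The radius from \<open>c\<close> to \<open>b\<close>, parametrised by
    \<open>[0, \<infinity>)\<close> to match the definition of an asymptotic value; \<open>b\<close>
    is reached only in the limit.\<close>
  define pt where "pt x = c + of_real (1 - 1 / (1 + x)) * (b - c)" for x :: real
  define \<alpha> where "\<alpha> x = g (pt x)" for x
  have pt_in: "pt x \<in> ball c s" if "x \<ge> 0" for x
  proof -
    have "dist c (pt x) = \<bar>1 - 1 / (1 + x)\<bar> * s"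
      using b by (simp add: pt_def dist_norm norm_mult norm_minus_commute del: of_real_diff)
    also have "\<bar>1 - 1 / (1 + x)\<bar> < 1" using that by (simp add: field_simps)
    finally show ?thesis using s by simp
  qed
  have cont_pt: "continuous_on {0..} pt"
    unfolding pt_def by (intro continuous_intros) auto
  have cont: "continuous_on {0..} \<alpha>"
    unfolding \<alpha>_def
    by (rule continuous_on_compose2 [OF holomorphic_on_imp_continuous_on [OF holg] cont_pt])
      (use pt_in in auto)
  have lim_pt: "(pt \<longlongrightarrow> b) at_top"
  proof -
    have "((\<lambda>x::real. 1 / (1 + x)) \<longlongrightarrow> 0) at_top"
      by (intro tendsto_divide_0 [OF tendsto_const] filterlim_at_top_imp_at_infinity
          filterlim_tendsto_add_at_top [OF tendsto_const filterlim_ident])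
    then have "((\<lambda>x. c + of_real (1 - 1 / (1 + x)) * (b - c)) \<longlongrightarrow> c + of_real (1 - 0) * (b - c)) at_top"
      by (intro tendsto_intros)
    then show ?thesis by (simp add: pt_def [abs_def])
  qed
  have conth: "isCont h b"
    using holomorphic_on_imp_continuous_on [OF h(1)] br by (simp add: continuous_on_eq_continuous_at)
  have lim_f: "((\<lambda>x. f (\<alpha> x)) \<longlongrightarrow> h b) at_top"
  proof (rule Lim_transform_eventually)
    show "((\<lambda>x. h (pt x)) \<longlongrightarrow> h b) at_top" using isCont_tendsto_compose [OF conth lim_pt] .
    show "eventually (\<lambda>x. h (pt x) = f (\<alpha> x)) at_top"
      using eventually_ge_at_top [of 0]
      by eventually_elim (use fg pt_in in \<open>simp add: \<alpha>_def\<close>)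
  qed
  have "\<not> filterlim \<alpha> at_infinity at_top"
  proof
    assume "filterlim \<alpha> at_infinity at_top"
    then have "h b \<in> asymptotic_values f"
      using cont lim_f by (auto simp: asymptotic_values_def)
    then show False using no_asym h br by blast
  qed
  then obtain B where B: "\<not> eventually (\<lambda>x. B \<le> cmod (\<alpha> x)) at_top"
    unfolding filterlim_at_infinity_conv_norm_at_top filterlim_at_top by blast
  have "\<exists>x \<ge> real n. cmod (\<alpha> x) \<le> B" for n
    using B unfolding eventually_at_top_linorder by (meson linear)
  then obtain X where X: "\<And>n. X n \<ge> real n" "\<And>n. cmod (\<alpha> (X n)) \<le> B" by metis
  have "\<forall>n. (\<alpha> \<circ> X) n \<in> cball 0 B" using X by simp
  then obtain z1 \<sigma> where \<sigma>: "strict_mono (\<sigma> :: nat \<Rightarrow> nat)" "(\<alpha> \<circ> X \<circ> \<sigma>) \<longlonglongrightarrow> z1"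
    by (rule seq_compactE [OF compact_imp_seq_compact [OF compact_cball]])
  have Xtop: "filterlim (X \<circ> \<sigma>) at_top sequentially"
  proof -
    have "filterlim X at_top sequentially"
      by (rule filterlim_at_top_mono [OF filterlim_real_sequentially]) (simp add: X)
    then show ?thesis unfolding o_def
      using filterlim_compose filterlim_subseq [OF \<sigma>(1)] by blast
  qed
  have "(\<lambda>n. f ((\<alpha> \<circ> X \<circ> \<sigma>) n)) \<longlonglongrightarrow> h b"
    using filterlim_compose [OF lim_f Xtop] by (simp add: o_def)
  moreover have "isCont f z1"
    using holomorphic_on_imp_continuous_on [OF hol] by (simp add: continuous_on_eq_continuous_at)
  then have "(\<lambda>n. f ((\<alpha> \<circ> X \<circ> \<sigma>) n)) \<longlonglongrightarrow> f z1"
    using \<sigma>(2) by (rule isCont_tendsto_compose)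
  ultimately have fz1: "f z1 = h b" using LIMSEQ_unique by blast
  then have dz1: "deriv f z1 \<noteq> 0" using regular h br by force
  obtain e U k where k: "e > 0" "ball b e \<subseteq> ball c r" "open U" "z1 \<in> U"
      "k holomorphic_on ball b e" "\<And>w. w \<in> ball b e \<Longrightarrow> f (k w) = h w"
      "\<And>w u. w \<in> ball b e \<Longrightarrow> u \<in> U \<Longrightarrow> f u = h w \<Longrightarrow> k w = u"
    by (rule local_lift [OF hol h(1) open_ball br fz1 dz1]) (rule that)
  have "eventually (\<lambda>n. (\<alpha> \<circ> X \<circ> \<sigma>) n \<in> U) sequentially"
    by (rule topological_tendstoD [OF \<sigma>(2) k(3,4)])
  moreover have "eventually (\<lambda>n. pt ((X \<circ> \<sigma>) n) \<in> ball b e) sequentially"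
    by (rule topological_tendstoD [OF filterlim_compose [OF lim_pt Xtop]]) (use k(1) in auto)
  ultimately have "eventually (\<lambda>n. (\<alpha> \<circ> X \<circ> \<sigma>) n \<in> U \<and> pt ((X \<circ> \<sigma>) n) \<in> ball b e) sequentially"
    by (rule eventually_conj)
  then obtain n where n: "\<alpha> (X (\<sigma> n)) \<in> U" "pt (X (\<sigma> n)) \<in> ball b e"
    by (auto simp: eventually_sequentially)
  define w0 where "w0 = pt (X (\<sigma> n))"
  have w0s: "w0 \<in> ball c s" unfolding w0_def using X(1) by (intro pt_in) (meson of_nat_0_le_iff order_trans)
  have kw0: "k w0 = g w0"
    using k(7) [of w0 "g w0"] n w0s fg by (simp add: w0_def \<alpha>_def)
  have "k w = g w" if w: "w \<in> ball b e" "w \<in> ball c s" for w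
  proof (rule lift_unique [OF hol, of "ball b e \<inter> ball c s" k g w0])
    show "connected (ball b e \<inter> ball c s)"
      by (intro convex_connected convex_Int convex_ball)
    show "k holomorphic_on ball b e \<inter> ball c s" "g holomorphic_on ball b e \<inter> ball c s"
      using k holg by (auto intro: holomorphic_on_subset)
    have "w0 \<in> ball c r" using k(2) n(2) unfolding w0_def by blast
    then have "f (k w0) \<in> V" using k(6) [of w0] n(2) h(2) by (auto simp: w0_def)
    then show "deriv f (k w0) \<noteq> 0" by (rule regular)
  qed (use w n w0s k fg kw0 in \<open>auto simp: w0_def\<close>)
  then show ?thesis using that k by blast
qed

text \<open>The extensions across the individual boundary points are glued. They are consistent
  because two of their discs that meet also meet inside \<open>ball c s\<close>, where both
  extensions equal \<open>g\<close>. Compactness of the closed disc then gives a uniform gain in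
  radius.\<close>

lemma lift_disc_extend:
  assumes h: "h holomorphic_on ball c r" "h ` ball c r \<subseteq> V"
    and s: "0 < s" "s < r" and g: "lifts f h c z0 (ball c s) g"
  shows "\<exists>s' > s. s' \<le> r \<and> (\<exists>g. lifts f h c z0 (ball c s') g)"
proof -
  have holg: "g holomorphic_on ball c s" and fg: "\<And>w. w \<in> ball c s \<Longrightarrow> f (g w) = h w"
    using g by (auto simp: lifts_def)
  define Q where "Q b e k \<longleftrightarrow> e > 0 \<and> k holomorphic_on ball b e \<and>
      (\<forall>w\<in>ball b e. f (k w) = h w) \<and> (\<forall>w\<in>ball b e. w \<in> ball c s \<longrightarrow> k w = g w)"
    for b e and k :: "complex \<Rightarrow> complex"
  have "\<exists>e k. Q b e k" if "b \<in> sphere c s" for b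
  proof -
    have "dist c b = s" using that by simp
    then show ?thesis
      unfolding Q_def by (rule lift_boundary_extension [OF h s g]) blast
  qed
  then obtain e k where "\<And>b. b \<in> sphere c s \<Longrightarrow> Q b (e b) (k b)"
    by metis
  then have ek: "\<And>b. b \<in> sphere c s \<Longrightarrow> e b > 0"
      "\<And>b. b \<in> sphere c s \<Longrightarrow> k b holomorphic_on ball b (e b)"
      "\<And>b w. b \<in> sphere c s \<Longrightarrow> w \<in> ball b (e b) \<Longrightarrow> f (k b w) = h w"
      "\<And>b w. b \<in> sphere c s \<Longrightarrow> w \<in> ball b (e b) \<Longrightarrow> w \<in> ball c s \<Longrightarrow> k b w = g w"
    unfolding Q_def by blast+
  have agree: "k b w = k b' w"
    if b: "b \<in> sphere c s" "b' \<in> sphere c s" and w: "w \<in> ball b (e b)" "w \<in> ball b' (e b')" for b b' w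
  proof (cases "b = b'")
    case False
    define D where "D = ball b (e b) \<inter> ball b' (e b')"
    \<comment> \<open>The point \<open>u\<close> divides the segment from \<open>b\<close> to
      \<open>b'\<close> in the ratio of the two radii. It lies in both discs because
      \<open>dist b b' < e b + e b'\<close>, and in the open disc because the disc is strictly
      convex.\<close>
    define t where "t = e b / (e b + e b')"
    have e0: "e b > 0" "e b' > 0" using ek(1) b by auto
    then have t: "0 < t" "t < 1" by (auto simp: t_def)
    define u where "u = (1 - t) *\<^sub>R b + t *\<^sub>R b'"
    have bb: "dist b b' < e b + e b'"
      using w dist_triangle2 [of b b' w] by (simp add: dist_commute)
    have "u \<in> open_segment b b'" using t False by (auto simp: u_def in_segment)
    then have us: "u \<in> ball c s"
      using dist_decreases_open_segment [of u b b' c] b by simp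
    have "u - b = t *\<^sub>R (b' - b)" by (simp add: u_def algebra_simps)
    then have "norm (u - b) = t * norm (b' - b)" using t by simp
    then have "dist b u = t * dist b b'"
      by (metis dist_commute dist_norm)
    also have "\<dots> < t * (e b + e b')" using bb t by simp
    also have "\<dots> = e b" using e0 by (simp add: t_def)
    finally have ub: "u \<in> ball b (e b)" by simp
    have "u - b' = (1 - t) *\<^sub>R (b - b')" by (simp add: u_def algebra_simps)
    then have "norm (u - b') = (1 - t) * norm (b - b')" using t by simp
    then have "dist b' u = (1 - t) * dist b b'"
      by (metis dist_commute dist_norm)
    also have "\<dots> < (1 - t) * (e b + e b')" using bb t by simp
    also have "\<dots> = e b'" using e0 by (simp add: t_def field_simps)
    finally have ub': "u \<in> ball b' (e b')" by simp
    show ?thesis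
    proof (rule lift_unique [OF hol, of D "k b" "k b'" u])
      show "connected D" unfolding D_def by (intro convex_connected convex_Int convex_ball)
      show "k b holomorphic_on D" "k b' holomorphic_on D"
        unfolding D_def using ek(2) b by (auto intro: holomorphic_on_subset)
      show "f (k b z) = f (k b' z)" if "z \<in> D" for z using that ek(3) b by (simp add: D_def)
      show "k b u = k b' u" using ek(4) b ub ub' us by simp
      have "u \<in> ball c r" using us s by simp
      then have "f (k b u) \<in> V" using ek(3) b ub h by (metis image_subset_iff)
      then show "deriv f (k b u) \<noteq> 0" by (rule regular)
    qed (use ub ub' w in \<open>auto simp: D_def\<close>)
  qed simp
  define Om where "Om = ball c s \<union> (\<Union>b\<in>sphere c s. ball b (e b))"
  have "cball c s \<subseteq> Om"
  proof
    fix w assume "w \<in> cball c s"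
    then have "w \<in> ball c s \<or> w \<in> sphere c s" by auto
    then show "w \<in> Om" using ek(1) unfolding Om_def by force
  qed
  moreover have opOm: "open Om" unfolding Om_def by (intro open_Un open_UN ballI open_ball)
  ultimately obtain d where d: "d > 0" "(\<Union>x\<in>cball c s. ball x d) \<subseteq> Om"
    using compact_subset_open_imp_ball_epsilon_subset [OF compact_cball] by blast
  define s' where "s' = min (s + d) r"
  have s': "s < s'" "s' \<le> r" using s d by (auto simp: s'_def)
  have sub: "ball c s' \<subseteq> Om"
  proof
    fix w assume w: "w \<in> ball c s'"
    show "w \<in> Om"
    proof (cases "w \<in> ball c s")
      case True then show ?thesis by (simp add: Om_def)
    next
      case False
      define x where "x = c + (s / dist c w) *\<^sub>R (w - c)"
      have D: "dist c w \<ge> s" "dist c w > 0" using False s by auto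
      have "dist c x = s" using D s by (simp add: x_def dist_norm norm_minus_commute)
      moreover have "w - x = (1 - s / dist c w) *\<^sub>R (w - c)" by (simp add: x_def algebra_simps)
      then have "dist x w = \<bar>1 - s / dist c w\<bar> * dist c w"
        by (simp add: dist_norm norm_minus_commute)
      moreover have "\<bar>1 - s / dist c w\<bar> = 1 - s / dist c w" using D s by simp
      moreover have "(1 - s / dist c w) * dist c w = dist c w - s"
        using D(2) by (simp add: left_diff_distrib)
      ultimately have "dist x w = dist c w - s" "dist c x = s" by simp_all
      then have "w \<in> ball x d" "x \<in> cball c s" using w by (simp_all add: s'_def)
      then show ?thesis using d(2) by blast
    qed
  qed
  define G where "G w = (if w \<in> ball c s then g w
      else k (SOME b. b \<in> sphere c s \<and> w \<in> ball b (e b)) w)" for w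
  have Gk: "G w = k b w" if "b \<in> sphere c s" "w \<in> ball b (e b)" for b w
  proof (cases "w \<in> ball c s")
    case True
    then show ?thesis using ek(4) that by (simp add: G_def)
  next
    case False
    define b' where "b' = (SOME b. b \<in> sphere c s \<and> w \<in> ball b (e b))"
    have b': "b' \<in> sphere c s \<and> w \<in> ball b' (e b')"
      unfolding b'_def by (rule someI_ex) (use that in blast)
    have "G w = k b' w" using False by (simp add: G_def b'_def)
    also have "\<dots> = k b w" by (rule agree) (use b' that in blast)+
    finally show ?thesis .
  qed
  have "lifts f h c z0 (ball c s') G"
    unfolding lifts_def
  proof (intro conjI ballI)
    have "G holomorphic_on Om"
      unfolding Om_def
    proof (rule holomorphic_on_Un)
      show "G holomorphic_on ball c s"
        using holg by (rule holomorphic_transform) (simp add: G_def)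
      show "G holomorphic_on (\<Union>b\<in>sphere c s. ball b (e b))"
      proof (rule holomorphic_on_UN_open)
        show "G holomorphic_on ball b (e b)" if "b \<in> sphere c s" for b
          using ek(2) [OF that] by (rule holomorphic_transform) (simp only: Gk [OF that])
      qed simp
    qed auto
    then show "G holomorphic_on ball c s'" using sub holomorphic_on_subset by blast
    show "G c = z0" using g s by (simp add: G_def lifts_def)
    show "f (G w) = h w" if w: "w \<in> ball c s'" for w
    proof (cases "w \<in> ball c s")
      case True then show ?thesis using fg by (simp add: G_def)
    next
      case False
      then obtain b where b: "b \<in> sphere c s" "w \<in> ball b (e b)"
        using sub w unfolding Om_def by blast
      then show ?thesis using Gk [OF b] ek(3) [OF b] by simp
    qed
  qed
  then show ?thesis using s' by blast
qed

text \<open>A continuity argument in the radius: the supremum of the radii that admit a lift is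
  attained by taking unions, and \<open>lift_disc_extend\<close> excludes that it is smaller than
  \<open>r\<close>.\<close>

lemma lift_disc:
  assumes r: "r > 0" and h: "h holomorphic_on ball c r" "h ` ball c r \<subseteq> V" and z0: "f z0 = h c"
  shows "\<exists>g. lifts f h c z0 (ball c r) g"
proof -
  define I where "I = {s. 0 < s \<and> s \<le> r \<and> (\<exists>g. lifts f h c z0 (ball c s) g)}"
  have cin: "c \<in> ball c r" using r by simp
  have dz0: "deriv f z0 \<noteq> 0" using regular z0 h cin by force
  obtain e U k where k: "e > 0" "ball c e \<subseteq> ball c r" "z0 \<in> U"
      "k holomorphic_on ball c e" "\<And>w. w \<in> ball c e \<Longrightarrow> f (k w) = h w"
      "\<And>w u. w \<in> ball c e \<Longrightarrow> u \<in> U \<Longrightarrow> f u = h w \<Longrightarrow> k w = u"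
    by (rule local_lift [OF hol h(1) open_ball cin z0 dz0]) (rule that)
  have "k c = z0" using k z0 by simp
  then have "lifts f h c z0 (ball c e) k" using k by (simp add: lifts_def)
  then have lk: "lifts f h c z0 (ball c (min e r)) k" by (rule lifts_subset) auto
  have eI: "min e r \<in> I"
    unfolding I_def using k(1) r by (intro CollectI conjI exI [of _ k] lk) auto
  have bdd: "bdd_above I" unfolding I_def bdd_above_def by blast
  define s where "s = Sup I"
  have s0: "0 < s" using cSup_upper [OF eI bdd] k r by (auto simp: s_def)
  have sr: "s \<le> r" unfolding s_def
  proof (rule cSup_least)
    show "I \<noteq> {}" using eI by blast
  qed (simp add: I_def)
  \<comment> \<open>The offset 2 makes the first radius \<open>s / 2\<close>, so that already the
    first disc of the exhaustion contains \<open>c\<close>.\<close>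
  have "\<exists>g. lifts f h c z0 (\<Union>n. ball c (s - s / real (n + 2))) g"
  proof (rule lifts_Union [OF hol dz0])
    show "mono (\<lambda>n. ball c (s - s / real (n + 2)))"
    proof (rule monoI)
      fix i j :: nat assume "i \<le> j"
      then have "s / real (j + 2) \<le> s / real (i + 2)" using s0 by (intro divide_left_mono) auto
      then show "ball c (s - s / real (i + 2)) \<subseteq> ball c (s - s / real (j + 2))"
        by (intro subset_ball) simp
    qed
    show "c \<in> ball c (s - s / real (0 + 2))" using s0 by simp
    show "\<exists>g. lifts f h c z0 (ball c (s - s / real (n + 2))) g" for n
    proof -
      have "s - s / real (n + 2) < Sup I" unfolding s_def [symmetric] using s0 by simp
      then obtain t where t: "t \<in> I" "s - s / real (n + 2) < t"
        using less_cSup_iff [OF _ bdd] eI by blast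
      then obtain g where "lifts f h c z0 (ball c t) g" by (auto simp: I_def)
      then have "lifts f h c z0 (ball c (s - s / real (n + 2))) g"
        by (rule lifts_subset) (use t in \<open>auto intro: subset_ball\<close>)
      then show ?thesis by blast
    qed
  qed auto
  moreover have "(\<Union>n. ball c (s - s / real (n + 2))) = ball c s"
  proof (intro equalityI subsetI)
    fix w assume "w \<in> ball c s"
    then have d: "s - dist c w > 0" by simp
    obtain n where "real n > s / (s - dist c w)" using reals_Archimedean2 by blast
    then have "real n * (s - dist c w) > s" using d by (simp add: field_simps)
    then have "real (n + 2) * (s - dist c w) > s" using d by (simp add: algebra_simps)
    then have "s / real (n + 2) < s - dist c w" by (simp add: field_simps)
    then have "w \<in> ball c (s - s / real (n + 2))" by simp
    then show "w \<in> (\<Union>n. ball c (s - s / real (n + 2)))" by blast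
  next
    fix w assume "w \<in> (\<Union>n. ball c (s - s / real (n + 2)))"
    then obtain n where "dist c w < s - s / real (n + 2)" by auto
    also have "\<dots> \<le> s" using s0 by simp
    finally show "w \<in> ball c s" by simp
  qed
  ultimately obtain g where g: "lifts f h c z0 (ball c s) g" by auto
  have "s = r"
  proof (rule ccontr)
    assume "s \<noteq> r"
    then obtain s' where s': "s' > s" "s' \<le> r" "\<exists>g. lifts f h c z0 (ball c s') g"
      using lift_disc_extend [OF h s0 _ g] sr by auto
    then have "s' \<in> I" using s0 by (auto simp: I_def)
    then show False using cSup_upper [OF _ bdd] s' by (fastforce simp: s_def)
  qed
  then show ?thesis using g by blast
qed

text \<open>The half plane is exhausted by nested discs tangent to its boundary line, with radii
  growing by the factor 3/2. Each centre is half a radius away from the previous one, so it lies in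
  the previous disc, where the lift is already known and fixes the next one.\<close>

lemma lift_half_plane:
  assumes h: "h holomorphic_on {z. Re z > m}" "h ` {z. Re z > m} \<subseteq> V"
    and c: "Re c > m" and z0: "f z0 = h c"
  shows "\<exists>g. lifts f h c z0 {z. Re z > m} g"
proof -
  define d where "d = Re c - m"
  define r where "r n = d * (3/2) ^ n" for n :: nat
  define cn where "cn n = Complex (m + r n) (Im c)" for n
  have d0: "d > 0" using c by (simp add: d_def)
  have r0: "r n > 0" for n using d0 by (simp add: r_def)
  have dz0: "deriv f z0 \<noteq> 0" using regular z0 h c by force
  have c0: "cn 0 = c" by (simp add: cn_def r_def d_def complex_eq_iff)
  have BH: "ball (cn n) (r n) \<subseteq> {z. Re z > m}" for n
  proof
    fix z assume "z \<in> ball (cn n) (r n)"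
    then have "cmod (cn n - z) < r n" by (simp add: dist_norm)
    then have "\<bar>Re (cn n - z)\<bar> < r n" using abs_Re_le_cmod le_less_trans by blast
    then show "z \<in> {z. Re z > m}" by (simp add: cn_def)
  qed
  have rS: "r (Suc n) = r n + r n / 2" for n by (simp add: r_def field_simps)
  have dc: "dist (cn n) (cn (Suc n)) = r n / 2" for n
  proof -
    have "cn n - cn (Suc n) = of_real (- (r n / 2))" by (simp add: cn_def rS complex_eq_iff)
    then show ?thesis using r0 [of n] by (simp add: dist_norm del: of_real_minus of_real_divide)
  qed
  have sub: "ball (cn n) (r n) \<subseteq> ball (cn (Suc n)) (r (Suc n))" for n
  proof
    fix z assume "z \<in> ball (cn n) (r n)"
    then show "z \<in> ball (cn (Suc n)) (r (Suc n))"
      using dc [of n] rS [of n] dist_triangle [of "cn (Suc n)" z "cn n"] by (simp add: dist_commute)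
  qed
  have mono: "mono (\<lambda>n. ball (cn n) (r n))"
    using sub by (simp add: mono_iff_le_Suc)
  have c_in: "c \<in> ball (cn n) (r n)" for n
  proof -
    have "c \<in> ball (cn 0) (r 0)" using c0 r0 [of 0] by simp
    then show ?thesis using monoD [OF mono, of 0 n] by blast
  qed
  have ex: "\<exists>g. lifts f h c z0 (ball (cn n) (r n)) g" for n
  proof (induction n)
    case 0
    show ?case unfolding c0
      by (rule lift_disc) (use h BH [of 0] r0 z0 c0 in \<open>auto intro: holomorphic_on_subset\<close>)
  next
    case (Suc n)
    then obtain g where g: "lifts f h c z0 (ball (cn n) (r n)) g" by blast
    let ?c = "cn (Suc n)"
    have cin: "?c \<in> ball (cn n) (r n)" using dc [of n] r0 [of n] by simp
    have fg: "f (g ?c) = h ?c" using g cin by (simp add: lifts_def)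
    have "\<exists>g'. lifts f h ?c (g ?c) (ball ?c (r (Suc n))) g'"
    proof (rule lift_disc [OF r0])
      show "h holomorphic_on ball ?c (r (Suc n))" by (rule holomorphic_on_subset [OF h(1) BH])
      show "h ` ball ?c (r (Suc n)) \<subseteq> V" using image_mono [OF BH] h(2) by (rule order_trans)
    qed (rule fg)
    then obtain g' where g': "lifts f h ?c (g ?c) (ball ?c (r (Suc n))) g'" by blast
    have "g' c = g c"
    proof (rule lift_unique [OF hol, of "ball (cn n) (r n)" g' g ?c])
      show "g' holomorphic_on ball (cn n) (r n)" "g holomorphic_on ball (cn n) (r n)"
        using g g' sub [of n] by (auto simp: lifts_def intro: holomorphic_on_subset)
      show "f (g' z) = f (g z)" if "z \<in> ball (cn n) (r n)" for z
        using g g' that sub [of n] by (auto simp: lifts_def)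
      show "g' ?c = g ?c" using g' by (simp add: lifts_def)
      have "?c \<in> {z. Re z > m}" using BH [of n] cin by blast
      then have "f (g' ?c) \<in> V" using fg g' h(2) by (auto simp: lifts_def)
      then show "deriv f (g' ?c) \<noteq> 0" by (rule regular)
    qed (use cin c_in in auto)
    then have "lifts f h c z0 (ball ?c (r (Suc n))) g'" using g g' by (simp add: lifts_def)
    then show ?case by blast
  qed
  have "\<exists>g. lifts f h c z0 (\<Union>n. ball (cn n) (r n)) g"
    by (rule lifts_Union [OF hol dz0 _ _ mono _ ex]) (use c_in in auto)
  moreover have "(\<Union>n. ball (cn n) (r n)) = {z. Re z > m}"
  proof (intro equalityI subsetI)
    fix z assume z: "z \<in> {z. Re z > m}"
    define u where "u = Re z - m"
    define v where "v = Im z - Im c"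
    have u: "u > 0" using z by (simp add: u_def)
    \<comment> \<open>With \<open>u\<close> the distance to the boundary line and \<open>v\<close>
      the vertical offset, \<open>z\<close> lies in the \<open>n\<close>-th disc exactly when
      \<open>u\<^sup>2 + v\<^sup>2 < 2 * u * r n\<close>.\<close>
    obtain n where n: "(3/2::real) ^ n > (u\<^sup>2 + v\<^sup>2) / (2 * u * d)"
      using real_arch_pow [of "3/2"] by auto
    then have "u\<^sup>2 + v\<^sup>2 < 2 * u * r n" using u d0 by (simp add: r_def field_simps)
    then have "(u - r n)\<^sup>2 + v\<^sup>2 < (r n)\<^sup>2" by (simp add: power2_eq_square algebra_simps)
    moreover have "(dist (cn n) z)\<^sup>2 = (u - r n)\<^sup>2 + v\<^sup>2"
      unfolding dist_norm cmod_power2 by (simp add: cn_def u_def v_def power2_eq_square algebra_simps)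
    ultimately have "dist (cn n) z < r n"
      using r0 [of n] by (metis less_eq_real_def power_less_imp_less_base)
    then show "z \<in> (\<Union>n. ball (cn n) (r n))" by auto
  qed (use BH in blast)
  ultimately show ?thesis by simp
qed

end

section \<open>Logarithmic tracts\<close>

lemma exp_eq_shift: "exp (z + 2 * of_real pi * \<i> * of_int k) = exp (z::complex)"
  unfolding exp_eq by (intro exI [of _ k]) (simp add: mult_ac)

lemma exp_eq_imp_shift:
  assumes "exp z = exp (w::complex)"
  obtains n :: int where "z = w + 2 * of_real pi * \<i> * of_int n"
proof -
  obtain n :: int where "z = w + (of_int (2 * n) * pi) * \<i>" using assms exp_eq by blast
  then have "z = w + 2 * of_real pi * \<i> * of_int n" by (simp add: mult_ac)
  then show ?thesis by (rule that)
qed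

lemma polynomial_of_tendsto_infinity:
  assumes f: "f holomorphic_on UNIV"
    and lim: "\<And>B. \<exists>r. \<forall>z. cmod z > r \<longrightarrow> cmod (f z) \<ge> B"
  shows "\<exists>p :: complex poly. f = poly p"
proof -
  have "filterlim f at_infinity at_infinity"
    unfolding filterlim_at_infinity [OF order.refl] eventually_at_infinity
  proof (intro allI impI)
    fix B :: real
    obtain r where r: "\<And>z. cmod z > r \<Longrightarrow> cmod (f z) \<ge> B" using lim by blast
    show "\<exists>b. \<forall>x. b \<le> cmod x \<longrightarrow> B \<le> cmod (f x)"
      using r by (intro exI [of _ "r + 1"]) auto
  qed
  then have "((inverse \<circ> f) \<longlongrightarrow> 0) at_infinity"
    unfolding o_def by (rule filterlim_compose [OF tendsto_inverse_0])
  then obtain a n where a: "\<And>z. f z = (\<Sum>i\<le>n. a i * z ^ i)"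
    using pole_at_infinity [OF f] by blast
  have "f = poly (\<Sum>i\<le>n. monom (a i) i)"
    by (rule ext) (simp add: a poly_sum poly_monom)
  then show ?thesis by blast
qed

section \<open>Inverse branches of the function over a neighbourhood of infinity\<close>

locale large_values = 
  fixes f :: "complex \<Rightarrow> complex" and R :: real
  assumes hol: "f holomorphic_on UNIV"
    and not_poly: "\<not> (\<exists>p :: complex poly. f = poly p)"
    and R: "R > 0"
    and sing: "\<And>w. w \<in> singular_values f \<Longrightarrow> cmod w < R"

sublocale large_values \<subseteq> asymptotically_regular f "{w. cmod w > R}"
proof
  show "f holomorphic_on UNIV" by (rule hol)
  show "deriv f z \<noteq> 0" if "f z \<in> {w. cmod w > R}" for z
  proof
    assume "deriv f z = 0"
    then have "f z \<in> singular_values f" by (auto simp: singular_values_def critical_values_def)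
    then show False using sing that by fastforce
  qed
  show "{w. cmod w > R} \<inter> asymptotic_values f = {}"
    using sing by (fastforce simp: singular_values_def)
qed

context large_values
begin

definition \<rho> :: real where "\<rho> = ln R"

text \<open>An inverse of \<open>f\<close> over \<open>{w. cmod w > R}\<close>, made single valued
  by uniformising that region by \<open>exp\<close>. The values still lie in the plane of
  \<open>f\<close>; their logarithm is taken only in \<open>log_tract_exists\<close>.\<close>

definition is_branch :: "(complex \<Rightarrow> complex) \<Rightarrow> bool" where
  "is_branch g \<longleftrightarrow> g holomorphic_on {z. Re z > \<rho>} \<and> (\<forall>z. Re z > \<rho> \<longrightarrow> f (g z) = exp z)"

lemma exp_gt_R: "Re z > \<rho> \<Longrightarrow> cmod (exp z) > R"
  using R exp_less_mono [of "ln R" "Re z"] by (simp add: \<rho>_def del: exp_less_mono)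

lemma branch_exists:
  assumes "cmod (f w) > R"
  obtains g where "is_branch g" "g (Ln (f w)) = w" "Re (Ln (f w)) > \<rho>"
proof -
  have fw: "f w \<noteq> 0" using assms R by auto
  have re: "Re (Ln (f w)) > \<rho>" using assms R fw by (simp add: \<rho>_def)
  have "exp ` {z. Re z > \<rho>} \<subseteq> {w. cmod w > R}" using exp_gt_R by blast
  then have "\<exists>g. lifts f exp (Ln (f w)) w {z. Re z > \<rho>} g"
    by (intro lift_half_plane re) (auto intro: holomorphic_intros simp: fw)
  then show ?thesis using that re by (auto simp: lifts_def is_branch_def)
qed

lemma branch_shift:
  assumes "is_branch g"
  shows "is_branch (\<lambda>z. g (z + 2 * of_real pi * \<i> * of_int k))"
  unfolding is_branch_def
proof (intro conjI allI impI)
  have g: "g holomorphic_on {z. Re z > \<rho>}" using assms by (simp add: is_branch_def)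
  show "(\<lambda>z. g (z + 2 * of_real pi * \<i> * of_int k)) holomorphic_on {z. Re z > \<rho>}"
    by (rule holomorphic_on_compose_gen [OF _ g, unfolded o_def]) (auto intro!: holomorphic_intros)
  show "f (g (z + 2 * of_real pi * \<i> * of_int k)) = exp z" if "Re z > \<rho>" for z
  proof -
    have "Re (z + 2 * of_real pi * \<i> * of_int k) > \<rho>" using that by simp
    then show ?thesis using assms exp_eq_shift by (simp add: is_branch_def)
  qed
qed

lemma branch_unique:
  assumes "is_branch g1" "is_branch g2" and z: "Re z0 > \<rho>" "g1 z0 = g2 z0" "Re z > \<rho>"
  shows "g1 z = g2 z"
proof (rule lift_unique [OF hol, of "{z. Re z > \<rho>}" g1 g2 z0])
  show "deriv f (g1 z0) \<noteq> 0"
  proof (rule regular)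
    have "f (g1 z0) = exp z0" using assms(1) z(1) by (simp add: is_branch_def)
    then show "f (g1 z0) \<in> {w. cmod w > R}" using exp_gt_R [OF z(1)] by simp
  qed
  show "connected {z. Re z > \<rho>}" by (intro convex_connected convex_halfspace_Re_gt)
  show "open {z. Re z > \<rho>}" by (rule open_halfspace_Re_gt)
  show "g1 holomorphic_on {z. Re z > \<rho>}" "g2 holomorphic_on {z. Re z > \<rho>}"
    using assms(1,2) by (simp_all add: is_branch_def)
  show "f (g1 w) = f (g2 w)" if "w \<in> {z. Re z > \<rho>}" for w
    using assms(1,2) that by (simp add: is_branch_def)
qed (use z in simp_all)

text \<open>\<open>f\<close> is bounded on the disc of radius \<open>X\<close>, while
  \<open>f (g z) = exp z\<close> is large when \<open>Re z\<close> is.\<close>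

lemma branch_large:
  assumes g: "is_branch g"
  shows "\<exists>A. \<forall>z. Re z > \<rho> \<longrightarrow> Re z \<ge> A \<longrightarrow> cmod (g z) > X"
proof -
  have "compact (f ` cball 0 X)"
    using hol by (intro compact_continuous_image compact_cball)
      (auto intro!: holomorphic_on_imp_continuous_on intro: holomorphic_on_subset)
  then have "bounded (f ` cball 0 X)" by (rule compact_imp_bounded)
  then obtain B where B: "B > 0" "\<And>w. cmod w \<le> X \<Longrightarrow> cmod (f w) \<le> B"
    unfolding bounded_pos by auto
  have "cmod (g z) > X" if "Re z > \<rho>" "Re z \<ge> ln B + 1" for z
  proof (rule ccontr)
    assume "\<not> cmod (g z) > X"
    then have "cmod (f (g z)) \<le> B" using B(2) by simp
    moreover have "f (g z) = exp z" using g that by (simp add: is_branch_def)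
    ultimately have "exp (Re z) \<le> B" by simp
    then have "Re z \<le> ln B" using B(1) by (simp add: ln_ge_iff)
    then show False using that by simp
  qed
  then show ?thesis by blast
qed

text \<open>A periodic branch would parametrise a punctured neighbourhood of infinity, so that \<open>f\<close> would
  tend to infinity there.\<close>

lemma branch_not_periodic:
  assumes g: "is_branch g" and k: "k > (0::int)"
    and per: "\<And>z. Re z > \<rho> \<Longrightarrow> g (z + 2 * of_real pi * \<i> * of_int k) = g z"
  shows False
proof -
  have holg: "g holomorphic_on {z. Re z > \<rho>}" and fg: "\<And>z. Re z > \<rho> \<Longrightarrow> f (g z) = exp z"
    using g by (auto simp: is_branch_def)
  have contg: "continuous_on {z. Re z > \<rho>} g" by (rule holomorphic_on_imp_continuous_on [OF holg])
  have contf: "isCont f w" for w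
    using holomorphic_on_imp_continuous_on [OF hol] by (simp add: continuous_on_eq_continuous_at)
  have pern: "g (z + 2 * of_real pi * \<i> * of_int k * of_nat n) = g z" if "Re z > \<rho>" for z n
  proof (induction n)
    case (Suc n)
    have "g (z + 2 * of_real pi * \<i> * of_int k * of_nat n + 2 * of_real pi * \<i> * of_int k) =
        g (z + 2 * of_real pi * \<i> * of_int k * of_nat n)"
      by (rule per) (use that in simp)
    then show ?case using Suc by (simp add: algebra_simps)
  qed simp
  have peri: "g (z + 2 * of_real pi * \<i> * of_int k * of_int n) = g z" if "Re z > \<rho>" for z n
  proof (cases n)
    case (nonneg j)
    then show ?thesis using pern [OF that, of j] by simp
  next
    case (neg j)
    define z' where "z' = z + 2 * of_real pi * \<i> * of_int k * of_int n"
    have "g (z' + 2 * of_real pi * \<i> * of_int k * of_nat (Suc j)) = g z'"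
      by (rule pern) (use that in \<open>simp add: z'_def\<close>)
    moreover have "z' + 2 * of_real pi * \<i> * of_int k * of_nat (Suc j) = z"
      unfolding z'_def neg by (simp add: algebra_simps del: of_nat_Suc)
    ultimately have "g z = g z'" by (simp del: of_nat_Suc)
    then show ?thesis by (simp add: z'_def)
  qed
  define P where "P = 2 * pi * of_int k"
  have P0: "P > 0" using k by (simp add: P_def)
  have reduce: "\<exists>z'. Re z' = Re z \<and> 0 \<le> Im z' \<and> Im z' \<le> P \<and> g z' = g z" if "Re z > \<rho>" for z
  proof -
    define n where "n = - \<lfloor>Im z / P\<rfloor>"
    define z' where "z' = z + 2 * of_real pi * \<i> * of_int k * of_int n"
    have "Im z' = Im z - P * of_int \<lfloor>Im z / P\<rfloor>" by (simp add: z'_def n_def P_def)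
    also have "\<dots> = P * frac (Im z / P)" using P0 by (simp add: frac_def algebra_simps)
    finally have "Im z' = P * frac (Im z / P)" .
    then have "0 \<le> Im z'" "Im z' \<le> P"
      using P0 frac_ge_0 [of "Im z / P"] less_imp_le [OF frac_lt_1 [of "Im z / P"]]
      by (auto intro: mult_left_le)
    moreover have "Re z' = Re z" by (simp add: z'_def)
    moreover have "g z' = g z" unfolding z'_def by (rule peri [OF that])
    ultimately show ?thesis by blast
  qed
  have "\<exists>r. \<forall>z. cmod z > r \<longrightarrow> cmod (f z) \<ge> B" for B
  proof -
    \<comment> \<open>On the image \<open>Y\<close> of \<open>Re z \<ge> A\<close> the modulus of
      \<open>f\<close> is at least \<open>exp A \<ge> B\<close>. So it suffices that
      \<open>Y\<close> contains a neighbourhood of infinity.\<close>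
    define A where "A = max (\<rho> + 1) (ln (max B 1))"
    have A: "A > \<rho>" by (simp add: A_def)
    have eA: "exp A \<ge> B"
    proof -
      have "B \<le> exp (ln (max B 1))" by simp
      also have "\<dots> \<le> exp A" unfolding exp_le_cancel_iff by (simp add: A_def)
      finally show ?thesis .
    qed
    define Y where "Y = g ` {z. Re z \<ge> A}"
    \<comment> \<open>Along a convergent sequence in \<open>Y\<close> the values of \<open>f\<close>
      are bounded, which bounds the real parts of the preimages under \<open>g\<close>; periodicity
      lets their imaginary parts be taken in \<open>[0, P]\<close>. The preimages therefore
      accumulate.\<close>
    have clY: "closed Y"
      unfolding closed_sequential_limits
    proof (intro allI impI, elim conjE)
      fix y l assume y: "\<forall>n. y n \<in> Y" and lim: "y \<longlonglongrightarrow> l"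
      have "\<exists>z. Re z \<ge> A \<and> 0 \<le> Im z \<and> Im z \<le> P \<and> g z = y n" for n
      proof -
        obtain z where z: "Re z \<ge> A" "y n = g z" using y unfolding Y_def by blast
        then obtain z' where "Re z' = Re z \<and> 0 \<le> Im z' \<and> Im z' \<le> P \<and> g z' = g z"
          using reduce [of z] A by auto
        then show ?thesis using z by (intro exI [of _ z']) simp
      qed
      then have "\<exists>z. \<forall>n. Re (z n) \<ge> A \<and> 0 \<le> Im (z n) \<and> Im (z n) \<le> P \<and> g (z n) = y n"
        by (intro choice allI)
      then obtain z where z: "\<And>n. Re (z n) \<ge> A" "\<And>n. 0 \<le> Im (z n)" "\<And>n. Im (z n) \<le> P"
          "\<And>n. g (z n) = y n" by blast
      have "convergent (\<lambda>n. f (y n))"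
        using isCont_tendsto_compose [OF contf lim] by (auto simp: convergent_def)
      then have "Bseq (\<lambda>n. f (y n))" by (rule convergent_imp_Bseq)
      then obtain K where K: "K > 0" "\<And>n. cmod (f (y n)) \<le> K" unfolding Bseq_def by blast
      have "Re (z n) \<le> ln K" for n
      proof -
        have "f (y n) = exp (z n)" using fg [of "z n"] z(1) [of n] A by (simp add: z(4))
        then have "exp (Re (z n)) \<le> K" using K(2) [of n] by simp
        then show ?thesis using K(1) by (simp add: ln_ge_iff)
      qed
      then have "\<forall>n. z n \<in> cbox (Complex A 0) (Complex (ln K) P)"
        using z by (simp add: in_cbox_complex_iff)
      then obtain l' \<sigma> where \<sigma>: "l' \<in> cbox (Complex A 0) (Complex (ln K) P)"
          "strict_mono (\<sigma> :: nat \<Rightarrow> nat)" "(z \<circ> \<sigma>) \<longlonglongrightarrow> l'"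
        by (rule seq_compactE [OF compact_imp_seq_compact [OF compact_cbox]])
      have l': "Re l' \<ge> A" using \<sigma>(1) by (simp add: in_cbox_complex_iff)
      then have "isCont g l'"
        using contg A by (simp add: continuous_on_eq_continuous_at open_halfspace_Re_gt)
      then have "(\<lambda>n. g ((z \<circ> \<sigma>) n)) \<longlonglongrightarrow> g l'" using \<sigma>(3) by (rule isCont_tendsto_compose)
      moreover have "(\<lambda>n. g ((z \<circ> \<sigma>) n)) = y \<circ> \<sigma>" by (auto simp: z(4))
      moreover have "(y \<circ> \<sigma>) \<longlonglongrightarrow> l" using LIMSEQ_subseq_LIMSEQ [OF lim \<sigma>(2)] .
      ultimately have "g l' = l" by (simp add: LIMSEQ_unique)
      then show "l \<in> Y" using l' by (auto simp: Y_def)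
    qed
    define Kc where "Kc = g ` cbox (Complex A 0) (Complex A P)"
    have "compact Kc"
      unfolding Kc_def
      by (intro compact_continuous_image compact_cbox continuous_on_subset [OF contg])
        (use A in \<open>auto simp: in_cbox_complex_iff\<close>)
    then have "bounded Kc" by (rule compact_imp_bounded)
    then obtain r where r: "\<And>w. w \<in> Kc \<Longrightarrow> cmod w \<le> r"
      unfolding bounded_iff by blast
    \<comment> \<open>By the open mapping theorem only the line \<open>Re z = A\<close> can produce
      frontier points, and one period of that line suffices. Hence the frontier is bounded.\<close>
    have fr: "frontier Y \<subseteq> Kc"
    proof
      fix y assume y: "y \<in> frontier Y"
      then have "y \<in> Y" using frontier_subset_closed [OF clY] by blast
      then obtain z where z: "Re z \<ge> A" "y = g z" by (auto simp: Y_def)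
      have "Re z = A"
      proof (rule ccontr)
        assume "Re z \<noteq> A"
        then have zA: "Re z > A" using z by simp
        have "open (g ` {z. Re z > A})"
        proof (rule open_mapping_thm [OF holg])
          show "\<not> g constant_on {z. Re z > \<rho>}"
          proof
            assume "g constant_on {z. Re z > \<rho>}"
            then obtain c where c: "\<And>z. Re z > \<rho> \<Longrightarrow> g z = c" by (auto simp: constant_on_def)
            have "g (of_real (\<rho> + 1)) = g (of_real (\<rho> + 2))" using c by simp
            then have "exp (of_real (\<rho> + 1)) = exp (of_real (\<rho> + 2) :: complex)"
              using fg [of "of_real (\<rho> + 1)"] fg [of "of_real (\<rho> + 2)"] by simp
            then have "cmod (exp (of_real (\<rho> + 1))) = cmod (exp (of_real (\<rho> + 2) :: complex))" by simp
            then show False by simp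
          qed
        qed (use A in \<open>auto simp: open_halfspace_Re_gt convex_connected convex_halfspace_Re_gt\<close>)
        moreover have "y \<in> g ` {z. Re z > A}" using zA z by blast
        moreover have "g ` {z. Re z > A} \<subseteq> Y" by (auto simp: Y_def)
        ultimately have "y \<in> interior Y" by (meson interiorI)
        then show False using y by (simp add: frontier_def)
      qed
      then obtain z' where "Re z' = A" "0 \<le> Im z'" "Im z' \<le> P" "g z' = y"
        using reduce [of z] A z by auto
      then show "y \<in> Kc"
        unfolding Kc_def by (intro image_eqI [of _ _ z']) (simp_all add: in_cbox_complex_iff)
    qed
    \<comment> \<open>A connected exterior region that meets \<open>Y\<close> but not its frontier
      is contained in \<open>Y\<close>.\<close>
    define X where "X = - cball (0::complex) (max r 0)"
    have "connected X"
      unfolding X_def by (rule connected_complement_bounded_convex) auto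
    moreover have "X \<inter> Y \<noteq> {}"
    proof -
      obtain A' where A': "\<And>z. Re z > \<rho> \<Longrightarrow> Re z \<ge> A' \<Longrightarrow> cmod (g z) > max r 0"
        using branch_large [OF g] by blast
      define t where "t = max A A'"
      have t: "t \<ge> A" "t \<ge> A'" by (auto simp: t_def)
      then have "cmod (g (of_real t)) > max r 0" using A' [of "of_real t"] A by simp
      then have "g (of_real t) \<in> X" unfolding X_def by (simp add: not_le del: max_less_iff_conj)
      moreover have "g (of_real t) \<in> Y" unfolding Y_def using t by (intro imageI) simp
      ultimately show ?thesis by blast
    qed
    moreover have "X \<inter> frontier Y = {}"
    proof -
      have "w \<notin> X" if "w \<in> frontier Y" for w
      proof -
        have "cmod w \<le> r" using that fr r by blast
        then show ?thesis by (simp add: X_def)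
      qed
      then show ?thesis by blast
    qed
    ultimately have "X - Y = {}" using connected_Int_frontier by blast
    then have "cmod (f w) \<ge> B" if "cmod w > max r 0" for w
    proof -
      have "w \<in> X" unfolding X_def using that by (simp add: not_le del: max_less_iff_conj)
      then have "w \<in> Y" using \<open>X - Y = {}\<close> by blast
      then obtain z where z: "Re z \<ge> A" "w = g z" unfolding Y_def by blast
      then have "cmod (f w) = exp (Re z)" using fg [of z] A by simp
      also have "\<dots> \<ge> exp A" using z by simp
      finally show ?thesis using eA by simp
    qed
    then show ?thesis by blast
  qed
  then show False using polynomial_of_tendsto_infinity [OF hol] not_poly by blast
qed

text \<open>Two points with the same image differ by a multiple of \<open>2 \<pi> \<i>\<close>. The
  branch and its translate then agree at one point, hence everywhere, which
  \<open>branch_not_periodic\<close> excludes.\<close>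

lemma branch_inj:
  assumes g: "is_branch g" and z: "Re z > \<rho>" "Re w > \<rho>" and eq: "g z = g w"
  shows "z = w"
proof (rule ccontr)
  assume "z \<noteq> w"
  have "exp z = exp w" using g z eq unfolding is_branch_def by metis
  then obtain n :: int where n: "z = w + 2 * of_real pi * \<i> * of_int n" by (rule exp_eq_imp_shift)
  have n0: "n \<noteq> 0" using n \<open>z \<noteq> w\<close> by auto
  have per: "g (u + 2 * of_real pi * \<i> * of_int n) = g u" if "Re u > \<rho>" for u
    by (rule branch_unique [OF branch_shift [OF g] g z(2) _ that]) (use eq n in \<open>simp add: algebra_simps\<close>)
  show False
  proof (cases "n > 0")
    case True
    then show False using branch_not_periodic [OF g True per] by simp
  next
    case False
    then have "- n > 0" using n0 by simp
    moreover have "g (u + 2 * of_real pi * \<i> * of_int (- n)) = g u" if "Re u > \<rho>" for u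
      using per [of "u + 2 * of_real pi * \<i> * of_int (- n)"] that by simp
    ultimately show False by (rule branch_not_periodic [OF g])
  qed
qed

text \<open>Unlike in \<open>branch_large\<close>, \<open>z\<close> may escape vertically. If the
  images accumulated at a finite \<open>w\<close>, then \<open>cmod (f w) \<ge> exp M > R\<close>,
  so some branch \<open>h\<close> parametrises a neighbourhood of \<open>w\<close>. Each image near
  \<open>w\<close> makes \<open>h\<close> a translate of \<open>g\<close>, and the translation
  becomes arbitrarily long; but injectivity of \<open>g\<close> admits only one translation.\<close>

lemma branch_at_infinity:
  assumes g: "is_branch g" and M: "M > \<rho>"
  shows "\<exists>\<kappa>. \<forall>z. Re z \<ge> M \<longrightarrow> cmod z \<ge> \<kappa> \<longrightarrow> cmod (g z) \<ge> X"
proof (rule ccontr)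
  assume "\<not> ?thesis"
  then have "\<forall>n::nat. \<exists>z. Re z \<ge> M \<and> cmod z \<ge> real n \<and> cmod (g z) < X" by (meson not_le)
  then obtain z where z: "\<And>n. Re (z n) \<ge> M" "\<And>n::nat. cmod (z n) \<ge> real n" "\<And>n. cmod (g (z n)) < X"
    by metis
  have zr: "Re (z n) > \<rho>" for n using z(1) [of n] M by simp
  have fg: "f (g (z n)) = exp (z n)" for n using g zr by (simp add: is_branch_def)
  have "\<forall>n. (g \<circ> z) n \<in> cball 0 X" using z(3) by (simp add: less_imp_le)
  then obtain w \<sigma> where \<sigma>: "strict_mono (\<sigma> :: nat \<Rightarrow> nat)" "(g \<circ> z \<circ> \<sigma>) \<longlonglongrightarrow> w"
    by (rule seq_compactE [OF compact_imp_seq_compact [OF compact_cball]])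
  have "isCont f w"
    using holomorphic_on_imp_continuous_on [OF hol] by (simp add: continuous_on_eq_continuous_at)
  then have "(\<lambda>n. cmod (f ((g \<circ> z \<circ> \<sigma>) n))) \<longlonglongrightarrow> cmod (f w)"
    by (intro tendsto_norm isCont_tendsto_compose [OF _ \<sigma>(2)])
  moreover have "cmod (f ((g \<circ> z \<circ> \<sigma>) n)) \<ge> exp M" for n
    using z(1) by (simp add: fg)
  ultimately have "cmod (f w) \<ge> exp M" by (intro LIMSEQ_le_const) auto
  moreover have "exp M > R" using exp_gt_R [of "of_real M"] M by simp
  ultimately have "cmod (f w) > R" by simp
  then obtain h where h: "is_branch h" "h (Ln (f w)) = w" "Re (Ln (f w)) > \<rho>"
    by (rule branch_exists)
  define c where "c = Ln (f w)"
  obtain d where d: "d > 0" "ball c d \<subseteq> {z. Re z > \<rho>}"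
    using h(3) open_halfspace_Re_gt open_contains_ball unfolding c_def by (metis mem_Collect_eq)
  have holh: "h holomorphic_on ball c d"
    using h(1) d(2) holomorphic_on_subset by (auto simp: is_branch_def)
  have "inj_on h (ball c d)"
    using branch_inj [OF h(1)] d(2) by (auto simp: inj_on_def)
  then have "open (h ` ball c d)" using open_mapping_thm3 [OF holh] by simp
  moreover have "w \<in> h ` ball c d" 
    using h(2) d(1) by (intro image_eqI [of _ _ c]) (auto simp: c_def)
  ultimately have ev: "eventually (\<lambda>n. (g \<circ> z \<circ> \<sigma>) n \<in> h ` ball c d) sequentially"
    using topological_tendstoD [OF \<sigma>(2)] by blast
  have key: "\<exists>k::int. (\<forall>u. Re u > \<rho> \<longrightarrow> g (u + 2 * of_real pi * \<i> * of_int k) = h u) \<and>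
      cmod (z m) < cmod c + d + 2 * pi * of_int \<bar>k\<bar>"
    if gm: "g (z m) \<in> h ` ball c d" for m
  proof -
    obtain y where y: "y \<in> ball c d" "g (z m) = h y" using gm by blast
    have yr: "Re y > \<rho>" using y d by blast
    have "exp (z m) = exp y" using fg [of m] y h(1) yr by (simp add: is_branch_def)
    then obtain n :: int where n: "z m = y + 2 * of_real pi * \<i> * of_int n" by (rule exp_eq_imp_shift)
    have "g (u + 2 * of_real pi * \<i> * of_int n) = h u" if "Re u > \<rho>" for u
      by (rule branch_unique [OF branch_shift [OF g] h(1) yr _ that])
        (use y n in \<open>simp add: algebra_simps\<close>)
    moreover have "cmod (z m) < cmod c + d + 2 * pi * of_int \<bar>n\<bar>"
    proof -
      have "cmod (z m) \<le> cmod y + cmod (2 * of_real pi * \<i> * of_int n)"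
        unfolding n by (rule norm_triangle_ineq)
      also have "cmod (2 * of_real pi * \<i> * of_int n) = 2 * pi * of_int \<bar>n\<bar>"
        by (simp add: norm_mult)
      also have "cmod y < cmod c + d"
      proof -
        have "cmod (y - c) < d" using y(1) by (simp add: dist_norm norm_minus_commute)
        then show ?thesis using norm_triangle_sub [of y c] by simp
      qed
      finally show ?thesis by simp
    qed
    ultimately show ?thesis by blast
  qed
  obtain N where N: "\<And>n. n \<ge> N \<Longrightarrow> g (z (\<sigma> n)) \<in> h ` ball c d"
    using ev by (auto simp: eventually_sequentially)
  obtain k :: int where k: "\<And>u. Re u > \<rho> \<Longrightarrow> g (u + 2 * of_real pi * \<i> * of_int k) = h u"
    using key [OF N [OF order.refl]] by blast
  obtain n0 :: nat where n0: "real n0 > cmod c + d + 2 * pi * of_int \<bar>k\<bar>" using reals_Archimedean2 by blast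
  define n where "n = max N n0"
  obtain k' :: int where k': "\<And>u. Re u > \<rho> \<Longrightarrow> g (u + 2 * of_real pi * \<i> * of_int k') = h u"
      "cmod (z (\<sigma> n)) < cmod c + d + 2 * pi * of_int \<bar>k'\<bar>"
    using key [OF N [of n]] by (auto simp: n_def)
  have "real n0 \<le> real (\<sigma> n)" using seq_suble [OF \<sigma>(1), of n] by (simp add: n_def)
  also have "\<dots> \<le> cmod (z (\<sigma> n))" by (rule z)
  finally have "k' \<noteq> k" using n0 k'(2) by auto
  moreover have "c + 2 * of_real pi * \<i> * of_int k = c + 2 * of_real pi * \<i> * of_int k'"
    by (rule branch_inj [OF g]) (use h(3) k [of c] k'(1) [of c] in \<open>auto simp: c_def\<close>)
  ultimately show False by simp
qed

end

text \<open>\<open>G\<close> is a branch of \<open>ln \<circ> f\<^sup>-\<^sup>1 \<circ> exp\<close>.\<close>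

locale log_tract =
  fixes f G :: "complex \<Rightarrow> complex" and \<rho> :: real
  assumes hol_f: "f holomorphic_on UNIV"
    and hol_G: "G holomorphic_on {z. Re z > \<rho>}"
    and f_exp_G: "\<And>z. Re z > \<rho> \<Longrightarrow> f (exp (G z)) = exp z"
    and exp_G_inj: "\<And>z w. Re z > \<rho> \<Longrightarrow> Re w > \<rho> \<Longrightarrow> exp (G z) = exp (G w) \<Longrightarrow> z = w"
    and G_at_infinity: "\<And>M X. M > \<rho> \<Longrightarrow> \<exists>\<kappa>. \<forall>z. Re z \<ge> M \<longrightarrow> cmod z \<ge> \<kappa> \<longrightarrow> Re (G z) \<ge> X"

text \<open>A branch on a half plane has a holomorphic logarithm once it omits 0, and then
  \<open>Re (G z)\<close> is the logarithm of \<open>cmod (g z)\<close>.\<close>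

lemma log_tract_exists:
  assumes "entire_transcendental f" "class_S f"
  shows "\<exists>G \<rho>. log_tract f G \<rho>"
proof -
  have f: "f holomorphic_on UNIV" and np: "\<not> (\<exists>p :: complex poly. f = poly p)"
    using assms(1) unfolding entire_transcendental_def by (rule conjunct1, rule conjunct2)
  \<comment> \<open>With \<open>R\<close> above \<open>cmod (f 0)\<close> as well, no branch takes
    the value 0, since \<open>f\<close> has modulus above \<open>R\<close> at the values of a
    branch.\<close>
  have "bounded (insert (f 0) (singular_values f))"
    using assms(2) unfolding class_S_def by (intro finite_imp_bounded finite.insertI)
  then obtain B where B: "\<And>w. w \<in> insert (f 0) (singular_values f) \<Longrightarrow> cmod w \<le> B"
    unfolding bounded_iff by blast
  define R where "R = max B 0 + 1"
  have RB: "cmod w < R" if "w \<in> insert (f 0) (singular_values f)" for w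
    using B [OF that] by (simp add: R_def)
  interpret large_values f R
  proof
    show "R > 0" by (simp add: R_def)
    show "cmod w < R" if "w \<in> singular_values f" for w using RB that by blast
  qed (rule f np)+
  have "\<not> bounded (range f)"
  proof
    assume "bounded (range f)"
    then have "f constant_on UNIV" using Liouville_theorem [OF f] by simp
    then obtain c where "\<And>z. f z = c" unfolding constant_on_def by blast
    then have "f = poly [:c:]" by (intro ext) simp
    then show False using np by blast
  qed
  then obtain w where w: "cmod (f w) > R" unfolding bounded_iff by (auto simp: not_le)
  then obtain g where g: "is_branch g" by (rule branch_exists)
  have fg: "f (g z) = exp z" if "Re z > \<rho>" for z using g that by (simp add: is_branch_def)
  have g0: "g z \<noteq> 0" if "Re z > \<rho>" for z
  proof
    assume "g z = 0"
    then have "f 0 = exp z" using fg that by metis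
    then show False using exp_gt_R [OF that] RB [of "f 0"] by simp
  qed
  have "g holomorphic_on {z. Re z > \<rho>}" using g by (simp add: is_branch_def)
  moreover have "contractible {z. Re z > \<rho>}"
    by (intro convex_imp_contractible convex_halfspace_Re_gt)
  moreover have "g z \<noteq> 0" if "z \<in> {z. Re z > \<rho>}" for z using g0 that by simp
  ultimately obtain G where G: "G holomorphic_on {z. Re z > \<rho>}"
      "\<And>z. z \<in> {z. Re z > \<rho>} \<Longrightarrow> g z = exp (G z)"
    using contractible_imp_holomorphic_log [of g "{z. Re z > \<rho>}"] by blast
  have "log_tract f G \<rho>"
  proof
    show "f (exp (G z)) = exp z" if "Re z > \<rho>" for z using fg G(2) that by simp
    show "z = w" if "Re z > \<rho>" "Re w > \<rho>" "exp (G z) = exp (G w)" for z w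
      using branch_inj [OF g] G(2) that by simp
    show "\<exists>\<kappa>. \<forall>z. Re z \<ge> M \<longrightarrow> cmod z \<ge> \<kappa> \<longrightarrow> Re (G z) \<ge> X" if M: "M > \<rho>" for M X
    proof -
      obtain \<kappa> where \<kappa>: "\<And>z. Re z \<ge> M \<Longrightarrow> cmod z \<ge> \<kappa> \<Longrightarrow> cmod (g z) \<ge> exp X"
        using branch_at_infinity [OF g M] by blast
      have "Re (G z) \<ge> X" if "Re z \<ge> M" "cmod z \<ge> \<kappa>" for z
        using \<kappa> [OF that] G(2) [of z] that(1) M by simp
      then show ?thesis by blast
    qed
  qed (use f G in auto)
  then show ?thesis by blast
qed

section \<open>Inverse branches and multipliers\<close>

lemma holomorphic_funpow:
  assumes "\<phi> holomorphic_on D" "\<phi> ` D \<subseteq> D"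
  shows "(\<phi> ^^ n) holomorphic_on D \<and> (\<phi> ^^ n) ` D \<subseteq> D"
proof (induction n)
  case (Suc n)
  then have "(\<phi> \<circ> (\<phi> ^^ n)) holomorphic_on D"
    using assms(1) by (intro holomorphic_on_compose_gen) auto
  moreover have "(\<phi> \<circ> (\<phi> ^^ n)) ` D \<subseteq> D" using Suc assms(2) by auto
  ultimately show ?case unfolding funpow.simps by blast
qed (auto intro: holomorphic_intros)

lemma inj_on_funpow:
  assumes "inj_on \<phi> D" "\<phi> ` D \<subseteq> D"
  shows "inj_on (\<phi> ^^ n) D \<and> (\<phi> ^^ n) ` D \<subseteq> D"
proof (induction n)
  case (Suc n)
  then have "inj_on (\<phi> \<circ> (\<phi> ^^ n)) D"
    using assms(1) by (intro comp_inj_on) (auto intro: inj_on_subset)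
  moreover have "(\<phi> \<circ> (\<phi> ^^ n)) ` D \<subseteq> D" using Suc assms(2) by auto
  ultimately show ?case unfolding funpow.simps by blast
qed auto

lemma deriv_funpow_fixpoint:
  assumes "h holomorphic_on UNIV" "h p = p"
  shows "deriv (h ^^ c) p = deriv h p ^ c"
proof (induction c)
  case 0
  show ?case by (simp add: id_def)
next
  case (Suc c)
  have hc: "(h ^^ c) p = p" using assms(2) by (induction c) auto
  have "(h ^^ c) holomorphic_on UNIV" using holomorphic_funpow [OF assms(1)] by simp
  then have "((h ^^ c) has_field_derivative deriv (h ^^ c) p) (at p)"
    by (rule holomorphic_derivI) auto
  moreover have "(h has_field_derivative deriv h p) (at ((h ^^ c) p))"
    unfolding hc by (rule holomorphic_derivI [OF assms(1)]) auto
  ultimately have "(h \<circ> (h ^^ c) has_field_derivative deriv h p * deriv (h ^^ c) p) (at p)"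
    by (intro DERIV_chain)
  then show ?case unfolding funpow.simps power_Suc Suc by (rule DERIV_imp_deriv)
qed

text \<open>The point \<open>exp z\<close> is fixed by \<open>f ^^ m\<close>, whose derivative there
  is the reciprocal of \<open>deriv \<Psi> z\<close>: the factors \<open>exp z\<close> from the
  change of coordinates cancel at a fixed point.\<close>

lemma multiplier_real_of_inverse_branch:
  assumes f: "f holomorphic_on UNIV"
    and real: "\<And>n p. repelling_periodic_point f n p \<Longrightarrow> multiplier f n p \<in> \<real>"
    and W: "open W" "z \<in> W" "\<Psi> holomorphic_on W" "\<Psi> z = z"
    and inv: "\<And>w. w \<in> W \<Longrightarrow> (f ^^ m) (exp (\<Psi> w)) = exp w"
    and m: "m > 0" and small: "cmod (deriv \<Psi> z) < 1"
  shows "deriv \<Psi> z \<in> \<real>"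
proof -
  define p where "p = exp z"
  have fp: "(f ^^ m) p = p" using inv [OF W(2)] W(4) by (simp add: p_def)
  have holm: "(f ^^ n) holomorphic_on UNIV" for n using holomorphic_funpow [OF f] by simp
  have d\<Psi>: "(\<Psi> has_field_derivative deriv \<Psi> z) (at z)"
    by (rule holomorphic_derivI [OF W(3,1,2)])
  have "((\<lambda>w. exp (\<Psi> w)) has_field_derivative p * deriv \<Psi> z) (at z)"
    using d\<Psi> W(4) by (auto intro!: derivative_eq_intros simp: p_def)
  moreover have "((f ^^ m) has_field_derivative deriv (f ^^ m) p) (at (exp (\<Psi> z)))"
    unfolding W(4) p_def by (rule holomorphic_derivI [OF holm]) auto
  ultimately have "((\<lambda>w. (f ^^ m) (exp (\<Psi> w))) has_field_derivative
      deriv (f ^^ m) p * (p * deriv \<Psi> z)) (at z)"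
    by (rule DERIV_chain2 [rotated])
  then have "(exp has_field_derivative deriv (f ^^ m) p * (p * deriv \<Psi> z)) (at z)"
    by (rule has_field_derivative_transform_within_open [OF _ W(1,2)]) (rule inv)
  then have "deriv (f ^^ m) p * (p * deriv \<Psi> z) = p"
    unfolding p_def by (rule DERIV_unique) (rule DERIV_exp)
  then have "p * (deriv (f ^^ m) p * deriv \<Psi> z) = p * 1" by (simp add: mult_ac)
  then have dm: "deriv (f ^^ m) p * deriv \<Psi> z = 1" by (simp add: p_def)
  have dm1: "cmod (deriv (f ^^ m) p) > 1"
  proof (rule ccontr)
    assume "\<not> ?thesis"
    then have "cmod (deriv (f ^^ m) p) * cmod (deriv \<Psi> z) \<le> 1 * cmod (deriv \<Psi> z)"
      by (intro mult_right_mono) auto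
    then have "cmod (deriv (f ^^ m) p * deriv \<Psi> z) < 1" using small by (simp add: norm_mult)
    then show False using dm by simp
  qed
  \<comment> \<open>\<open>m\<close> need not be the exact period \<open>d\<close>. It is a multiple
    of \<open>d\<close>, the derivative of \<open>f ^^ m\<close> is a power of the multiplier, and
    both modulus above 1 and reality pass between the two.\<close>
  define d where "d = (LEAST k. k > 0 \<and> (f ^^ k) p = p)"
  have d: "d > 0 \<and> (f ^^ d) p = p"
    unfolding d_def by (rule LeastI [of _ m]) (use m fp in simp)
  have least: "(f ^^ k) p \<noteq> p" if "0 < k" "k < d" for k
    using not_less_Least [of k "\<lambda>k. k > 0 \<and> (f ^^ k) p = p"] that by (auto simp: d_def)
  have "m mod d = 0"
  proof (rule ccontr)
    assume "m mod d \<noteq> 0"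
    then have "(f ^^ (m mod d)) p \<noteq> p" using d by (intro least) auto
    then show False using funpow_mod_eq [of d f p m] d fp by simp
  qed
  then obtain c where c: "m = d * c" by (auto simp: mod_eq_0_iff_dvd)
  have dc: "deriv (f ^^ m) p = deriv (f ^^ d) p ^ c"
    unfolding c funpow_mult [symmetric] by (rule deriv_funpow_fixpoint) (use holm d in auto)
  have "cmod (deriv (f ^^ d) p) > 1"
  proof (rule ccontr)
    assume "\<not> ?thesis"
    then have "cmod (deriv (f ^^ m) p) \<le> 1" unfolding dc norm_power by (intro power_le_one) auto
    then show False using dm1 by simp
  qed
  then have "repelling_periodic_point f d p"
    using d least by (simp add: repelling_periodic_point_def periodic_point_def multiplier_def)
  then have "deriv (f ^^ d) p \<in> \<real>" using real by (fastforce simp: multiplier_def)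
  then have "deriv (f ^^ m) p \<in> \<real>" unfolding dc by (rule Reals_power)
  moreover have "deriv \<Psi> z = inverse (deriv (f ^^ m) p)" using dm inverse_unique by metis
  ultimately show ?thesis by simp
qed

text \<open>Banach's theorem is applied on the closed set \<open>K\<close>, since the open
  \<open>D\<close> is not complete. Convexity turns the derivative bound into a contraction on all
  of \<open>D\<close>, and boundedness of \<open>D\<close> makes the rate of convergence
  uniform.\<close>

lemma contraction_attracts:
  fixes D K :: "complex set"
  assumes D: "convex D" "open D" "bounded D" and K: "closed K" "K \<subseteq> D" "K \<noteq> {}"
    and \<phi>: "\<phi> holomorphic_on D" "\<phi> ` D \<subseteq> K"
    and d: "\<And>z. z \<in> D \<Longrightarrow> cmod (deriv \<phi> z) \<le> 1/2"
  obtains \<zeta> where "\<zeta> \<in> K" "\<phi> \<zeta> = \<zeta>"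
    "\<And>e. e > 0 \<Longrightarrow> eventually (\<lambda>n. \<forall>z\<in>D. dist ((\<phi> ^^ n) z) \<zeta> < e) sequentially"
proof -
  have lip: "dist (\<phi> z) (\<phi> w) \<le> 1/2 * dist z w" if "z \<in> D" "w \<in> D" for z w
    unfolding dist_norm
  proof (rule field_differentiable_bound [OF D(1) _ d that])
    show "(\<phi> has_field_derivative deriv \<phi> z) (at z within D)" if "z \<in> D" for z
      using holomorphic_derivI [OF \<phi>(1) D(2) that] by (rule has_field_derivative_at_within)
  qed
  have "\<exists>!x. x \<in> K \<and> \<phi> x = x"
  proof (rule Banach_fix [where c = "1/2"])
    show "complete K" using K(1) by (simp add: complete_eq_closed)
    show "\<phi> ` K \<subseteq> K" using \<phi>(2) K(2) by blast
    show "\<And>x y. x \<in> K \<Longrightarrow> y \<in> K \<Longrightarrow> dist (\<phi> x) (\<phi> y) \<le> 1/2 * dist x y"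
      using lip K(2) by blast
  qed (use K in auto)
  then obtain \<zeta> where \<zeta>: "\<zeta> \<in> K" "\<phi> \<zeta> = \<zeta>" by blast
  have \<zeta>D: "\<zeta> \<in> D" using \<zeta> K by blast
  obtain B where B: "B > 0" "\<And>z. z \<in> D \<Longrightarrow> cmod z \<le> B"
    using D(3) unfolding bounded_pos by blast
  have it: "(\<phi> ^^ n) z \<in> D \<and> dist ((\<phi> ^^ n) z) \<zeta> \<le> (1/2) ^ n * (2 * B)" if z: "z \<in> D" for n z
  proof (induction n)
    case 0
    have "dist z \<zeta> \<le> cmod z + cmod \<zeta>" unfolding dist_norm by (rule norm_triangle_ineq4)
    then show ?case using z B(2) [OF z] B(2) [OF \<zeta>D] by simp
  next
    case (Suc n)
    have "dist (\<phi> ((\<phi> ^^ n) z)) (\<phi> \<zeta>) \<le> 1/2 * dist ((\<phi> ^^ n) z) \<zeta>"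
      using Suc \<zeta>D by (intro lip) auto
    then have "dist (\<phi> ((\<phi> ^^ n) z)) \<zeta> \<le> (1/2) ^ Suc n * (2 * B)" using Suc \<zeta> by simp
    moreover have "\<phi> ((\<phi> ^^ n) z) \<in> D" using Suc \<phi>(2) K(2) by blast
    ultimately show ?case by simp
  qed
  have "eventually (\<lambda>n. \<forall>z\<in>D. dist ((\<phi> ^^ n) z) \<zeta> < e) sequentially" if e: "e > 0" for e
  proof -
    have "(\<lambda>n. (1/2) ^ n * (2 * B)) \<longlonglongrightarrow> 0 * (2 * B)"
      by (intro tendsto_mult_right LIMSEQ_power_zero) simp
    then have "eventually (\<lambda>n. (1/2) ^ n * (2 * B) < e) sequentially"
      using e by (intro order_tendstoD(2)) auto
    then show ?thesis
    proof (rule eventually_mono)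
      fix n assume "(1/2) ^ n * (2 * B) < e"
      then show "\<forall>z\<in>D. dist ((\<phi> ^^ n) z) \<zeta> < e" using it le_less_trans by blast
    qed
  qed
  then show ?thesis using that \<zeta> by blast
qed

text \<open>The germ at \<open>\<zeta>\<close> of an inverse branch of \<open>f ^^ d\<close> in
  logarithmic coordinates. The neighbourhood is left existential because it may shrink under
  composition.\<close>

definition inverse_branch_at ::
    "(complex \<Rightarrow> complex) \<Rightarrow> nat \<Rightarrow> (complex \<Rightarrow> complex) \<Rightarrow> complex \<Rightarrow> bool" where
  "inverse_branch_at f d \<psi> \<zeta> \<longleftrightarrow> (\<exists>W. open W \<and> \<zeta> \<in> W \<and> \<psi> holomorphic_on W \<and>
     (\<forall>w\<in>W. (f ^^ d) (exp (\<psi> w)) = exp w))"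

lemma inverse_branch_at_id: "inverse_branch_at f 0 (\<lambda>w. w) \<zeta>"
  unfolding inverse_branch_at_def by (intro exI [of _ UNIV]) (auto intro: holomorphic_intros)

lemma inverse_branch_at_shift:
  assumes "inverse_branch_at f d \<psi> \<zeta>"
  shows "inverse_branch_at f d (\<lambda>w. \<psi> w + 2 * of_real pi * \<i> * of_int k) \<zeta>"
  using assms unfolding inverse_branch_at_def exp_eq_shift
  by (auto intro!: holomorphic_intros)

lemma inverse_branch_at_compose:
  assumes \<psi>: "inverse_branch_at f d \<psi> \<zeta>" and S: "open S" "\<psi> \<zeta> \<in> S" "\<Theta> holomorphic_on S"
    and inv: "\<And>w. w \<in> S \<Longrightarrow> (f ^^ t) (exp (\<Theta> w)) = exp w"
  shows "inverse_branch_at f (d + t) (\<lambda>w. \<Theta> (\<psi> w)) \<zeta>"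
proof -
  obtain W where W: "open W" "\<zeta> \<in> W" "\<psi> holomorphic_on W" "\<And>w. w \<in> W \<Longrightarrow> (f ^^ d) (exp (\<psi> w)) = exp w"
    using \<psi> unfolding inverse_branch_at_def by blast
  define W' where "W' = W \<inter> \<psi> -` S"
  have "open W'"
    unfolding W'_def using W S by (intro continuous_open_preimage holomorphic_on_imp_continuous_on)
  moreover have "\<zeta> \<in> W'" using W S by (simp add: W'_def)
  moreover have "(\<lambda>w. \<Theta> (\<psi> w)) holomorphic_on W'"
    by (rule holomorphic_on_compose_gen [OF _ S(3), unfolded o_def])
      (use W in \<open>auto simp: W'_def intro: holomorphic_on_subset\<close>)
  moreover have "(f ^^ (d + t)) (exp (\<Theta> (\<psi> w))) = exp w" if "w \<in> W'" for w
    using that W(4) inv by (simp add: funpow_add W'_def)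
  ultimately show ?thesis unfolding inverse_branch_at_def by blast
qed

text \<open>Uniformity of \<open>attracts\<close> on \<open>D\<close> is the point: whichever
  inverse branch lands in \<open>D\<close>, following it by enough iterates of \<open>\<phi>\<close>
  gives a map that is nearly constant close to \<open>\<zeta>\<close>.\<close>

locale attracting_branch =
  fixes f :: "complex \<Rightarrow> complex" and D :: "complex set" and \<phi> :: "complex \<Rightarrow> complex" and \<zeta> :: complex
  assumes hol_f: "f holomorphic_on UNIV"
    and real: "\<And>n p. repelling_periodic_point f n p \<Longrightarrow> multiplier f n p \<in> \<real>"
    and D: "open D"
    and hol_\<phi>: "\<phi> holomorphic_on D" and inj_\<phi>: "inj_on \<phi> D" and \<phi>_D: "\<phi> ` D \<subseteq> D"
    and f_exp_\<phi>: "\<And>z. z \<in> D \<Longrightarrow> f (exp (\<phi> z)) = exp z"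
    and attracts: "\<And>e. e > 0 \<Longrightarrow> eventually (\<lambda>n. \<forall>z\<in>D. dist ((\<phi> ^^ n) z) \<zeta> < e) sequentially"
begin

lemma funpow_in_D: "z \<in> D \<Longrightarrow> (\<phi> ^^ n) z \<in> D"
  using holomorphic_funpow [OF hol_\<phi> \<phi>_D] by blast

lemma f_exp_funpow: "z \<in> D \<Longrightarrow> (f ^^ n) (exp ((\<phi> ^^ n) z)) = exp z"
proof (induction n)
  case (Suc n)
  have "(f ^^ Suc n) (exp ((\<phi> ^^ Suc n) z)) = (f ^^ n) (f (exp (\<phi> ((\<phi> ^^ n) z))))"
    by (simp add: funpow_swap1)
  then show ?case using Suc f_exp_\<phi> [OF funpow_in_D] by simp
qed simp

text \<open>Composing \<open>\<psi>\<close> with many iterates of \<open>\<phi>\<close> produces a fixed point close to \<open>\<zeta>\<close>, which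
  corresponds to a repelling periodic orbit of \<open>f\<close>.\<close>

lemma eventually_real_derivative:
  assumes \<psi>: "inverse_branch_at f d \<psi> \<zeta>" "\<psi> \<zeta> \<in> D" and e: "e > 0"
  shows "eventually (\<lambda>n. \<exists>z. dist \<zeta> z < e \<and> deriv (\<phi> ^^ n) (\<psi> z) * deriv \<psi> z \<in> \<real>) sequentially"
proof -
  obtain W where W: "open W" "\<zeta> \<in> W" "\<psi> holomorphic_on W" "\<And>w. w \<in> W \<Longrightarrow> (f ^^ d) (exp (\<psi> w)) = exp w"
    using \<psi> unfolding inverse_branch_at_def by blast
  define W' where "W' = W \<inter> \<psi> -` D"
  have W': "open W'" "\<zeta> \<in> W'" "\<psi> holomorphic_on W'"
    unfolding W'_def using W \<psi> D
    by (auto intro!: continuous_open_preimage holomorphic_on_imp_continuous_on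
        intro: holomorphic_on_subset)
  obtain \<delta>0 where \<delta>0: "\<delta>0 > 0" "cball \<zeta> \<delta>0 \<subseteq> W'" using W' open_contains_cball by metis
  define \<delta> where "\<delta> = min \<delta>0 e"
  have \<delta>: "\<delta> > 0" "\<delta> \<le> e" "cball \<zeta> \<delta> \<subseteq> W'" using \<delta>0 e by (auto simp: \<delta>_def)
  have "eventually (\<lambda>n. \<forall>z\<in>D. dist ((\<phi> ^^ n) z) \<zeta> < \<delta> / 4) sequentially"
    by (rule attracts) (use \<delta> in simp)
  then show ?thesis
    using eventually_gt_at_top [of 0]
  proof eventually_elim
    case (elim n)
    define \<Psi> where "\<Psi> w = (\<phi> ^^ n) (\<psi> w)" for w
    have holn: "(\<phi> ^^ n) holomorphic_on D" using holomorphic_funpow [OF hol_\<phi> \<phi>_D] by blast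
    have hol\<Psi>: "\<Psi> holomorphic_on W'"
      unfolding \<Psi>_def
      by (rule holomorphic_on_compose_gen [OF W'(3) holn, unfolded o_def]) (auto simp: W'_def)
    have near: "dist (\<Psi> w) \<zeta> < \<delta> / 4" if "w \<in> W'" for w
      unfolding \<Psi>_def using elim that by (simp add: W'_def)
    obtain z where z: "z \<in> cball \<zeta> \<delta>" "\<Psi> z = z"
    proof (rule brouwer [of "cball \<zeta> \<delta>" \<Psi>])
      show "continuous_on (cball \<zeta> \<delta>) \<Psi>"
        using hol\<Psi> \<delta>(3) by (intro holomorphic_on_imp_continuous_on) (rule holomorphic_on_subset)
      show "\<Psi> \<in> cball \<zeta> \<delta> \<rightarrow> cball \<zeta> \<delta>"
      proof
        fix w assume "w \<in> cball \<zeta> \<delta>"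
        then have "dist (\<Psi> w) \<zeta> < \<delta> / 4" using near \<delta>(3) by blast
        then show "\<Psi> w \<in> cball \<zeta> \<delta>" using \<delta>(1) by (simp add: dist_commute)
      qed
    qed (use \<delta>(1) in auto)
    have zW: "z \<in> W'" using z \<delta> by blast
    have zn: "dist \<zeta> z < \<delta> / 4" using near [OF zW] z(2) by (simp add: dist_commute)
    have sub: "cball z (\<delta>/2) \<subseteq> W'"
    proof
      fix w assume "w \<in> cball z (\<delta>/2)"
      then have "dist \<zeta> w \<le> \<delta>" using zn dist_triangle [of \<zeta> w z] \<delta>(1) by simp
      then show "w \<in> W'" using \<delta>(3) by auto
    qed
    \<comment> \<open>The values of \<open>\<Psi>\<close> stay within \<open>\<delta>/4\<close> of
      \<open>\<zeta>\<close> while a disc of radius \<open>\<delta>/2\<close> around the fixed point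
      is available, so the derivative is at most 1/2 in modulus.\<close>
    have "cmod ((deriv ^^ 1) (\<lambda>w. \<Psi> w - \<zeta>) z) \<le> fact 1 * (\<delta>/4) / (\<delta>/2) ^ 1"
    proof (rule Cauchy_inequality)
      show "(\<lambda>w. \<Psi> w - \<zeta>) holomorphic_on ball z (\<delta>/2)"
        using holomorphic_on_subset [OF hol\<Psi>] sub ball_subset_cball
        by (intro holomorphic_intros) blast
      show "continuous_on (cball z (\<delta>/2)) (\<lambda>w. \<Psi> w - \<zeta>)"
        using holomorphic_on_subset [OF hol\<Psi> sub]
        by (intro continuous_intros holomorphic_on_imp_continuous_on)
      show "cmod (\<Psi> x - \<zeta>) \<le> \<delta>/4" if "cmod (z - x) = \<delta>/2" for x
      proof -
        have "x \<in> W'" using that sub by (auto simp: dist_norm)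
        then show ?thesis using near [of x] by (simp add: dist_norm)
      qed
    qed (use \<delta> in simp)
    moreover have d\<Psi>: "(\<Psi> has_field_derivative deriv \<Psi> z) (at z)"
      by (rule holomorphic_derivI [OF hol\<Psi> W'(1) zW])
    then have "((\<lambda>w. \<Psi> w - \<zeta>) has_field_derivative deriv \<Psi> z) (at z)"
      by (auto intro!: derivative_eq_intros)
    then have "deriv (\<lambda>w. \<Psi> w - \<zeta>) z = deriv \<Psi> z" by (rule DERIV_imp_deriv)
    ultimately have "cmod (deriv \<Psi> z) < 1" using \<delta>(1) by simp
    moreover have "(f ^^ (d + n)) (exp (\<Psi> w)) = exp w" if "w \<in> W'" for w
      using that f_exp_funpow [of "\<psi> w" n] W(4) [of w] by (simp add: funpow_add \<Psi>_def W'_def)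
    ultimately have "deriv \<Psi> z \<in> \<real>"
      using multiplier_real_of_inverse_branch [OF hol_f real W'(1) zW hol\<Psi> z(2), of "d + n"] elim
      by simp
    moreover have "deriv \<Psi> z = deriv (\<phi> ^^ n) (\<psi> z) * deriv \<psi> z"
    proof (rule DERIV_imp_deriv)
      have "((\<phi> ^^ n) has_field_derivative deriv (\<phi> ^^ n) (\<psi> z)) (at (\<psi> z))"
        by (rule holomorphic_derivI [OF holn D]) (use zW in \<open>simp add: W'_def\<close>)
      moreover have "(\<psi> has_field_derivative deriv \<psi> z) (at z)"
        by (rule holomorphic_derivI [OF W'(3,1) zW])
      ultimately show "(\<Psi> has_field_derivative deriv (\<phi> ^^ n) (\<psi> z) * deriv \<psi> z) (at z)"
        unfolding \<Psi>_def by (rule DERIV_chain2)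
    qed
    ultimately show ?case using zn \<delta> by (intro exI [of _ z]) auto
  qed
qed

end

text \<open>\<open>deriv p\<close> equals \<open>F'' / F'\<close>, so the distortion bound applies;
  the constant is the same for every univalent \<open>F\<close>, in particular for all iterates at
  once.\<close>

lemma log_deriv_bound:
  assumes Om: "open Om" and F: "F holomorphic_on Om" "inj_on F Om"
    and p: "p holomorphic_on Om" "\<And>w. w \<in> Om \<Longrightarrow> exp (p w) = deriv F w"
    and r: "r > 0" "ball z r \<subseteq> Om"
  shows "cmod (deriv p z) \<le> distortion_const / r"
proof -
  have z: "z \<in> Om" using r by auto
  have "((\<lambda>w. exp (p w)) has_field_derivative exp (p z) * deriv p z) (at z)"
    using holomorphic_derivI [OF p(1) Om z] by (auto intro!: derivative_eq_intros)
  then have "(deriv F has_field_derivative exp (p z) * deriv p z) (at z)"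
    by (rule has_field_derivative_transform_within_open [OF _ Om z]) (rule p(2))
  then have "deriv (deriv F) z = deriv F z * deriv p z"
    by (simp add: DERIV_imp_deriv p(2) [OF z])
  moreover have "cmod (deriv (deriv F) z) \<le> distortion_const * cmod (deriv F z) / r"
    using holomorphic_on_subset [OF F(1) r(2)] inj_on_subset [OF F(2) r(2)]
    by (rule univalent_second_deriv_bound [OF r(1)])
  ultimately have "cmod (deriv F z) * cmod (deriv p z) \<le> cmod (deriv F z) * (distortion_const / r)"
    by (simp add: norm_mult mult_ac)
  moreover have "0 < cmod (deriv F z)" using p(2) [OF z, symmetric] by simp
  ultimately show ?thesis by (rule mult_left_le_imp_le)
qed

lemma norm_cis_diff_le: "cmod (cis x - cis y) \<le> \<bar>x - y\<bar>"
proof -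
  have "cis x - cis y = cis y * (cis (x - y) - 1)"
    by (simp add: right_diff_distrib cis_mult)
  then have "cmod (cis x - cis y) = cmod (exp (\<i> * of_real (x - y)) - 1)"
    by (simp add: norm_mult cis_conv_exp)
  also have "\<dots> = 2 * \<bar>sin ((x - y) / 2)\<bar>" by (rule dist_exp_i_1)
  also have "\<dots> \<le> 2 * \<bar>(x - y) / 2\<bar>" using abs_sin_x_le_abs_x [of "(x - y) / 2"] by simp
  finally show ?thesis by simp
qed

lemma sgn_exp_complex: "sgn (exp q) = cis (Im q)"
proof -
  have "exp q = of_real (exp (Re q)) * cis (Im q)" by (rule exp_eq_polar)
  then have "sgn (exp q) = sgn (of_real (exp (Re q))) * sgn (cis (Im q))"
    by (simp only: Real_Vector_Spaces.sgn_mult)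
  also have "\<dots> = cis (Im q)" unfolding sgn_of_real by (simp add: sgn_div_norm)
  finally show ?thesis .
qed

lemma inverse_branch_at_deriv_nonzero:
  assumes f: "f holomorphic_on UNIV" and \<psi>: "inverse_branch_at f d \<psi> \<zeta>"
  shows "deriv \<psi> \<zeta> \<noteq> 0"
proof
  assume z: "deriv \<psi> \<zeta> = 0"
  obtain W where W: "open W" "\<zeta> \<in> W" "\<psi> holomorphic_on W" "\<And>w. w \<in> W \<Longrightarrow> (f ^^ d) (exp (\<psi> w)) = exp w"
    using \<psi> unfolding inverse_branch_at_def by blast
  have "(\<psi> has_field_derivative 0) (at \<zeta>)"
    using holomorphic_derivI [OF W(3,1,2)] z by simp
  then have "((\<lambda>w. exp (\<psi> w)) has_field_derivative 0) (at \<zeta>)"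
    by (auto intro!: derivative_eq_intros)
  moreover have "(f ^^ d) holomorphic_on UNIV" using holomorphic_funpow [OF f] by simp
  then have "((f ^^ d) has_field_derivative deriv (f ^^ d) (exp (\<psi> \<zeta>))) (at (exp (\<psi> \<zeta>)))"
    by (rule holomorphic_derivI) auto
  ultimately have "((\<lambda>w. (f ^^ d) (exp (\<psi> w))) has_field_derivative
      deriv (f ^^ d) (exp (\<psi> \<zeta>)) * 0) (at \<zeta>)"
    by (rule DERIV_chain2 [rotated])
  then have "(exp has_field_derivative deriv (f ^^ d) (exp (\<psi> \<zeta>)) * 0) (at \<zeta>)"
    by (rule has_field_derivative_transform_within_open [OF _ W(1,2)]) (rule W(4))
  then have "deriv (f ^^ d) (exp (\<psi> \<zeta>)) * 0 = exp \<zeta>"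
    by (rule DERIV_unique) (rule DERIV_exp)
  then show False by simp
qed

context attracting_branch
begin

text \<open>At a fixed point \<open>z\<close> near \<open>\<zeta>\<close> the number
  \<open>exp (p n (\<tau> z)) * deriv \<eta> z\<close> is real. The fixed point depends on
  \<open>n\<close>, but by distortion the functions \<open>Im (p n)\<close> are Lipschitz near
  \<open>b\<close> with a constant independent of \<open>n\<close>, so \<open>z\<close> may be
  replaced by \<open>\<zeta>\<close> in the limit. The factor
  \<open>sgn (deriv \<eta> \<zeta>)\<close> does not depend on \<open>k\<close>.\<close>

lemma iterate_direction_tendsto:
  assumes \<eta>: "inverse_branch_at f d \<eta> \<zeta>"
    and Om: "open Om" and \<Theta>: "\<Theta> holomorphic_on Om" "\<Theta> ` Om \<subseteq> D" "inj_on \<Theta> Om"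
    and inv: "\<And>w. w \<in> Om \<Longrightarrow> (f ^^ t) (exp (\<Theta> w)) = exp w"
    and p: "\<And>n. p n holomorphic_on Om"
      "\<And>n w. w \<in> Om \<Longrightarrow> exp (p n w) = deriv (\<lambda>w. (\<phi> ^^ n) (\<Theta> w)) w"
    and b: "b = \<eta> \<zeta> + 2 * of_real pi * \<i> * of_int k" "b \<in> Om"
  shows "(\<lambda>n. Im (cis (Im (p n b)) * sgn (deriv \<eta> \<zeta>))) \<longlonglongrightarrow> 0"
proof (rule tendstoI)
  fix e :: real assume e: "e > 0"
  obtain r0 where r0: "r0 > 0" "ball b r0 \<subseteq> Om" using Om b open_contains_ball by blast
  define r where "r = r0 / 2"
  have r: "r > 0" using r0 by (simp add: r_def)
  have sub: "ball w r \<subseteq> Om" if "w \<in> ball b r" for w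
  proof
    fix v assume "v \<in> ball w r"
    then have "dist b v < r0" using that dist_triangle [of b v w] by (simp add: r_def)
    then show "v \<in> Om" using r0 by auto
  qed
  have hol: "(\<lambda>w. (\<phi> ^^ n) (\<Theta> w)) holomorphic_on Om" for n
    by (rule holomorphic_on_compose_gen [OF \<Theta>(1) conjunct1 [OF holomorphic_funpow [OF hol_\<phi> \<phi>_D]]
          \<Theta>(2), unfolded o_def])
  have inj: "inj_on (\<lambda>w. (\<phi> ^^ n) (\<Theta> w)) Om" for n
  proof -
    have "inj_on (\<phi> ^^ n) (\<Theta> ` Om)"
      by (rule inj_on_subset [OF conjunct1 [OF inj_on_funpow [OF inj_\<phi> \<phi>_D]] \<Theta>(2)])
    then show ?thesis by (rule comp_inj_on [OF \<Theta>(3), unfolded o_def])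
  qed
  define K where "K = distortion_const / r"
  have lip: "\<bar>Im (p n w) - Im (p n b)\<bar> \<le> K * cmod (w - b)" if w: "w \<in> ball b r" for n w
  proof -
    have "cmod (p n w - p n b) \<le> K * cmod (w - b)"
    proof (rule field_differentiable_bound [OF convex_ball, of b r])
      show "(p n has_field_derivative deriv (p n) x) (at x within ball b r)" if "x \<in> ball b r" for x
      proof -
        have "x \<in> ball x r" using r by simp
        then have "x \<in> Om" using sub [OF that] by blast
        then show ?thesis by (rule holomorphic_derivI [OF p(1) Om])
      qed
      show "cmod (deriv (p n) x) \<le> K" if "x \<in> ball b r" for x
        unfolding K_def by (rule log_deriv_bound [OF Om hol inj p r sub [OF that]])
    qed (use w r in auto)
    then show ?thesis using abs_Im_le_cmod [of "p n w - p n b"] by simp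
  qed
  obtain W where W: "open W" "\<zeta> \<in> W" "\<eta> holomorphic_on W"
    using \<eta> unfolding inverse_branch_at_def by blast
  have d0: "deriv \<eta> \<zeta> \<noteq> 0" by (rule inverse_branch_at_deriv_nonzero [OF hol_f \<eta>])
  have cont: "isCont \<eta> \<zeta>" "isCont (deriv \<eta>) \<zeta>"
    using W holomorphic_on_imp_continuous_on [OF W(3)]
      holomorphic_on_imp_continuous_on [OF holomorphic_deriv [OF W(3,1)]]
    by (simp_all add: continuous_on_eq_continuous_at)
  \<comment> \<open>A bound, independent of \<open>n\<close>, for the error of replacing
    \<open>z\<close> by \<open>\<zeta>\<close> in the direction of the multiplier.\<close>
  define h where "h z = K * cmod (\<eta> z - \<eta> \<zeta>) + cmod (sgn (deriv \<eta> z) - sgn (deriv \<eta> \<zeta>))" for z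
  have "isCont h \<zeta>" unfolding h_def using cont d0 by (intro continuous_intros) auto
  then have "(h \<longlongrightarrow> 0) (nhds \<zeta>)" by (simp add: isCont_def tendsto_nhds_iff h_def)
  then have "eventually (\<lambda>z. h z < e) (nhds \<zeta>)" using e by (rule order_tendstoD)
  moreover have "(\<eta> \<longlongrightarrow> \<eta> \<zeta>) (nhds \<zeta>)" using cont(1) by (simp add: isCont_def tendsto_nhds_iff)
  then have "eventually (\<lambda>z. dist (\<eta> z) (\<eta> \<zeta>) < r) (nhds \<zeta>)" using r by (rule tendstoD)
  moreover have "eventually (\<lambda>z. z \<in> W) (nhds \<zeta>)" using W eventually_nhds_in_open by blast
  ultimately have "eventually (\<lambda>z. h z < e \<and> dist (\<eta> z) (\<eta> \<zeta>) < r \<and> z \<in> W) (nhds \<zeta>)"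
    by eventually_elim simp
  then obtain \<delta> where \<delta>: "\<delta> > 0"
      "\<And>z. dist z \<zeta> < \<delta> \<Longrightarrow> h z < e \<and> dist (\<eta> z) (\<eta> \<zeta>) < r \<and> z \<in> W"
    unfolding eventually_nhds_metric by blast
  define \<tau> where "\<tau> z = \<eta> z + 2 * of_real pi * \<i> * of_int k" for z
  have \<tau>: "inverse_branch_at f d \<tau> \<zeta>" unfolding \<tau>_def by (rule inverse_branch_at_shift [OF \<eta>])
  have \<tau>b: "\<tau> \<zeta> = b" by (simp add: \<tau>_def b)
  define \<psi> where "\<psi> z = \<Theta> (\<tau> z)" for z
  have \<psi>: "inverse_branch_at f (d + t) \<psi> \<zeta>"
    unfolding \<psi>_def by (rule inverse_branch_at_compose [OF \<tau> Om _ \<Theta>(1) inv]) (use b \<tau>b in auto)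
  have "\<psi> \<zeta> \<in> D" using \<Theta>(2) b \<tau>b by (auto simp: \<psi>_def)
  with \<psi> have "eventually (\<lambda>n. \<exists>z. dist \<zeta> z < \<delta> \<and> deriv (\<phi> ^^ n) (\<psi> z) * deriv \<psi> z \<in> \<real>) sequentially"
    using \<delta>(1) by (rule eventually_real_derivative)
  then show "eventually (\<lambda>n. dist (Im (cis (Im (p n b)) * sgn (deriv \<eta> \<zeta>))) 0 < e) sequentially"
  proof eventually_elim
    case (elim n)
    then obtain z where z: "dist \<zeta> z < \<delta>" "deriv (\<phi> ^^ n) (\<psi> z) * deriv \<psi> z \<in> \<real>" by blast
    have z': "h z < e" "dist (\<eta> z) (\<eta> \<zeta>) < r" "z \<in> W" 
      using \<delta>(2) [of z] z(1) unfolding dist_commute [of z \<zeta>] by blast+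
    have \<tau>zb: "\<tau> z - b = \<eta> z - \<eta> \<zeta>" by (simp add: \<tau>_def b)
    have y: "\<tau> z \<in> ball b r"
      using z'(2) \<tau>zb by (simp add: dist_norm norm_minus_commute [of b])
    have "\<tau> z \<in> ball (\<tau> z) r" using r by simp
    then have yOm: "\<tau> z \<in> Om" using sub [OF y] by blast
    have d\<tau>: "(\<tau> has_field_derivative deriv \<eta> z) (at z)"
      unfolding \<tau>_def using holomorphic_derivI [OF W(3,1) z'(3)] by (auto intro!: derivative_eq_intros)
    have d\<Theta>: "(\<Theta> has_field_derivative deriv \<Theta> (\<tau> z)) (at (\<tau> z))"
      by (rule holomorphic_derivI [OF \<Theta>(1) Om yOm])
    have "(\<phi> ^^ n) holomorphic_on D" using holomorphic_funpow [OF hol_\<phi> \<phi>_D] by blast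
    then have d\<phi>: "((\<phi> ^^ n) has_field_derivative deriv (\<phi> ^^ n) (\<psi> z)) (at (\<Theta> (\<tau> z)))"
      unfolding \<psi>_def by (rule holomorphic_derivI [OF _ D]) (use yOm \<Theta>(2) in blast)
    have "deriv \<psi> z = deriv \<Theta> (\<tau> z) * deriv \<eta> z"
      unfolding \<psi>_def by (rule DERIV_imp_deriv, rule DERIV_chain2 [OF d\<Theta> d\<tau>])
    moreover have "exp (p n (\<tau> z)) = deriv (\<phi> ^^ n) (\<psi> z) * deriv \<Theta> (\<tau> z)"
      unfolding p(2) [OF yOm] by (rule DERIV_imp_deriv, rule DERIV_chain2 [OF d\<phi> d\<Theta>])
    ultimately have "exp (p n (\<tau> z)) * deriv \<eta> z \<in> \<real>" using z(2) by (simp add: mult_ac)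
    then have "Im (sgn (exp (p n (\<tau> z)) * deriv \<eta> z)) = 0" by (simp add: complex_is_Real_iff Im_sgn)
    then have im0: "Im (cis (Im (p n (\<tau> z))) * sgn (deriv \<eta> z)) = 0"
      unfolding Real_Vector_Spaces.sgn_mult sgn_exp_complex .
    let ?u = "sgn (deriv \<eta> z)" and ?ub = "sgn (deriv \<eta> \<zeta>)"
    let ?c = "cis (Im (p n (\<tau> z)))" and ?cb = "cis (Im (p n b))"
    have "?cb * ?ub - ?c * ?u = (?cb - ?c) * ?ub + ?c * (?ub - ?u)" by (simp add: algebra_simps)
    then have "cmod (?cb * ?ub - ?c * ?u) \<le> cmod (?cb - ?c) * cmod ?ub + cmod ?c * cmod (?ub - ?u)"
      by (metis norm_triangle_ineq norm_mult)
    also have "\<dots> = cmod (?cb - ?c) + cmod (?ub - ?u)" using d0 by (simp add: norm_sgn)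
    also have "\<dots> \<le> K * cmod (\<eta> z - \<eta> \<zeta>) + cmod (?u - ?ub)"
    proof -
      have "cmod (?cb - ?c) \<le> \<bar>Im (p n b) - Im (p n (\<tau> z))\<bar>" by (rule norm_cis_diff_le)
      also have "\<dots> \<le> K * cmod (\<tau> z - b)" using lip [OF y, of n] by (simp add: abs_minus_commute)
      finally show ?thesis by (simp add: \<tau>zb norm_minus_commute)
    qed
    also have "\<dots> < e" using z'(1) by (simp add: h_def)
    finally have "\<bar>Im (?cb * ?ub - ?c * ?u)\<bar> < e" using abs_Im_le_cmod le_less_trans by blast
    then show ?case using im0 by (simp add: dist_real_def)
  qed
qed

text \<open>The fixed points obtained from \<open>\<Theta> \<circ> (\<eta> + 2 \<pi> \<i> j)\<close> determine the argument of the derivative at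
  \<open>a + 2 \<pi> \<i> j\<close> modulo \<open>\<pi>\<close>; the distortion bound makes consecutive arguments differ by at most
  \<open>1\<close>, which removes the ambiguity.\<close>

lemma vertical_constancy:
  assumes \<eta>: "inverse_branch_at f d \<eta> \<zeta>" and a: "a = \<eta> \<zeta>"
    and Om: "Om = {z. Re z > m} \<inter> ball 0 T"
    and \<Theta>: "\<Theta> holomorphic_on Om" "\<Theta> ` Om \<subseteq> D" "inj_on \<Theta> Om"
    and inv: "\<And>w. w \<in> Om \<Longrightarrow> (f ^^ t) (exp (\<Theta> w)) = exp w"
    and p: "\<And>n. p n holomorphic_on Om"
      "\<And>n w. w \<in> Om \<Longrightarrow> exp (p n w) = deriv (\<lambda>w. (\<phi> ^^ n) (\<Theta> w)) w"
    and bnd: "\<And>n z. Re z > m \<Longrightarrow> cmod z < T / 3 \<Longrightarrow> cmod (deriv (p n) z) \<le> C / (Re z - m)"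
    and am: "Re a > m" "cmod a < T / 3" "C * pi / (Re a - m) \<le> 1 / 2"
    and e: "e > 0"
  shows "eventually (\<lambda>n. \<forall>j::int. cmod (a + 2 * of_real pi * \<i> * of_int j) < T / 3 \<longrightarrow>
    \<bar>Im (p n (a + 2 * of_real pi * \<i> * of_int j)) - Im (p n a)\<bar> \<le> e) sequentially"
proof -
  define b where "b j = a + 2 * of_real pi * \<i> * of_int j" for j :: int
  have opOm: "open Om" unfolding Om by (intro open_Int open_halfspace_Re_gt open_ball)
  have T0: "T > 0" using am(2) norm_ge_zero [of a] by linarith
  have inOm: "x \<in> Om" if "Re x > m" "cmod x < T / 3" for x
    using that T0 by (simp add: Om)
  have reb: "Re (b j) = Re a" for j by (simp add: b_def)
  have b0: "b 0 = a" by (simp add: b_def)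
  define J where "J = {j. cmod (b j) < T / 3}"
  have 0: "0 \<in> J" using am(2) by (simp add: J_def b0)
  \<comment> \<open>By convexity of the disc the admissible indices form an interval around 0, so
    every one of them is reached from 0 by unit steps inside \<open>J\<close>.\<close>
  have between: "i \<in> J" if j: "j \<in> J" "(0 \<le> i \<and> i \<le> j) \<or> (j \<le> i \<and> i \<le> 0)" for i j
  proof (cases "j = 0")
    case True then show ?thesis using j 0 by auto
  next
    case False
    define u where "u = real_of_int i / real_of_int j"
    have u: "0 \<le> u" "u \<le> 1" using j(2) False by (auto simp: u_def field_simps divide_le_0_iff)
    have "b i = (1 - u) *\<^sub>R b 0 + u *\<^sub>R b j"
      using False by (simp add: b_def u_def scaleR_conv_of_real algebra_simps)
    moreover have "b 0 \<in> ball 0 (T / 3)" "b j \<in> ball 0 (T / 3)" using 0 j by (auto simp: J_def)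
    ultimately have "b i \<in> ball 0 (T / 3)"
      using convexD [OF convex_ball, of "b 0" 0 "T / 3" "b j" "1 - u" u] u by simp
    then show ?thesis by (simp add: J_def)
  qed
  have finJ: "finite J"
  proof (rule finite_subset)
    show "J \<subseteq> {- \<lceil>T\<rceil> .. \<lceil>T\<rceil>}"
    proof
      fix j assume "j \<in> J"
      then have "cmod (b j) < T / 3" by (simp add: J_def)
      moreover have "cmod (b j - a) \<le> cmod (b j) + cmod a" by (rule norm_triangle_ineq4)
      moreover have "cmod (b j - a) = 2 * pi * \<bar>real_of_int j\<bar>" by (simp add: b_def norm_mult)
      moreover have "\<bar>real_of_int j\<bar> * 1 \<le> \<bar>real_of_int j\<bar> * (2 * pi)"
        using pi_ge_two by (intro mult_left_mono) auto
      ultimately have "\<bar>real_of_int j\<bar> \<le> T" using am(2) T0 by (simp add: mult_ac)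
      also have "T \<le> of_int \<lceil>T\<rceil>" by (rule le_of_int_ceiling)
      finally show "j \<in> {- \<lceil>T\<rceil> .. \<lceil>T\<rceil>}" by (simp add: abs_le_iff)
    qed
  qed simp
  have lim: "(\<lambda>n. Im (cis (Im (p n (b j))) * sgn (deriv \<eta> \<zeta>))) \<longlonglongrightarrow> 0" if "j \<in> J" for j
    by (rule iterate_direction_tendsto [OF \<eta> opOm \<Theta> inv p, of _ j])
      (use that am(1) reb inOm in \<open>auto simp: b_def a J_def\<close>)
  have d0: "deriv \<eta> \<zeta> \<noteq> 0" by (rule inverse_branch_at_deriv_nonzero [OF hol_f \<eta>])
  have step: "(\<lambda>n. Im (p n (b j')) - Im (p n (b j))) \<longlonglongrightarrow> 0"
    if j: "j \<in> J" "j' \<in> J" "\<bar>j' - j\<bar> = 1" for j j'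
  proof -
    define x where "x n = Im (p n (b j')) - Im (p n (b j))" for n
    have x1: "\<bar>x n\<bar> \<le> 1" for n
    proof -
      have "cmod (p n (b j') - p n (b j)) \<le> C / (Re a - m) * cmod (b j' - b j)"
      proof (rule field_differentiable_bound)
        have seg: "Re x = Re a \<and> cmod x < T / 3" if x: "x \<in> closed_segment (b j) (b j')" for x
        proof
          have "closed_segment (b j) (b j') \<subseteq> ball 0 (T / 3)"
            by (intro closed_segment_subset convex_ball) (use j in \<open>auto simp: J_def\<close>)
          then show "cmod x < T / 3" using x by auto
          obtain u where "x = (1 - u) *\<^sub>R b j + u *\<^sub>R b j'"
            using x unfolding closed_segment_def by blast
          then have "Re x = (1 - u) * Re a + u * Re a" by (simp add: reb)
          then show "Re x = Re a" by (simp add: algebra_simps)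
        qed
        show "(p n has_field_derivative deriv (p n) x) (at x within closed_segment (b j) (b j'))"
          if "x \<in> closed_segment (b j) (b j')" for x
          using seg [OF that] am(1)
          by (intro holomorphic_derivI [OF p(1) opOm] inOm) auto
        show "cmod (deriv (p n) x) \<le> C / (Re a - m)" if "x \<in> closed_segment (b j) (b j')" for x
          using seg [OF that] am(1) bnd [of x n] by simp
      qed auto
      also have "cmod (b j' - b j) = 2 * pi"
      proof -
        have "b j' - b j = 2 * of_real pi * \<i> * of_int (j' - j)" by (simp add: b_def algebra_simps)
        also have "cmod \<dots> = 2 * pi * \<bar>real_of_int (j' - j)\<bar>" by (simp add: norm_mult del: of_int_diff)
        also have "\<bar>real_of_int (j' - j)\<bar> = 1" using j(3) by linarith
        finally show ?thesis by simp
      qed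
      also have "C / (Re a - m) * (2 * pi) = 2 * (C * pi / (Re a - m))" by simp
      also have "\<dots> \<le> 2 * (1 / 2)" using am(3) by (intro mult_left_mono) simp_all
      finally have "cmod (p n (b j') - p n (b j)) \<le> 1" by simp
      then show ?thesis using abs_Im_le_cmod [of "p n (b j') - p n (b j)"] by (simp add: x_def)
    qed
    \<comment> \<open>In the product of \<open>?s j' n\<close> with the conjugate of
      \<open>?s j n\<close> the common direction cancels, and what remains is
      \<open>cis (x n)\<close>. As \<open>\<bar>x n\<bar> \<le> 1 < pi / 2\<close>,
      \<open>arcsin\<close> recovers \<open>x n\<close> from its sine.\<close>
    have "(\<lambda>n. sin (x n)) \<longlonglongrightarrow> 0"
    proof (rule Lim_null_comparison)
      let ?s = "\<lambda>j n. cis (Im (p n (b j))) * sgn (deriv \<eta> \<zeta>)"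
      show "(\<lambda>n. \<bar>Im (?s j' n)\<bar> + \<bar>Im (?s j n)\<bar>) \<longlonglongrightarrow> 0"
        using tendsto_add [OF tendsto_rabs [OF lim [OF j(2)]] tendsto_rabs [OF lim [OF j(1)]]] by simp
      have "norm (sin (x n)) \<le> \<bar>Im (?s j' n)\<bar> + \<bar>Im (?s j n)\<bar>" for n
      proof -
        have "?s j' n * cnj (?s j n) = cis (x n) * (sgn (deriv \<eta> \<zeta>) * cnj (sgn (deriv \<eta> \<zeta>)))"
        proof -
          have "cis (x n) = cis (Im (p n (b j'))) * cnj (cis (Im (p n (b j))))"
            by (simp add: x_def cis_mult cis_cnj)
          then show ?thesis by (simp add: mult_ac del: cis_cnj)
        qed
        also have "sgn (deriv \<eta> \<zeta>) * cnj (sgn (deriv \<eta> \<zeta>)) = 1"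
          using d0 by (simp add: complex_norm_square [symmetric] norm_sgn)
        finally have "sin (x n) = Im (?s j' n * cnj (?s j n))" by simp
        also have "\<dots> = Im (?s j' n) * Re (?s j n) - Re (?s j' n) * Im (?s j n)"
          by (simp only: times_complex.sel cnj.sel)
        finally have "\<bar>sin (x n)\<bar> \<le> \<bar>Im (?s j' n)\<bar> * \<bar>Re (?s j n)\<bar> + \<bar>Re (?s j' n)\<bar> * \<bar>Im (?s j n)\<bar>"
          using abs_triangle_ineq4 [of "Im (?s j' n) * Re (?s j n)" "Re (?s j' n) * Im (?s j n)"]
          by (simp only: abs_mult)
        also have "\<dots> \<le> \<bar>Im (?s j' n)\<bar> * 1 + 1 * \<bar>Im (?s j n)\<bar>"
        proof -
          have "cmod (?s i n) = 1" for i using d0 by (simp add: norm_mult norm_sgn)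
          then have "\<bar>Re (?s i n)\<bar> \<le> 1" for i using abs_Re_le_cmod [of "?s i n"] by simp
          then show ?thesis by (intro add_mono mult_left_mono mult_right_mono) auto
        qed
        finally show ?thesis by simp
      qed
      then show "eventually (\<lambda>n. norm (sin (x n)) \<le> \<bar>Im (?s j' n)\<bar> + \<bar>Im (?s j n)\<bar>) sequentially"
        by simp
    qed
    then have "(\<lambda>n. arcsin (sin (x n))) \<longlonglongrightarrow> arcsin 0"
      by (intro isCont_tendsto_compose [OF isCont_arcsin]) auto
    moreover have "arcsin (sin (x n)) = x n" for n
      using x1 [of n] pi_ge_two by (intro arcsin_sin) linarith+
    ultimately show ?thesis by (simp add: x_def)
  qed
  have pos: "int i \<in> J \<longrightarrow> (\<lambda>n. Im (p n (b (int i))) - Im (p n a)) \<longlonglongrightarrow> 0" for i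
  proof (induction i)
    case 0 then show ?case by (simp add: b0)
  next
    case (Suc i)
    show ?case
    proof
      assume S: "int (Suc i) \<in> J"
      then have i: "int i \<in> J" using between [OF S, of "int i"] by simp
      have "(\<lambda>n. (Im (p n (b (int (Suc i)))) - Im (p n (b (int i)))) + (Im (p n (b (int i))) - Im (p n a))) \<longlonglongrightarrow> 0 + 0"
        by (intro tendsto_add step) (use S i Suc in auto)
      then show "(\<lambda>n. Im (p n (b (int (Suc i)))) - Im (p n a)) \<longlonglongrightarrow> 0" by simp
    qed
  qed
  have neg: "- int i \<in> J \<longrightarrow> (\<lambda>n. Im (p n (b (- int i))) - Im (p n a)) \<longlonglongrightarrow> 0" for i
  proof (induction i)
    case 0 then show ?case by (simp add: b0)
  next
    case (Suc i)
    show ?case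
    proof
      assume S: "- int (Suc i) \<in> J"
      then have i: "- int i \<in> J" using between [OF S, of "- int i"] by simp
      have "(\<lambda>n. (Im (p n (b (- int (Suc i)))) - Im (p n (b (- int i)))) + (Im (p n (b (- int i))) - Im (p n a))) \<longlonglongrightarrow> 0 + 0"
        by (intro tendsto_add step) (use S i Suc in auto)
      then show "(\<lambda>n. Im (p n (b (- int (Suc i)))) - Im (p n a)) \<longlonglongrightarrow> 0" by simp
    qed
  qed
  have all: "(\<lambda>n. Im (p n (b j)) - Im (p n a)) \<longlonglongrightarrow> 0" if "j \<in> J" for j
    using that pos [of "nat j"] neg [of "nat (- j)"] by (cases "j \<ge> 0") auto
  have "eventually (\<lambda>n. \<forall>j\<in>J. \<bar>Im (p n (b j)) - Im (p n a)\<bar> \<le> e) sequentially"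
  proof (rule eventually_ball_finite [OF finJ], rule ballI)
    fix j assume "j \<in> J"
    then have "eventually (\<lambda>n. dist (Im (p n (b j)) - Im (p n a)) 0 < e) sequentially"
      using all e tendstoD by blast
    then show "eventually (\<lambda>n. \<bar>Im (p n (b j)) - Im (p n a)\<bar> \<le> e) sequentially"
      by (rule eventually_mono) (simp add: dist_real_def)
  qed
  then show ?thesis by (rule eventually_mono) (auto simp: J_def b_def)
qed

end

section \<open>The derivative in the tract\<close>

context log_tract
begin

lemma inj_G: "inj_on G {z. Re z > \<rho>}"
  using exp_G_inj by (auto simp: inj_on_def)

lemma deriv_G_nonzero: "Re z > \<rho> \<Longrightarrow> deriv G z \<noteq> 0"
  using holomorphic_injective_imp_regular [OF hol_G open_halfspace_Re_gt inj_G] by simp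

text \<open>The image of \<open>G\<close> contains no two points differing by \<open>2 \<pi> \<i>\<close>, hence no disc of radius 4.\<close>

lemma deriv_G_bound:
  assumes z: "Re z > \<rho>"
  shows "cmod (deriv G z) \<le> 48 / (Re z - \<rho>)"
proof (rule ccontr)
  define r where "r = Re z - \<rho>"
  have r: "r > 0" using z by (simp add: r_def)
  have sub: "ball z r \<subseteq> {z. Re z > \<rho>}"
  proof
    fix w assume "w \<in> ball z r"
    then have "\<bar>Re (z - w)\<bar> < r" using abs_Re_le_cmod [of "z - w"] by (simp add: dist_norm)
    then show "w \<in> {z. Re z > \<rho>}" by (simp add: r_def)
  qed
  assume "\<not> ?thesis"
  \<comment> \<open>Bloch's theorem in the form with constant 1/12. Radius 4 exceeds
    \<open>pi\<close>, so the disc contains two points at distance \<open>2 * pi\<close> on a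
    vertical line; this is the origin of \<open>48 = 4 * 12\<close>.\<close>
  then have "4 \<le> r * cmod (deriv G z) / 12" using r by (simp add: r_def field_simps)
  then obtain b where b: "ball b 4 \<subseteq> G ` ball z r"
    using Bloch [OF holomorphic_on_subset [OF hol_G sub] r] by blast
  have "b + of_real pi * \<i> \<in> ball b 4" "b - of_real pi * \<i> \<in> ball b 4"
    using pi_less_4 by (simp_all add: dist_norm norm_mult)
  then have mem: "b + of_real pi * \<i> \<in> G ` ball z r" "b - of_real pi * \<i> \<in> G ` ball z r"
    by (auto intro!: subsetD [OF b])
  obtain u where u: "u \<in> ball z r" "b + of_real pi * \<i> = G u" using mem(1) by blast
  obtain v where v: "v \<in> ball z r" "b - of_real pi * \<i> = G v" using mem(2) by blast
  have "G u = G v + 2 * of_real pi * \<i> * of_int 1" by (simp flip: u(2) v(2))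
  then have "exp (G u) = exp (G v)" by (simp only: exp_eq_shift)
  moreover have "Re u > \<rho>" "Re v > \<rho>" using u(1) v(1) sub by auto
  ultimately have "u = v" using exp_G_inj by blast
  then have "Im (b + of_real pi * \<i>) = Im (b - of_real pi * \<i>)" using u(2) v(2) by simp
  then show False by simp
qed

lemma log_deriv_G_exists:
  obtains L where "L holomorphic_on {z. Re z > \<rho>}" "\<And>z. Re z > \<rho> \<Longrightarrow> exp (L z) = deriv G z"
proof -
  have "deriv G holomorphic_on {z. Re z > \<rho>}"
    by (rule holomorphic_deriv [OF hol_G open_halfspace_Re_gt])
  moreover have "contractible {z. Re z > \<rho>}"
    by (intro convex_imp_contractible convex_halfspace_Re_gt)
  moreover have "deriv G z \<noteq> 0" if "z \<in> {z. Re z > \<rho>}" for z using deriv_G_nonzero that by simp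
  ultimately obtain L where L: "L holomorphic_on {z. Re z > \<rho>}"
      "\<And>z. z \<in> {z. Re z > \<rho>} \<Longrightarrow> deriv G z = exp (L z)"
    using contractible_imp_holomorphic_log [of "deriv G" "{z. Re z > \<rho>}"] by blast
  show ?thesis by (rule that [OF L(1)]) (use L(2) in simp)
qed

text \<open>The attracting fixed point leaves every compact set as its basin grows; this brings it back to a
  bounded region.\<close>

lemma branch_with_bounded_value:
  assumes Ahi: "Ahi > \<rho>"
    and low: "\<And>z. Re z \<ge> Ahi \<Longrightarrow> Re (G z) \<ge> Alo"
    and descend: "\<And>z. Re z \<ge> Ahi \<Longrightarrow> \<bar>Im z\<bar> \<le> pi \<Longrightarrow> Re (G z) \<le> Re z - 1"
    and \<zeta>: "Re \<zeta> \<ge> Alo"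
  obtains \<eta> d where "inverse_branch_at f d \<eta> \<zeta>" "Alo \<le> Re (\<eta> \<zeta>)" "Re (\<eta> \<zeta>) \<le> Ahi" "\<bar>Im (\<eta> \<zeta>)\<bar> \<le> pi"
proof -
  let ?good = "\<exists>\<eta> d. inverse_branch_at f d \<eta> \<zeta> \<and> Alo \<le> Re (\<eta> \<zeta>) \<and> Re (\<eta> \<zeta>) \<le> Ahi \<and> \<bar>Im (\<eta> \<zeta>)\<bar> \<le> pi"
  have norm: "\<exists>\<eta>'. inverse_branch_at f d \<eta>' \<zeta> \<and> Re (\<eta>' \<zeta>) = Re (\<eta> \<zeta>) \<and> \<bar>Im (\<eta>' \<zeta>)\<bar> \<le> pi"
    if "inverse_branch_at f d \<eta> \<zeta>" for \<eta> d
  proof -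
    define k :: int where "k = - round (Im (\<eta> \<zeta>) / (2 * pi))"
    have "\<bar>of_int (round (Im (\<eta> \<zeta>) / (2 * pi))) - Im (\<eta> \<zeta>) / (2 * pi)\<bar> \<le> 1/2"
      by (rule of_int_round_abs_le)
    then have "\<bar>Im (\<eta> \<zeta>) + 2 * pi * of_int k\<bar> \<le> pi"
      using pi_gt_zero unfolding k_def by (simp add: field_simps abs_if split: if_splits)
    then show ?thesis
      using inverse_branch_at_shift [OF that, of k]
      by (intro exI [of _ "\<lambda>w. \<eta> w + 2 * of_real pi * \<i> * of_int k"]) simp
  qed
  \<comment> \<open>Induction on the excess over \<open>Ahi\<close>: after normalising the imaginary
    part, each composition with \<open>G\<close> lowers the real part by at least 1 without falling
    below \<open>Alo\<close>.\<close>
  have "(\<exists>\<eta> d. inverse_branch_at f d \<eta> \<zeta> \<and> Alo \<le> Re (\<eta> \<zeta>) \<and> Re (\<eta> \<zeta>) \<le> Ahi + real n) \<longrightarrow> ?good" for n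
  proof (induction n)
    case 0
    show ?case
    proof (intro impI, elim exE conjE)
      fix \<eta> d assume \<eta>: "inverse_branch_at f d \<eta> \<zeta>" "Alo \<le> Re (\<eta> \<zeta>)" "Re (\<eta> \<zeta>) \<le> Ahi + real 0"
      obtain \<eta>' where "inverse_branch_at f d \<eta>' \<zeta>" "Re (\<eta>' \<zeta>) = Re (\<eta> \<zeta>)" "\<bar>Im (\<eta>' \<zeta>)\<bar> \<le> pi"
        using norm [OF \<eta>(1)] by blast
      then show ?good using \<eta> by (intro exI [of _ \<eta>'] exI [of _ d]) simp
    qed
  next
    case (Suc n)
    show ?case
    proof (intro impI, elim exE conjE)
      fix \<eta> d assume \<eta>: "inverse_branch_at f d \<eta> \<zeta>" "Alo \<le> Re (\<eta> \<zeta>)" "Re (\<eta> \<zeta>) \<le> Ahi + real (Suc n)"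
      obtain \<eta>' where \<eta>': "inverse_branch_at f d \<eta>' \<zeta>" "Re (\<eta>' \<zeta>) = Re (\<eta> \<zeta>)" "\<bar>Im (\<eta>' \<zeta>)\<bar> \<le> pi"
        using norm [OF \<eta>(1)] by blast
      show ?good
      proof (cases "Re (\<eta>' \<zeta>) \<le> Ahi")
        case True
        then show ?thesis using \<eta> \<eta>' by (intro exI [of _ \<eta>'] exI [of _ d]) simp
      next
        case False
        have "inverse_branch_at f (d + 1) (\<lambda>w. G (\<eta>' w)) \<zeta>"
          by (rule inverse_branch_at_compose [OF \<eta>'(1) open_halfspace_Re_gt _ hol_G])
            (use False Ahi f_exp_G in auto)
        moreover have "Alo \<le> Re (G (\<eta>' \<zeta>))" using low False by simp
        moreover have "Re (G (\<eta>' \<zeta>)) \<le> Ahi + real n"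
          using descend [of "\<eta>' \<zeta>"] False \<eta>' \<eta>(3) by simp
        ultimately show ?thesis using Suc by blast
      qed
    qed
  qed
  moreover obtain n where "Re \<zeta> \<le> Ahi + real n"
    using real_arch_simple [of "Re \<zeta> - Ahi"] by (auto simp: algebra_simps)
  then have "inverse_branch_at f 0 (\<lambda>w. w) \<zeta> \<and> Alo \<le> Re \<zeta> \<and> Re \<zeta> \<le> Ahi + real n"
    using inverse_branch_at_id \<zeta> by blast
  ultimately have ?good by blast
  then show ?thesis using that by blast
qed

text \<open>\<open>L\<close> is isolated as a difference: if \<open>P n\<close> is a logarithm of
  the derivative of \<open>\<phi> ^^ n\<close>, then \<open>Q n = P n \<circ> G + L\<close> is one
  for \<open>(\<phi> ^^ n) \<circ> G\<close>. Both have nearly constant imaginary part far to the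
  right, so \<open>Im L\<close> has too. All auxiliary choices may depend on the two points
  compared; only the abscissa must not.\<close>

lemma Im_log_deriv_oscillation:
  assumes real: "\<And>n p. repelling_periodic_point f n p \<Longrightarrow> multiplier f n p \<in> \<real>"
    and L: "L holomorphic_on {z. Re z > \<rho>}" "\<And>z. Re z > \<rho> \<Longrightarrow> exp (L z) = deriv G z"
  obtains A where "A > \<rho>" "\<And>z w. Re z \<ge> A \<Longrightarrow> Re w \<ge> A \<Longrightarrow> \<bar>Im (L z) - Im (L w)\<bar> \<le> 1/8"
proof -
  \<comment> \<open>As \<open>48 / 4800 = 1/100\<close>, \<open>G\<close> contracts by 1/100 to the
    right of \<open>M\<close> and grows at most like \<open>cmod z / 100\<close>.\<close>
  define M where "M = \<rho> + 4800"
  have M: "M > \<rho>" by (simp add: M_def)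
  have dG: "cmod (deriv G z) \<le> 1/100" if "Re z \<ge> M" for z
  proof -
    have "cmod (deriv G z) \<le> 48 / (Re z - \<rho>)" using that M by (intro deriv_G_bound) simp
    also have "\<dots> \<le> 48 / 4800" using that by (intro divide_left_mono) (auto simp: M_def)
    finally show ?thesis by simp
  qed
  define g0 where "g0 = cmod (G (of_real M)) + \<bar>M\<bar> / 100"
  have g0: "g0 \<ge> 0" by (simp add: g0_def)
  have Gb: "cmod (G z) \<le> g0 + cmod z / 100" if "Re z \<ge> M" for z
  proof -
    have "cmod (G z - G (of_real M)) \<le> 1/100 * cmod (z - of_real M)"
    proof (rule field_differentiable_bound [OF convex_halfspace_Re_ge, of M])
      show "(G has_field_derivative deriv G x) (at x within {x. Re x \<ge> M})" if "x \<in> {x. Re x \<ge> M}" for x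
        by (rule holomorphic_derivI [OF hol_G open_halfspace_Re_gt]) (use that M in auto)
    qed (use dG that in auto)
    moreover have "cmod (z - of_real M) \<le> cmod z + \<bar>M\<bar>" using norm_triangle_ineq4 [of z "of_real M"] by simp
    moreover have "cmod (G z) \<le> cmod (G (of_real M)) + cmod (G z - G (of_real M))"
      by (rule norm_triangle_sub)
    ultimately show ?thesis by (simp add: g0_def)
  qed
  have large: "\<exists>B. \<forall>z. Re z \<ge> B \<longrightarrow> Re (G z) \<ge> X" for X
  proof -
    obtain \<kappa> where \<kappa>: "\<And>z. Re z \<ge> M \<Longrightarrow> cmod z \<ge> \<kappa> \<Longrightarrow> Re (G z) \<ge> X"
      using G_at_infinity [OF M] by blast
    have "Re (G z) \<ge> X" if "Re z \<ge> max M \<kappa>" for z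
      using \<kappa> [of z] that complex_Re_le_cmod [of z] by simp
    then show ?thesis by blast
  qed
  obtain B1 where B1: "\<And>z. Re z \<ge> B1 \<Longrightarrow> Re (G z) \<ge> M + 1" using large by blast
  \<comment> \<open>To the right of \<open>m\<close> the values of \<open>G\<close> have real part
    above \<open>M\<close>, which later makes \<open>G\<close> map \<open>Om\<close> into the basin
    \<open>D\<close>.\<close>
  define m where "m = max M B1"
  have m: "m \<ge> M" "\<And>z. Re z \<ge> m \<Longrightarrow> Re (G z) \<ge> M + 1" using B1 by (auto simp: m_def)
  define C where "C = distortion_const"
  have C: "C > 0" by (simp add: C_def distortion_const_pos)
  \<comment> \<open>The final comparison adds four errors of \<open>3 * e\<close>, and 12/100 is
    below 1/8. \<open>Alo\<close> is placed so far right of \<open>m\<close> that the distortion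
    over a vertical distance \<open>pi\<close> is at most \<open>e\<close>.\<close>
  define e :: real where "e = 1/100"
  define Alo where "Alo = m + 1 + 100 * (C * pi)"
  have Cpi: "C * pi > 0" using C by simp
  then have Alo: "Alo \<ge> m + 1" "Alo > M" using m(1) unfolding Alo_def by linarith+
  have eA: "C * pi / (x - m) \<le> e" if "x \<ge> Alo" for x
  proof -
    have x: "x - m > 0" "100 * (C * pi) \<le> x - m"
      using that Cpi unfolding Alo_def by linarith+
    then have "C * pi \<le> e * (x - m)" unfolding e_def by simp
    with x(1) show ?thesis by (simp add: pos_divide_le_eq)
  qed
  obtain \<kappa> where \<kappa>: "\<And>z. Re z \<ge> M \<Longrightarrow> cmod z \<ge> \<kappa> \<Longrightarrow> Re (G z) \<ge> Alo"
    using G_at_infinity [OF M] by blast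
  obtain B2 where B2: "\<And>z. Re z \<ge> B2 \<Longrightarrow> Re (G z) \<ge> Alo" using large by blast
  define Ahi where "Ahi = max (max Alo B2) (2 * g0 + 10)"
  have Ahi: "Ahi \<ge> Alo" "Ahi \<ge> 2 * g0 + 10" "\<And>z. Re z \<ge> Ahi \<Longrightarrow> Re (G z) \<ge> Alo"
    using B2 by (auto simp: Ahi_def)
  have AhiM: "Ahi > M" using Ahi Alo by simp
  have descend: "Re (G z) \<le> Re z - 1" if z: "Re z \<ge> Ahi" "\<bar>Im z\<bar> \<le> pi" for z
  proof -
    have "Re (G z) \<le> cmod (G z)" by (rule complex_Re_le_cmod)
    also have "\<dots> \<le> g0 + cmod z / 100" using z AhiM by (intro Gb) simp
    also have "cmod z \<le> Re z + 4"
    proof -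
      have "Re z \<ge> 0" using z(1) Ahi(2) g0 by linarith
      then show ?thesis using cmod_le [of z] z(2) pi_less_4 by simp
    qed
    also have "g0 + (Re z + 4) / 100 \<le> Re z - 1"
    proof -
      have "100 * g0 + (Re z + 4) \<le> 100 * Re z - 100" using z(1) Ahi(2) g0 by linarith
      then show ?thesis by (simp add: field_simps)
    qed
    finally show ?thesis by simp
  qed
  obtain B3 where B3: "\<And>z. Re z \<ge> B3 \<Longrightarrow> Re (G z) \<ge> Ahi" using large by blast
  define A2 where "A2 = max Ahi B3"
  have A2: "A2 \<ge> Ahi" "\<And>z. Re z \<ge> A2 \<Longrightarrow> Re (G z) \<ge> Ahi" using B3 by (auto simp: A2_def)
  have "\<bar>Im (L z) - Im (L w)\<bar> \<le> 1/8" if zw: "Re z \<ge> A2" "Re w \<ge> A2" for z w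
  proof -
    define X0 where "X0 = cmod z + cmod w + cmod (G z) + cmod (G w)"
    \<comment> \<open>Bounds \<open>\<bar>Re a\<bar>\<close> in advance. The base point
      \<open>a\<close> appears only after \<open>k\<close> and depends on it, but its real part will
      lie between \<open>Alo\<close> and \<open>Ahi\<close>; so \<open>N\<close> can be chosen
      before \<open>k\<close>.\<close>
    define Am where "Am = \<bar>Alo\<bar> + \<bar>Ahi\<bar>"
    define X where "X = X0 + Am + 1"
    define c where "c = Am + \<bar>m\<bar> + 1"
    have X: "X > 0" "X0 \<ge> 0" by (auto simp: X_def X0_def Am_def intro!: add_nonneg_pos)
    have c: "c > 0" by (auto simp: c_def Am_def intro!: add_nonneg_pos)
    have "eventually (\<lambda>N. (2 * e + C * ln (N + c)) * sqrt 2 * sqrt (X / N) \<le> e) at_top"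
      by (rule log_over_sqrt_eventually) (use X c C in \<open>auto simp: e_def\<close>)
    then have "eventually (\<lambda>N. (2 * e + C * ln (N + c)) * sqrt 2 * sqrt (X / N) \<le> e \<and> N > 1 \<and> N \<ge> X) at_top"
      by (intro eventually_conj eventually_gt_at_top eventually_ge_at_top)
    then obtain N where N: "(2 * e + C * ln (N + c)) * sqrt 2 * sqrt (X / N) \<le> e" "N > 1" "N \<ge> X"
      by (auto simp: eventually_at_top_linorder)
    obtain k :: nat where k: "real k > 2 * (Am + N + 4) + 2 * \<bar>m\<bar> + \<bar>\<kappa>\<bar> + 2 * g0 + 1"
      using reals_Archimedean2 by blast
    have kge: "real k > 2 * (Am + N + 4)" "real k > 2 * \<bar>m\<bar>" "real k > \<kappa>" "real k > 2 * g0" "real k > 1"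
      using k N g0 by (auto simp: Am_def)
    define T where "T = 2 * real k"

    \<comment> \<open>The attracting branch on a large half disc\<close>
    define D where "D = {z. Re z > M} \<inter> ball 0 T"
    define K where "K = {z. Re z \<ge> Alo} \<inter> cball 0 (real k)"
    define sh :: complex where "sh = 2 * of_real pi * \<i> * of_int (int k)"
    have resh: "Re sh = 0" by (simp add: sh_def)
    have nsh: "cmod sh = 2 * pi * real k" by (simp add: sh_def norm_mult)
    define \<phi> where "\<phi> x = G (x + sh)" for x
    have opD: "open D" unfolding D_def by (intro open_Int open_halfspace_Re_gt open_ball)
    have cvD: "convex D" unfolding D_def by (intro convex_Int convex_halfspace_Re_gt convex_ball)
    have D\<rho>: "Re (x + sh) > \<rho>" if "x \<in> D" for x using that M by (simp add: D_def resh)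
    \<comment> \<open>\<open>cmod sh = 2 * pi * k\<close> lies between \<open>6 * k\<close> and
      \<open>8 * k\<close>, and \<open>cmod x < 2 * k\<close>. So \<open>x + sh\<close> has modulus
      at least \<open>4 * k\<close>, beyond \<open>\<kappa>\<close>, and at most
      \<open>10 * k\<close>, whence its image has modulus at most \<open>g0 + k / 10\<close>, below
      \<open>k\<close>.\<close>
    have D_K: "\<phi> ` D \<subseteq> K"
    proof
      fix y assume "y \<in> \<phi> ` D"
      then obtain x where x: "x \<in> D" "y = \<phi> x" by blast
      have xT: "cmod x < 2 * real k" "Re x > M" using x by (auto simp: D_def T_def)
      have "3 * real k \<le> pi * real k" using pi_gt3 by (intro mult_right_mono) auto
      then have "6 * real k \<le> cmod sh" by (simp add: nsh)
      moreover have "cmod sh \<le> cmod (x + sh) + cmod x" using norm_triangle_ineq4 [of "x + sh" x] by simp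
      ultimately have "cmod (x + sh) \<ge> \<kappa>" using xT kge by linarith
      then have "Re y \<ge> Alo" using \<kappa> [of "x + sh"] xT by (simp add: x \<phi>_def resh)
      moreover have "cmod y \<le> real k"
      proof -
        have "cmod y \<le> g0 + cmod (x + sh) / 100" unfolding x \<phi>_def using xT by (intro Gb) (simp add: resh)
        moreover have "cmod (x + sh) \<le> cmod x + cmod sh" by (rule norm_triangle_ineq)
        moreover have "pi * real k \<le> 4 * real k" using pi_less_4 by (intro mult_right_mono) auto
        then have "cmod sh \<le> 8 * real k" by (simp add: nsh)
        ultimately show ?thesis using xT kge by linarith
      qed
      ultimately show "y \<in> K" by (simp add: K_def)
    qed
    have K_D: "K \<subseteq> D" using Alo kge by (auto simp: K_def D_def T_def)
    have hol\<phi>: "\<phi> holomorphic_on D"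
      unfolding \<phi>_def
      by (rule holomorphic_on_compose_gen [OF _ hol_G, unfolded o_def])
        (use D\<rho> in \<open>auto intro!: holomorphic_intros\<close>)
    have d\<phi>: "cmod (deriv \<phi> x) \<le> 1/2" if x: "x \<in> D" for x
    proof -
      have "(G has_field_derivative deriv G (x + sh)) (at (x + sh))"
        by (rule holomorphic_derivI [OF hol_G open_halfspace_Re_gt]) (use D\<rho> [OF x] in simp)
      moreover have "((\<lambda>x. x + sh) has_field_derivative 1) (at x)" by (auto intro!: derivative_eq_intros)
      ultimately have "(\<phi> has_field_derivative deriv G (x + sh) * 1) (at x)"
        unfolding \<phi>_def by (rule DERIV_chain2)
      then have "deriv \<phi> x = deriv G (x + sh)" by (simp add: DERIV_imp_deriv)
      then show ?thesis using dG [of "x + sh"] x by (simp add: D_def resh)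
    qed
    have Kcl: "closed K" unfolding K_def by (intro closed_Int closed_halfspace_Re_ge closed_cball)
    have bD: "bounded D" unfolding D_def by (simp add: bounded_Int)
    have "of_real Alo \<in> K" using kge(1) N(2) by (simp add: K_def Am_def)
    then have Kne: "K \<noteq> {}" by blast
    obtain \<zeta> where \<zeta>: "\<zeta> \<in> K" "\<phi> \<zeta> = \<zeta>"
        and att: "\<And>e. e > 0 \<Longrightarrow> eventually (\<lambda>n. \<forall>z\<in>D. dist ((\<phi> ^^ n) z) \<zeta> < e) sequentially"
      by (rule contraction_attracts [OF cvD opD bD Kcl K_D Kne hol\<phi> D_K d\<phi>]) (assumption, rule that)
    have inj\<phi>: "inj_on \<phi> D"
    proof (rule inj_onI)
      fix x y assume "x \<in> D" "y \<in> D" "\<phi> x = \<phi> y"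
      then have "x + sh = y + sh" using inj_onD [OF inj_G, of "x + sh" "y + sh"] D\<rho> by (simp add: \<phi>_def)
      then show "x = y" by simp
    qed
    have \<phi>D: "\<phi> ` D \<subseteq> D" using D_K K_D by (rule order_trans)
    interpret attracting_branch f D \<phi> \<zeta>
    proof
      show "f (exp (\<phi> x)) = exp x" if "x \<in> D" for x
        unfolding \<phi>_def f_exp_G [OF D\<rho> [OF that]] unfolding sh_def by (rule exp_eq_shift)
    qed (rule hol_f real opD hol\<phi> inj\<phi> \<phi>D att; assumption)+
    obtain \<eta> d where \<eta>: "inverse_branch_at f d \<eta> \<zeta>" "Alo \<le> Re (\<eta> \<zeta>)" "Re (\<eta> \<zeta>) \<le> Ahi" "\<bar>Im (\<eta> \<zeta>)\<bar> \<le> pi"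
      by (rule branch_with_bounded_value [of Ahi Alo \<zeta>])
        (use AhiM M Ahi(3) descend \<zeta>(1) in \<open>auto simp: K_def\<close>)
    define a where "a = \<eta> \<zeta>"
    have a: "Alo \<le> Re a" "Re a \<le> Ahi" "\<bar>Im a\<bar> \<le> pi" using \<eta> by (auto simp: a_def)
    have aAm: "\<bar>Re a\<bar> \<le> Am" using a by (auto simp: Am_def)
    have aT: "cmod a < T / 3"
      using cmod_le [of a] aAm a(3) pi_less_4 kge(1) N(2) by (simp add: T_def)

    \<comment> \<open>Logarithms of the derivatives of the iterates, and their distortion\<close>
    define Om where "Om = {z. Re z > m} \<inter> ball 0 T"
    have opOm: "open Om" unfolding Om_def by (intro open_Int open_halfspace_Re_gt open_ball)
    have Om_D: "Om \<subseteq> D" using m(1) by (auto simp: Om_def D_def)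
    have Om\<rho>: "Re x > \<rho>" "Re x > M" if "x \<in> Om" for x using that m(1) M by (auto simp: Om_def)
    have G_Om: "G ` Om \<subseteq> D"
    proof
      fix y assume "y \<in> G ` Om"
      then obtain x where x: "Re x > m" "cmod x < T" "y = G x" by (auto simp: Om_def)
      have "cmod y \<le> g0 + cmod x / 100" unfolding x(3) using x m(1) by (intro Gb) simp
      then have "cmod y < T" using x(2) kge by (simp add: T_def)
      moreover have "Re y \<ge> M + 1" using m(2) x by simp
      ultimately show "y \<in> D" by (simp add: D_def)
    qed
    \<comment> \<open>The reason for \<open>T / 3\<close>: the radius is at most
      \<open>cmod x + \<bar>m\<bar>\<close>, and both \<open>cmod x\<close> and
      \<open>\<bar>m\<bar>\<close> are below \<open>T / 3\<close>, so the largest disc inside the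
      half plane also stays inside \<open>ball 0 T\<close>.\<close>
    have sub: "ball x (Re x - m) \<subseteq> Om" if x: "Re x > m" "cmod x < T / 3" for x
    proof
      fix y assume y: "y \<in> ball x (Re x - m)"
      have d: "cmod (x - y) < Re x - m" using y by (simp add: dist_norm)
      have "Re y > m" using d complex_Re_le_cmod [of "x - y"] by simp
      moreover have "cmod y \<le> cmod x + cmod (x - y)" by (metis norm_triangle_sub norm_minus_commute)
      then have "cmod y < T" using d x complex_Re_le_cmod [of x] kge(2) by (simp add: T_def)
      ultimately show "y \<in> Om" by (simp add: Om_def)
    qed
    have hn: "(\<phi> ^^ n) holomorphic_on D" "inj_on (\<phi> ^^ n) D" for n
      using holomorphic_funpow [OF hol\<phi> \<phi>D] inj_on_funpow [OF inj\<phi> \<phi>D] by auto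
    have "\<exists>P. P holomorphic_on D \<and> (\<forall>x\<in>D. deriv (\<phi> ^^ n) x = exp (P x))" for n
    proof -
      have nz: "deriv (\<phi> ^^ n) x \<noteq> 0" if "x \<in> D" for x
        by (rule holomorphic_injective_imp_regular [OF hn(1) opD hn(2) that])
      show ?thesis
        by (rule contractible_imp_holomorphic_log [OF holomorphic_deriv [OF hn(1) opD]
              convex_imp_contractible [OF cvD] nz]) (assumption, blast)
    qed
    then have "\<exists>P. \<forall>n. P n holomorphic_on D \<and> (\<forall>x\<in>D. deriv (\<phi> ^^ n) x = exp (P n x))"
      by (intro choice allI)
    then obtain P where P': "\<forall>n. P n holomorphic_on D \<and> (\<forall>x\<in>D. deriv (\<phi> ^^ n) x = exp (P n x))" ..
    have P: "P n holomorphic_on D" "x \<in> D \<Longrightarrow> exp (P n x) = deriv (\<phi> ^^ n) x" for n x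
      using spec [OF P', of n] by simp_all
    define Q where "Q n x = P n (G x) + L x" for n x
    have holG: "G holomorphic_on Om" using hol_G by (rule holomorphic_on_subset) (use Om\<rho> in auto)
    have injG: "inj_on G Om" using inj_G by (rule inj_on_subset) (use Om\<rho> in auto)
    have holQ: "Q n holomorphic_on Om" for n
    proof -
      have "(\<lambda>x. P n (G x)) holomorphic_on Om"
        by (rule holomorphic_on_compose_gen [OF holG P(1) G_Om, unfolded o_def])
      moreover have "L holomorphic_on Om" using L(1) by (rule holomorphic_on_subset) (use Om\<rho> in auto)
      ultimately show ?thesis unfolding Q_def by (intro holomorphic_intros)
    qed
    have expQ: "exp (Q n x) = deriv (\<lambda>x. (\<phi> ^^ n) (G x)) x" if x: "x \<in> Om" for n x
    proof -
      have GD: "G x \<in> D" using G_Om x by blast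
      have "(G has_field_derivative deriv G x) (at x)" by (rule holomorphic_derivI [OF holG opOm x])
      with holomorphic_derivI [OF hn(1) opD GD]
      have "((\<lambda>x. (\<phi> ^^ n) (G x)) has_field_derivative deriv (\<phi> ^^ n) (G x) * deriv G x) (at x)"
        by (rule DERIV_chain2)
      then have "deriv (\<lambda>x. (\<phi> ^^ n) (G x)) x = deriv (\<phi> ^^ n) (G x) * deriv G x"
        by (rule DERIV_imp_deriv)
      then show ?thesis by (simp add: Q_def exp_add P(2) [OF GD] L(2) [OF Om\<rho>(1) [OF x]])
    qed
    have holPOm: "P n holomorphic_on Om" for n using P(1) Om_D by (rule holomorphic_on_subset)
    have bP: "cmod (deriv (P n) x) \<le> C / (Re x - m)" if x: "Re x > m" "cmod x < T / 3" for n x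
      unfolding C_def
    proof (rule log_deriv_bound [OF opOm _ _ holPOm _ _ sub [OF x]])
      show "(\<phi> ^^ n) holomorphic_on Om" using hn(1) Om_D by (rule holomorphic_on_subset)
      show "inj_on (\<phi> ^^ n) Om" using hn(2) Om_D by (rule inj_on_subset)
    qed (use P(2) Om_D x in auto)
    have bQ: "cmod (deriv (Q n) x) \<le> C / (Re x - m)" if x: "Re x > m" "cmod x < T / 3" for n x
      unfolding C_def
    proof (rule log_deriv_bound [OF opOm _ _ holQ expQ _ sub [OF x]])
      show "(\<lambda>x. (\<phi> ^^ n) (G x)) holomorphic_on Om"
        by (rule holomorphic_on_compose_gen [OF holG hn(1) G_Om, unfolded o_def])
      show "inj_on (\<lambda>x. (\<phi> ^^ n) (G x)) Om"
        by (rule comp_inj_on [OF injG inj_on_subset [OF hn(2) G_Om], unfolded o_def])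
    qed (use x in auto)
    have am: "Re a > m" using a Alo by simp
    have ae: "C * pi / (Re a - m) \<le> e" by (rule eA [OF a(1)])
    moreover have "e \<le> 1/2" by (simp add: e_def)
    ultimately have ae2: "C * pi / (Re a - m) \<le> 1/2" by (rule order_trans)
    have e0: "e > 0" by (simp add: e_def)

    \<comment> \<open>Near constancy of both arguments and the comparison\<close>
    let ?vc = "\<lambda>p. \<forall>j::int. cmod (a + 2 * of_real pi * \<i> * of_int j) < T / 3 \<longrightarrow>
      \<bar>Im (p (a + 2 * of_real pi * \<i> * of_int j)) - Im (p a)\<bar> \<le> e"
    have "eventually (\<lambda>n. ?vc (P n)) sequentially"
      by (rule vertical_constancy [OF \<eta>(1) a_def Om_def, of "\<lambda>w. w" 0 P C])
        (use Om_D holPOm P(2) bP am aT ae2 e0 in \<open>auto intro: holomorphic_intros\<close>)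
    moreover have "eventually (\<lambda>n. ?vc (Q n)) sequentially"
      by (rule vertical_constancy [OF \<eta>(1) a_def Om_def holG G_Om injG, of 1 Q C])
        (use f_exp_G Om\<rho> holQ expQ bQ am aT ae2 e0 in auto)
    ultimately have "eventually (\<lambda>n. ?vc (P n) \<and> ?vc (Q n)) sequentially" by (rule eventually_conj)
    then obtain n where n: "?vc (P n)" "?vc (Q n)" unfolding eventually_sequentially by blast
    have osc: "\<bar>Im (p x) - Im (p a)\<bar> \<le> 3 * e"
      if p: "p holomorphic_on Om" "\<And>x. Re x > m \<Longrightarrow> cmod x < T / 3 \<Longrightarrow> cmod (deriv p x) \<le> C / (Re x - m)"
        "?vc p" and x: "Re x \<ge> Ahi" "cmod x \<le> X0" for p x
    proof -
      have xA: "cmod (x - of_real (Re a) + 1) \<le> X"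
      proof -
        have "cmod (x - of_real (Re a) + 1) \<le> cmod (x - of_real (Re a)) + cmod 1" by (rule norm_triangle_ineq)
        also have "cmod (x - of_real (Re a)) \<le> cmod x + cmod (of_real (Re a))" by (rule norm_triangle_ineq4)
        finally show ?thesis using x(2) aAm by (simp add: X_def)
      qed
      have xN: "cmod (x - of_real (Re a)) \<le> N"
      proof -
        have "cmod (x - of_real (Re a)) \<le> cmod x + cmod (of_real (Re a))" by (rule norm_triangle_ineq4)
        also have "\<dots> \<le> X" using x(2) aAm by (simp add: X_def)
        finally show ?thesis using N(3) by simp
      qed
      have "\<bar>Im (p x) - Im (p a)\<bar> \<le>
          2 * e + (2 * e + C * ln (N + c)) * sqrt 2 * sqrt (cmod (x - of_real (Re a) + 1) / N)"
      proof (rule half_disc_oscillation [where m = m and T = T])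
        show "p holomorphic_on {z. m < Re z} \<inter> ball 0 T" using p(1) by (simp add: Om_def)
        show "\<bar>Re a\<bar> + N + 4 < T / 3" using aAm kge(1) N(2) by (simp add: T_def Am_def)
        show "\<bar>Re a\<bar> + \<bar>m\<bar> \<le> c" using aAm by (simp add: c_def)
      qed (use p a Alo C e0 ae N x xN in auto)
      also have "\<dots> \<le> 2 * e + (2 * e + C * ln (N + c)) * sqrt 2 * sqrt (X / N)"
      proof -
        have "sqrt (cmod (x - of_real (Re a) + 1) / N) \<le> sqrt (X / N)"
          using xA N(2) by (intro real_sqrt_le_mono divide_right_mono) auto
        moreover have "(2 * e + C * ln (N + c)) * sqrt 2 \<ge> 0"
          using e0 C N(2) c by (intro mult_nonneg_nonneg add_nonneg_nonneg ln_ge_zero) auto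
        ultimately show ?thesis by (intro add_left_mono mult_left_mono)
      qed
      also have "\<dots> \<le> 3 * e" using N(1) by simp
      finally show ?thesis .
    qed
    have X0: "cmod z \<le> X0" "cmod w \<le> X0" "cmod (G z) \<le> X0" "cmod (G w) \<le> X0"
      by (auto simp: X0_def)
    have "\<bar>Im (P n (G z)) - Im (P n a)\<bar> \<le> 3 * e" "\<bar>Im (P n (G w)) - Im (P n a)\<bar> \<le> 3 * e"
      using osc [OF holPOm bP n(1)] A2 zw X0 by auto
    moreover have "\<bar>Im (Q n z) - Im (Q n a)\<bar> \<le> 3 * e" "\<bar>Im (Q n w) - Im (Q n a)\<bar> \<le> 3 * e"
      using osc [OF holQ bQ n(2)] A2 zw X0 by auto
    \<comment> \<open>\<open>L z - L w\<close> is the difference of \<open>Q n\<close> at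
      \<open>z\<close> and \<open>w\<close> minus the difference of \<open>P n\<close> at
      \<open>G z\<close> and \<open>G w\<close>; the values at \<open>a\<close> cancel.\<close>
    ultimately have "\<bar>Im (L z) - Im (L w)\<bar> \<le> 12 * e" unfolding Q_def plus_complex.sel by linarith
    then show ?thesis by (simp add: e_def)
  qed
  moreover have "A2 > \<rho>" using A2 AhiM M by simp
  ultimately show ?thesis using that by blast
qed

text \<open>A small oscillation of \<open>arg G'\<close> forces \<open>G'\<close> to decay slower than \<open>1/x\<close>.\<close>

lemma not_all_multipliers_real:
  assumes real: "\<And>n p. repelling_periodic_point f n p \<Longrightarrow> multiplier f n p \<in> \<real>"
  shows False
proof -
  obtain L where L: "L holomorphic_on {z. Re z > \<rho>}" "\<And>z. Re z > \<rho> \<Longrightarrow> exp (L z) = deriv G z"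
    by (rule log_deriv_G_exists) (rule that)
  obtain A where A: "A > \<rho>" "\<And>z w. Re z \<ge> A \<Longrightarrow> Re w \<ge> A \<Longrightarrow> \<bar>Im (L z) - Im (L w)\<bar> \<le> 1/8"
    by (rule Im_log_deriv_oscillation [OF real L]) (assumption, assumption, rule that)
  have dL: "cmod (deriv L z) \<le> 3/4 / (Re z - A)" if z: "Re z > A" for z
  proof (rule deriv_bound_of_Im_oscillation)
    have in_A: "Re w > A" if "w \<in> ball z (Re z - A)" for w
      using that complex_Re_le_cmod [of "z - w"] by (simp add: dist_norm)
    show "L holomorphic_on ball z (Re z - A)"
      by (rule holomorphic_on_subset [OF L(1)]) (use in_A A(1) in force)
    show "\<bar>Im (L w) - Im (L z)\<bar> \<le> 1/8" if "w \<in> ball z (Re z - A)" for w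
      using in_A [OF that] z by (intro A(2)) auto
  qed (use z in simp)
  \<comment> \<open>At \<open>x\<close> the slow decay costs at most
    \<open>(3/4) * (4 * B) = 3 * B\<close> from the value at \<open>A + 1\<close>, while the Bloch
    bound forces \<open>Re (L x) \<le> ln 48 - 4 * B\<close>. The gap \<open>B\<close> exceeds the
    difference of the starting values.\<close>
  define B where "B = \<bar>ln 48 - Re (L (of_real (A + 1)))\<bar> + 1"
  define x where "x = A + exp (4 * B)"
  have B: "B > 0" by (simp add: B_def)
  have "exp (4 * B) \<ge> 1" using B by simp
  then have x: "x \<ge> A + 1" by (simp add: x_def)
  have Cx: "Complex t 0 = of_real t" for t by (simp add: complex_eq_iff)
  have "cmod (L (Complex x 0) - L (Complex (A + 1) 0)) \<le> 3/4 * ln ((x - A) / (A + 1 - A))"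
  proof (rule horizontal_log_bound [OF open_halfspace_Re_gt L(1)])
    show "cmod (deriv L (Complex t 0)) \<le> 3/4 / (t - A)" if "A + 1 \<le> t" for t
      using dL [of "Complex t 0"] that by simp
  qed (use x A(1) in auto)
  then have "cmod (L (of_real x) - L (of_real (A + 1))) \<le> 3 * B" by (simp add: Cx x_def)
  then have "\<bar>Re (L (of_real x)) - Re (L (of_real (A + 1)))\<bar> \<le> 3 * B"
    using abs_Re_le_cmod [of "L (of_real x) - L (of_real (A + 1))"] by simp
  moreover have "Re (L (of_real x)) \<le> ln 48 - 4 * B"
  proof -
    have "exp (Re (L (of_real x))) = cmod (deriv G (of_real x))"
      using L(2) [of "of_real x"] x A(1) by (metis Re_complex_of_real less_add_one less_le_trans less_trans norm_exp_eq_Re)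
    also have "\<dots> \<le> 48 / (x - \<rho>)" using deriv_G_bound [of "of_real x"] x A(1) by simp
    also have "\<dots> \<le> 48 / exp (4 * B)" 
    proof (rule divide_left_mono)
      show le: "exp (4 * B) \<le> x - \<rho>" using A(1) by (simp add: x_def)
      have "exp (4 * B) > 0" by simp
      then show "(x - \<rho>) * exp (4 * B) > 0" using le by (intro mult_pos_pos less_le_trans [OF _ le])
    qed simp
    also have "\<dots> = exp (ln 48 - 4 * B)" by (simp add: exp_diff)
    finally show ?thesis by simp
  qed
  moreover have "ln 48 - Re (L (of_real (A + 1))) < B" unfolding B_def by linarith
  ultimately show False by linarith
qed

end

theorem theorem1p1:
  shows "\<not> (\<exists>f :: complex \<Rightarrow> complex.
           entire_transcendental f \<and> class_S f \<and>
           (\<forall>n p. repelling_periodic_point f n p \<longrightarrow> multiplier f n p \<in> \<real>))"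
proof
  assume "\<exists>f :: complex \<Rightarrow> complex.
           entire_transcendental f \<and> class_S f \<and>
           (\<forall>n p. repelling_periodic_point f n p \<longrightarrow> multiplier f n p \<in> \<real>)"
  then obtain f where f: "entire_transcendental f" "class_S f"
      and real: "\<And>n p. repelling_periodic_point f n p \<Longrightarrow> multiplier f n p \<in> \<real>"
    by blast
  obtain G \<rho> where "log_tract f G \<rho>" using log_tract_exists [OF f] by blast
  then show False using real by (rule log_tract.not_all_multipliers_real)
qed

end
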